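(* Let $K$ be an algebraic number field. There is a positive real constant $c_K$, depending only on the field $K$, such that for every $n\geq 1$, every line $L$ in $\mathbf{P}^n_K$ (defined over $K$) and every positive real number $B$, the counting function $$N_L(B)=\operatorname{card}\{P\in L(K)\mid H(P)\leq B\}$$ satisfies $$N_L(B)\leq \frac{c_K}{H(L)}B^2+1.$$
   Context: Heights are multiplicative and are relative to $K$ (not normalised to be independent of the field). For a $K$-rational point $[x_0:\ldots:x_m]\in\mathbf{P}^m(K)$, $$H([x_0:\ldots:x_m])=\prod_v\max_i\{|x_i|_v\},$$ where $v$ ranges over all (equivalence classes of) valuations of $K$ and the absolute values $|\cdot|_v$ are normalised in the standard way relative to $K$: $|x|_v=|\sigma(x)|$ for a real embedding $\sigma$, $|x|_v=|\tau(x)|^2$ for a pair of complex conjugate embeddings $\tau,\bar\tau$, and $|x|_v=(\#\mathcal{O}_K/\mathfrak{p})^{-\operatorname{ord}_{\mathfrak{p}}(x)}$ for a finite place corresponding to a prime ideal $\mathfrak{p}$ of the ring of integers $\mathcal{O}_K$. The product formula then makes $H$ well defined. Height of a line: a line $L\subset\mathbf{P}^n_K$ corresponds to a 2-dimensional subspace of $K^{n+1}$, spanned by vectors $(a_0,\ldots,a_n)$ and $(b_0,\ldots,b_n)$. Its height is the height of its Plücker point, $$H(L)=H\big((a_0dx_0+\cdots+a_ndx_n)\wedge(b_0dx_0+\cdots+b_ndx_n)\big),$$ where the wedge product is viewed as a point of $\mathbf{P}^{(n^2+n)/2-1}(K)$ with homogeneous coordinates $a_ib_j-a_jb_i$ for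 $0\leq i<j\leq n$ (the coefficients of $dx_i\wedge dx_j$). *)

theory Defs
  imports
    Complex_Main
    "HOL-Library.Function_Algebras"
    "HOL-Computational_Algebra.Polynomial"
    "HOL-Algebra.QuotRing"
    "HOL-Algebra.Ideal_Product"
begin

section \<open>Number fields\<close>

global_interpretation rat_space: vector_space "\<lambda>(q::rat) (x::'k::field_char_0). of_rat q * x"
  by unfold_locales (simp_all add: algebra_simps of_rat_add of_rat_mult)

definition number_field :: "'k::field_char_0 itself \<Rightarrow> bool" where
  "number_field _ \<longleftrightarrow> (\<exists>S::'k set. finite S \<and> rat_space.span S = UNIV)"

definition embedding :: "('k::field \<Rightarrow> 'l::field) \<Rightarrow> bool" where
  "embedding \<sigma> \<longleftrightarrow> \<sigma> 1 = 1 \<and> (\<forall>x y. \<sigma> (x + y) = \<sigma> x + \<sigma> y) \<and> (\<forall>x y. \<sigma> (x * y) = \<sigma> x * \<sigma> y)"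

definition integer_ring :: "'k::field_char_0 ring" where
  "integer_ring = \<lparr>carrier = {x. algebraic_int x}, monoid.mult = (*), one = 1,
                   ring.zero = 0, add = (+)\<rparr>"

text \<open>On integers, the order at \<open>p\<close> is the exponent of the highest power of \<open>p\<close> containing
  (equivalently, dividing the principal ideal of) the element. It is extended to nonzero elements
  of the field by \<open>ord (a / b) = ord a - ord b\<close>; its value at 0 is never used.\<close>

definition integer_ord :: "'k::field_char_0 set \<Rightarrow> 'k \<Rightarrow> nat" where
  "integer_ord p a = (GREATEST m. a \<in> p [^]\<^bsub>ideals_set integer_ring\<^esub> (m::nat))"

definition ord_at :: "'k::field_char_0 set \<Rightarrow> 'k \<Rightarrow> int" where
  "ord_at p x = (THE k. \<exists>a\<in>carrier integer_ring. \<exists>b\<in>carrier integer_ring. a \<noteq> 0 \<and> b \<noteq> 0 \<and>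
     x = a / b \<and> k = int (integer_ord p a) - int (integer_ord p b))"

definition ideal_norm :: "'k::field_char_0 set \<Rightarrow> nat" where
  "ideal_norm p = card (carrier (integer_ring Quot p))"


section \<open>Places and normalised absolute values\<close>

text \<open>A complex place is a pair of complex conjugate embeddings, represented as the two-element
  set of these embeddings, so that each pair contributes a single place.\<close>

datatype 'k place =
    Real_Place "'k \<Rightarrow> real"
  | Complex_Place "('k \<Rightarrow> complex) set"
  | Finite_Place "'k set"

definition places :: "'k::field_char_0 place set" where
  "places = {Real_Place \<sigma> |\<sigma>. embedding \<sigma>}
          \<union> {Complex_Place {\<tau>, cnj \<circ> \<tau>} |\<tau>. embedding \<tau> \<and> \<not> range \<tau> \<subseteq> \<real>}
          \<union> {Finite_Place p |p. primeideal p integer_ring \<and> p \<noteq> {0}}"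

fun place_abs :: "'k::field_char_0 place \<Rightarrow> 'k \<Rightarrow> real" where
  "place_abs (Real_Place \<sigma>) x = \<bar>\<sigma> x\<bar>"
| "place_abs (Complex_Place T) x = (cmod ((SOME \<tau>. \<tau> \<in> T) x))\<^sup>2"
| "place_abs (Finite_Place p) x =
     (if x = 0 then 0 else real (ideal_norm p) powi (- ord_at p x))"


section \<open>Heights\<close>

text \<open>The height of a vector of homogeneous coordinates indexed by a finite set \<open>I\<close>.
  For a number field and a nonzero vector all but finitely many factors are 1, so the infinite
  product over all places is the finite product of the factors different from 1.\<close>

definition local_max :: "'i set \<Rightarrow> ('i \<Rightarrow> 'k::field_char_0) \<Rightarrow> 'k place \<Rightarrow> real" where
  "local_max I x v = Max ((\<lambda>i. place_abs v (x i)) ` I)"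

definition coord_height :: "'i set \<Rightarrow> ('i \<Rightarrow> 'k::field_char_0) \<Rightarrow> real" where
  "coord_height I x = (\<Prod>v\<in>{v \<in> places. local_max I x v \<noteq> 1}. local_max I x v)"


section \<open>Projective space, lines and the counting function\<close>

text \<open>\<open>K\<^sup>n\<^sup>+\<^sup>1\<close> is modelled as the space of functions \<open>nat \<Rightarrow> K\<close> vanishing beyond \<open>n\<close>.\<close>

definition vec_scale :: "'k::field \<Rightarrow> (nat \<Rightarrow> 'k) \<Rightarrow> nat \<Rightarrow> 'k" where
  "vec_scale c x = (\<lambda>i. c * x i)"

global_interpretation coords: vector_space vec_scale
  by unfold_locales (auto simp: vec_scale_def plus_fun_def algebra_simps)

definition coord_space :: "nat \<Rightarrow> (nat \<Rightarrow> 'k::field) set" where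
  "coord_space n = {x. \<forall>i>n. x i = 0}"

definition proj_rel :: "nat \<Rightarrow> ((nat \<Rightarrow> 'k::field) \<times> (nat \<Rightarrow> 'k)) set" where
  "proj_rel n = {(x, y). x \<in> coord_space n - {0} \<and> y \<in> coord_space n - {0} \<and>
                         (\<exists>c. c \<noteq> 0 \<and> y = vec_scale c x)}"

definition proj_space :: "nat \<Rightarrow> (nat \<Rightarrow> 'k::field) set set" where
  "proj_space n = (coord_space n - {0}) // proj_rel n"

text \<open>By the product formula neither height below depends on the representative, respectively
  the basis, that is chosen.\<close>

definition point_height :: "nat \<Rightarrow> (nat \<Rightarrow> 'k::field_char_0) set \<Rightarrow> real" where
  "point_height n P = coord_height {..n} (SOME x. x \<in> P)"

text \<open>A line in projective \<open>n\<close>-space is given by the corresponding 2-dimensional subspace \<open>L\<close>.\<close>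

definition proj_line :: "nat \<Rightarrow> (nat \<Rightarrow> 'k::field) set \<Rightarrow> bool" where
  "proj_line n L \<longleftrightarrow> L \<subseteq> coord_space n \<and> coords.subspace L \<and> coords.dim L = 2"

definition line_points :: "nat \<Rightarrow> (nat \<Rightarrow> 'k::field) set \<Rightarrow> (nat \<Rightarrow> 'k) set set" where
  "line_points n L = {P \<in> proj_space n. P \<subseteq> L}"

definition pluecker :: "(nat \<Rightarrow> 'k::field) \<Rightarrow> (nat \<Rightarrow> 'k) \<Rightarrow> nat \<times> nat \<Rightarrow> 'k" where
  "pluecker a b = (\<lambda>(i, j). a i * b j - a j * b i)"

definition line_height :: "nat \<Rightarrow> (nat \<Rightarrow> 'k::field_char_0) set \<Rightarrow> real" where
  "line_height n L =
    (let (a, b) = (SOME (a, b). a \<noteq> b \<and> coords.independent {a, b} \<and> coords.span {a, b} = L)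
     in coord_height {(i, j). i < j \<and> j \<le> n} (pluecker a b))"

definition bounded_points :: "nat \<Rightarrow> (nat \<Rightarrow> 'k::field_char_0) set \<Rightarrow> real \<Rightarrow> (nat \<Rightarrow> 'k) set set" where
  "bounded_points n L B = {P \<in> line_points n L. point_height n P \<le> B}"

definition line_count :: "nat \<Rightarrow> (nat \<Rightarrow> 'k::field_char_0) set \<Rightarrow> real \<Rightarrow> nat" where
  "line_count n L B = card (bounded_points n L B)"

end

theory Submission
  imports Defs "Jordan_Normal_Form.Char_Poly"
begin

text \<open>
  Points on a line repel each other. For points \<open>P\<close>, \<open>Q\<close> of \<open>L\<close> with coordinate vectors \<open>x\<close>, \<open>y\<close> the
  vector \<open>x \<and> y\<close> is a scalar multiple of the Pluecker vector of \<open>L\<close>, so by the product formula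
  \<open>H(L)\<close> is the product of the local sizes \<open>\<bar>x \<and> y\<bar>\<^sub>v\<close> as soon as \<open>P \<noteq> Q\<close>. At a finite place
  \<open>\<bar>x \<and> y\<bar>\<^sub>v \<le> \<bar>x\<bar>\<^sub>v \<bar>y\<bar>\<^sub>v\<close>. If at every infinite place the two points are within \<open>\<epsilon>\<close> of each other, in the
  sense that \<open>\<bar>x \<and> y\<bar>\<^sub>v\<close> is at most \<open>\<bar>x\<bar>\<^sub>v \<bar>y\<bar>\<^sub>v\<close> times the power of \<open>\<epsilon>\<close> given by the local degree, then
  \<open>H(L) \<le> \<epsilon>\<^sup>d H(P) H(Q) \<le> \<epsilon>\<^sup>d B\<^sup>2\<close>, where \<open>d\<close> is the sum of the local degrees. Choose \<open>\<epsilon>\<close> with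
  \<open>\<epsilon>\<^sup>d = H(L) / (2 B\<^sup>2)\<close>. Then every product over the infinite places of cells of size \<open>\<epsilon>\<close> contains at
  most one point of height at most \<open>B\<close>. If \<open>\<epsilon> > 2\<close> one cell suffices, which accounts for the
  summand 1; otherwise at most \<open>(20 / \<epsilon>)\<^sup>d\<close> cells do, which is a constant times \<open>B\<^sup>2 / H(L)\<close>
  (\<open>line_count_bound\<close>). The number of cells does not depend on \<open>n\<close>: at each infinite place the
  points of the line are located by the two coordinates at which the Pluecker vector is largest.

  The bulk of the work is the product formula. The finite absolute values are multiplicative and
  ultrametric because the local ring at a prime ideal is a discrete valuation ring. This is
  obtained directly from the finiteness of the quotients of the ring of integers \<open>O\<close>: a nonzero
  annihilator of \<open>p\<close> modulo \<open>a\<close> yields a nonintegral element that carries \<open>p\<close> into \<open>O\<close>; it cannot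
  carry \<open>p\<close> into \<open>p\<close>, because repetitions among its powers would make it integral
  (\<open>local_uniformizer\<close>). The index
  \<open>[O : a O]\<close> is the product of the numbers \<open>N(p) ^ ord\<^sub>p(a)\<close>, by successively enlarging an
  ideal by quotients isomorphic to \<open>O / p\<close> (\<open>index_factorisation\<close>). The same index is the product
  of the absolute values of the conjugates of \<open>a\<close> (\<open>index_principal\<close>): both sides are
  multiplicative, hence it is enough to compare them up to a constant, and that is the pigeonhole
  principle for a lattice of integers. The lattice and the full set of conjugates come from a
  primitive element (\<open>primitive_element\<close>, \<open>embs_bij_roots\<close>, \<open>integer_lattice\<close>).
\<close>

section \<open>Algebraic integers form a ring\<close>

definition int_span :: "('i \<Rightarrow> 'k::field_char_0) \<Rightarrow> 'i set \<Rightarrow> 'k set" where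
  "int_span b I = range (\<lambda>c::'i \<Rightarrow> int. \<Sum>k\<in>I. of_int (c k) * b k)"

lemma int_span_add:
  assumes "u \<in> int_span b I" "v \<in> int_span b I"
  shows "u + v \<in> int_span b I"
proof -
  obtain c d where "u = (\<Sum>k\<in>I. of_int (c k) * b k)" "v = (\<Sum>k\<in>I. of_int (d k) * b k)"
    using assms by (auto simp: int_span_def)
  then have "u + v = (\<Sum>k\<in>I. of_int (c k + d k) * b k)"
    by (simp add: sum.distrib distrib_right)
  then show ?thesis
    by (auto simp: int_span_def intro!: image_eqI[where x = "\<lambda>k. c k + d k"])
qed

lemma int_span_scale: "u \<in> int_span b I \<Longrightarrow> of_int m * u \<in> int_span b I"
  by (auto simp: int_span_def sum_distrib_left mult.assoc [symmetric]
      intro!: image_eqI[where x = "\<lambda>k. m * c k" for c])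

lemma int_span_zero: "0 \<in> int_span b I"
  by (auto simp: int_span_def intro!: image_eqI[where x = "\<lambda>k. 0"])

lemma int_span_sum: "(\<And>j. j \<in> J \<Longrightarrow> f j \<in> int_span b I) \<Longrightarrow> sum f J \<in> int_span b I"
  by (induction J rule: infinite_finite_induct) (auto intro: int_span_add int_span_zero)

lemma int_span_base:
  assumes "finite I" "k \<in> I"
  shows "b k \<in> int_span b I"
proof -
  have "b k = (\<Sum>j\<in>I. of_int (if j = k then 1 else 0) * b j)"
    using assms by (simp add: if_distrib[of of_int] if_distrib[of "\<lambda>x. x * _"] cong: if_cong)
  then show ?thesis by (auto simp: int_span_def)
qed

lemma int_span_stable:
  assumes "\<And>k. k \<in> I \<Longrightarrow> x * b k \<in> int_span b I" and "u \<in> int_span b I"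
  shows "x * u \<in> int_span b I"
proof -
  obtain c where "u = (\<Sum>k\<in>I. of_int (c k) * b k)"
    using assms by (auto simp: int_span_def)
  then have "x * u = (\<Sum>k\<in>I. of_int (c k) * (x * b k))"
    by (simp add: sum_distrib_left algebra_simps)
  then show ?thesis
    using assms by (auto intro!: int_span_sum int_span_scale)
qed

text \<open>An element multiplying a nonzero finitely generated group of numbers into itself is an
  eigenvalue of an integer matrix, hence a root of its monic characteristic polynomial.\<close>

lemma algebraic_int_if_stable:
  fixes b :: "'i \<Rightarrow> 'k::field_char_0"
  assumes "finite I" and nz: "\<exists>k\<in>I. b k \<noteq> 0"
    and stable: "\<And>k. k \<in> I \<Longrightarrow> x * b k \<in> int_span b I"
  shows "algebraic_int x"
proof -
  define n where "n = card I"
  obtain h where h: "bij_betw h {0..<n} I"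
    using ex_bij_betw_nat_finite[OF \<open>finite I\<close>] n_def by auto
  have "\<exists>c::'i \<Rightarrow> int. x * b k = (\<Sum>j\<in>I. of_int (c j) * b j)" if "k \<in> I" for k
    using stable[OF that] by (auto simp: int_span_def)
  then obtain c :: "'i \<Rightarrow> 'i \<Rightarrow> int"
    where c: "\<And>k. k \<in> I \<Longrightarrow> x * b k = (\<Sum>j\<in>I. of_int (c k j) * b j)"
    by metis
  define A where "A = mat n n (\<lambda>(i, j). c (h i) (h j))"
  define B :: "'k mat" where "B = map_mat of_int A"
  define v where "v = vec n (\<lambda>i. b (h i))"
  have A: "A \<in> carrier_mat n n" and B: "B \<in> carrier_mat n n"
    by (auto simp: A_def B_def)
  have "B *\<^sub>v v = x \<cdot>\<^sub>v v"
  proof (rule eq_vecI)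
    fix i assume "i < dim_vec (x \<cdot>\<^sub>v v)"
    then have i: "i < n" by (simp add: v_def)
    then have hi: "h i \<in> I" using h by (auto simp: bij_betw_def)
    have "(B *\<^sub>v v) $ i = (\<Sum>j = 0..<n. of_int (c (h i) (h j)) * b (h j))"
      using i by (simp add: B_def A_def v_def scalar_prod_def)
    also have "\<dots> = (\<Sum>j\<in>I. of_int (c (h i) j) * b j)"
      by (rule sum.reindex_bij_betw[OF h])
    finally show "(B *\<^sub>v v) $ i = (x \<cdot>\<^sub>v v) $ i"
      using i c[OF hi] by (simp add: v_def)
  qed (simp add: B_def A_def v_def)
  moreover have "v \<noteq> 0\<^sub>v n"
  proof -
    obtain k where "k \<in> I" "b k \<noteq> 0" using nz by blast
    moreover obtain i where "i < n" "k = h i"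
      using h \<open>k \<in> I\<close> by (auto simp: bij_betw_def)
    ultimately show ?thesis by (auto simp: v_def dest!: arg_cong[where f = "\<lambda>w. w $ i"])
  qed
  ultimately have "eigenvalue B x"
    unfolding eigenvalue_def eigenvector_def by (auto simp: B_def A_def v_def intro!: exI[of _ v])
  then have "poly (char_poly B) x = 0"
    using eigenvalue_root_char_poly[OF B] by simp
  moreover have "char_poly B = map_poly of_int (char_poly A)"
    unfolding B_def by (rule of_int_hom.char_poly_hom[OF A])
  ultimately show ?thesis
    unfolding algebraic_int_altdef_ipoly using degree_monic_char_poly[OF A] by auto
qed

text \<open>The powers of an algebraic integer of degree \<open>n\<close> are integer combinations of the first
  \<open>n\<close>; for two of them the products of powers span a group stable under both.\<close>

lemma algebraic_int_monomial_span:
  fixes x y :: "'k::field_char_0"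
  assumes x: "algebraic_int x" and y: "algebraic_int y"
  obtains I and b :: "nat \<times> nat \<Rightarrow> 'k" where "finite I" "\<exists>k\<in>I. b k \<noteq> 0"
    "\<And>k. k \<in> I \<Longrightarrow> x * b k \<in> int_span b I" "\<And>k. k \<in> I \<Longrightarrow> y * b k \<in> int_span b I"
proof -
  have power_reduce: "\<exists>n>0. \<exists>c. z ^ n = (\<Sum>i<n. of_int (c i) * z ^ i)" if z: "algebraic_int z" for z :: 'k
  proof -
    obtain p where p: "poly (map_poly of_int p) z = 0" "lead_coeff p = 1"
      using z unfolding algebraic_int_altdef_ipoly by blast
    define n where "n = degree p"
    have "n > 0"
      using p by (intro Nat.gr0I) (auto simp: n_def elim!: degree_eq_zeroE)
    have "(\<Sum>i\<le>n. of_int (coeff p i) * z ^ i) = 0"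
      using p by (simp add: poly_altdef degree_map_poly coeff_map_poly n_def)
    then have "(\<Sum>i<n. of_int (coeff p i) * z ^ i) + z ^ n = 0"
      using p(2) unfolding lessThan_Suc_atMost[symmetric] sum.lessThan_Suc by (simp add: n_def)
    then have "z ^ n = - (\<Sum>i<n. of_int (coeff p i) * z ^ i)"
      by (simp only: add_eq_0_iff)
    also have "\<dots> = (\<Sum>i<n. of_int (- coeff p i) * z ^ i)"
      by (simp add: sum_negf)
    finally have "z ^ n = (\<Sum>i<n. of_int (- coeff p i) * z ^ i)" .
    with \<open>n > 0\<close> show ?thesis
      by (intro exI[of _ n] conjI exI[of _ "\<lambda>i. - coeff p i"])
  qed
  obtain n c where n: "n > 0" "x ^ n = (\<Sum>i<n. of_int (c i) * x ^ i)"
    using power_reduce[OF x] by blast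
  obtain m d where m: "m > 0" "y ^ m = (\<Sum>i<m. of_int (d i) * y ^ i)"
    using power_reduce[OF y] by blast
  define I where "I = {..<n} \<times> {..<m}"
  define b where "b = (\<lambda>(i, j). x ^ i * y ^ j)"
  have [simp]: "finite I" by (simp add: I_def)
  have base: "x ^ i * y ^ j \<in> int_span b I" if "i < n" "j < m" for i j
    using int_span_base[of I "(i, j)" b] that by (simp add: I_def b_def)
  have "x * (x ^ i * y ^ j) \<in> int_span b I" if "i < n" "j < m" for i j
  proof (cases "Suc i < n")
    case True
    then show ?thesis using base[of "Suc i" j] that by (simp add: mult.assoc)
  next
    case False
    then have "n = Suc i" using that by simp
    then have "x * (x ^ i * y ^ j) = x ^ n * y ^ j" by (simp add: mult.assoc)
    also have "\<dots> = (\<Sum>i<n. of_int (c i) * (x ^ i * y ^ j))"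
      by (simp add: n sum_distrib_right mult.assoc)
    also have "\<dots> \<in> int_span b I"
      using that by (intro int_span_sum int_span_scale base) auto
    finally show ?thesis .
  qed
  moreover have "y * (x ^ i * y ^ j) \<in> int_span b I" if "i < n" "j < m" for i j
  proof (cases "Suc j < m")
    case True
    then show ?thesis using base[of i "Suc j"] that by (simp add: algebra_simps)
  next
    case False
    then have "m = Suc j" using that by simp
    then have "y * (x ^ i * y ^ j) = x ^ i * y ^ m" by (simp add: algebra_simps)
    also have "\<dots> = (\<Sum>j<m. of_int (d j) * (x ^ i * y ^ j))"
      by (simp add: m sum_distrib_left algebra_simps)
    also have "\<dots> \<in> int_span b I"
      using that by (intro int_span_sum int_span_scale base) auto
    finally show ?thesis .
  qed
  moreover have "\<exists>k\<in>I. b k \<noteq> 0"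
    using n m by (intro bexI[of _ "(0, 0)"]) (auto simp: I_def b_def)
  ultimately show thesis
    by (intro that[of I b]) (auto simp: I_def b_def)
qed

lemma algebraic_int_add:
  fixes x y :: "'k::field_char_0"
  assumes "algebraic_int x" "algebraic_int y"
  shows "algebraic_int (x + y)"
proof -
  obtain I and b :: "nat \<times> nat \<Rightarrow> 'k" where I: "finite I" "\<exists>k\<in>I. b k \<noteq> 0"
    "\<And>k. k \<in> I \<Longrightarrow> x * b k \<in> int_span b I" "\<And>k. k \<in> I \<Longrightarrow> y * b k \<in> int_span b I"
    using algebraic_int_monomial_span[OF assms] by metis
  show ?thesis
    by (rule algebraic_int_if_stable[of I b]) (auto simp: distrib_right I intro!: int_span_add)
qed

lemma algebraic_int_mult:
  fixes x y :: "'k::field_char_0"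
  assumes "algebraic_int x" "algebraic_int y"
  shows "algebraic_int (x * y)"
proof -
  obtain I and b :: "nat \<times> nat \<Rightarrow> 'k" where I: "finite I" "\<exists>k\<in>I. b k \<noteq> 0"
    "\<And>k. k \<in> I \<Longrightarrow> x * b k \<in> int_span b I" "\<And>k. k \<in> I \<Longrightarrow> y * b k \<in> int_span b I"
    using algebraic_int_monomial_span[OF assms] by metis
  show ?thesis
  proof (rule algebraic_int_if_stable[of I b])
    fix k assume "k \<in> I"
    then have "x * (y * b k) \<in> int_span b I"
      using I int_span_stable[of I x b] by blast
    then show "x * y * b k \<in> int_span b I" by (simp add: mult.assoc)
  qed (use I in auto)
qed

lemma algebraic_int_diff:
  fixes x y :: "'k::field_char_0"
  shows "algebraic_int x \<Longrightarrow> algebraic_int y \<Longrightarrow> algebraic_int (x - y)"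
  using algebraic_int_add[of x "- y"] by simp

lemma algebraic_int_power:
  fixes x :: "'k::field_char_0"
  shows "algebraic_int x \<Longrightarrow> algebraic_int (x ^ n)"
  by (induction n) (auto intro: algebraic_int_mult)

lemma algebraic_int_sum:
  fixes f :: "'i \<Rightarrow> 'k::field_char_0"
  shows "(\<And>i. i \<in> I \<Longrightarrow> algebraic_int (f i)) \<Longrightarrow> algebraic_int (sum f I)"
  by (induction I rule: infinite_finite_induct) (auto intro: algebraic_int_add)

lemma algebraic_int_prod:
  fixes f :: "'i \<Rightarrow> 'k::field_char_0"
  shows "(\<And>i. i \<in> I \<Longrightarrow> algebraic_int (f i)) \<Longrightarrow> algebraic_int (prod f I)"
  by (induction I rule: infinite_finite_induct) (auto intro: algebraic_int_mult)

text \<open>A monic integer equation of least degree reads \<open>c + x q(x) = 0\<close> with \<open>c \<noteq> 0\<close>, for otherwise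
  \<open>q\<close> would be an equation of smaller degree. So \<open>- q(x)\<close> is the cofactor, up to the sign of \<open>c\<close>.\<close>

lemma algebraic_int_dvd_nat:
  fixes x :: "'k::field_char_0"
  assumes "algebraic_int x" "x \<noteq> 0"
  obtains m y where "m > 0" "algebraic_int y" "x * y = of_nat m"
proof -
  define P where "P = (\<lambda>p::int poly. poly (map_poly of_int p) x = 0 \<and> lead_coeff p = 1)"
  obtain p where "P p" using assms unfolding algebraic_int_altdef_ipoly P_def by auto
  then obtain p where p: "P p" and least: "\<And>q. degree q < degree p \<Longrightarrow> \<not> P q"
    using exists_least_iff[of "\<lambda>n. \<exists>p. P p \<and> degree p = n"] by blast
  obtain c q where pq: "p = pCons c q" by (cases p)
  have "p \<noteq> 0" using p by (auto simp: P_def)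
  have mp: "map_poly of_int (pCons c q) = pCons (of_int c :: 'k) (map_poly of_int q)"
    by (rule poly_eqI) (simp add: coeff_map_poly coeff_pCons split: nat.split)
  have qnz: "q \<noteq> 0"
    using p by (auto simp: P_def pq)
  have eq: "of_int c + x * poly (map_poly of_int q) x = 0"
    using p by (simp add: P_def pq mp)
  have "c \<noteq> 0"
  proof
    assume "c = 0"
    then have "P q" using eq assms p qnz by (simp add: P_def pq)
    moreover have "degree q < degree p" using qnz by (simp add: pq)
    ultimately show False using least by blast
  qed
  define y where "y = - of_int (sgn c) * poly (map_poly of_int q) x"
  have "algebraic_int (poly (map_poly of_int q) x)"
    unfolding poly_altdef using assms
    by (intro algebraic_int_sum algebraic_int_mult algebraic_int_power) (auto simp: coeff_map_poly)
  then have "algebraic_int y" unfolding y_def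
    by (intro algebraic_int_mult algebraic_int_minus) auto
  moreover have "x * y = of_nat (nat \<bar>c\<bar>)"
  proof -
    have "x * y = of_int (sgn c) * (- (x * poly (map_poly of_int q) x))"
      by (simp add: y_def)
    also have "- (x * poly (map_poly of_int q) x) = of_int c"
      using eq by (simp add: add_eq_0_iff2)
    also have "of_int (sgn c) * of_int c = (of_int \<bar>c\<bar> :: 'k)"
      by (simp flip: of_int_mult add: abs_sgn mult.commute)
    finally show ?thesis by simp
  qed
  ultimately show thesis using that[of "nat \<bar>c\<bar>" y] \<open>c \<noteq> 0\<close> by simp
qed


section \<open>A primitive element\<close>

definition rat_indep :: "('i \<Rightarrow> 'k::field_char_0) \<Rightarrow> 'i set \<Rightarrow> bool" where
  "rat_indep f I \<longleftrightarrow> (\<forall>c::'i \<Rightarrow> rat. (\<Sum>i\<in>I. of_rat (c i) * f i) = 0 \<longrightarrow> (\<forall>i\<in>I. c i = 0))"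

lemma rat_indepD:
  "rat_indep f I \<Longrightarrow> (\<Sum>i\<in>I. of_rat (c i) * f i) = 0 \<Longrightarrow> i \<in> I \<Longrightarrow> c i = 0"
  by (auto simp: rat_indep_def)

lemma rat_indep_inj_on:
  assumes "rat_indep f I" "finite I"
  shows "inj_on f I"
proof (rule inj_onI, rule ccontr)
  fix i j assume ij: "i \<in> I" "j \<in> I" "f i = f j" "i \<noteq> j"
  define c :: "_ \<Rightarrow> rat" where "c = (\<lambda>k. (if k = i then 1 else 0) - (if k = j then 1 else 0))"
  have "of_rat (c k) * f k = (if k = i then f i else 0) - (if k = j then f j else 0)" for k
    by (simp add: c_def)
  then have "(\<Sum>k\<in>I. of_rat (c k) * f k) = 0"
    using ij assms by (simp add: sum_subtractf)
  from rat_indepD[OF assms(1) this ij(1)] show False using ij by (simp add: c_def)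
qed

lemma rat_indep_independent:
  assumes "rat_indep f I" "finite I"
  shows "rat_space.independent (f ` I)"
proof (rule rat_space.independent_if_scalars_zero)
  fix g :: "'b \<Rightarrow> rat" and x
  assume "(\<Sum>x\<in>f ` I. of_rat (g x) * x) = 0" "x \<in> f ` I"
  then show "g x = 0"
    using rat_indepD[OF assms(1), of "\<lambda>i. g (f i)"] rat_indep_inj_on[OF assms]
    by (auto simp: sum.reindex)
qed (use assms in auto)

lemma rat_indep_card_le:
  fixes f :: "'i \<Rightarrow> 'k::field_char_0" and S :: "'k set"
  assumes "finite S" "rat_space.span S = UNIV" "rat_indep f I" "finite I"
  shows "card I \<le> card S"
  using rat_space.independent_span_bound[OF assms(1) rat_indep_independent[OF assms(3,4)]]
    card_image[OF rat_indep_inj_on[OF assms(3,4)]] assms(2) by simp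

text \<open>The coordinates with respect to a basis that extends the family.\<close>

lemma dual_functionals:
  fixes f :: "'i \<Rightarrow> 'k::field_char_0"
  assumes "rat_indep f I" "finite I"
  obtains \<phi> :: "'i \<Rightarrow> 'k \<Rightarrow> rat" where
    "\<And>j J (c :: 'j \<Rightarrow> rat) x. \<phi> j (\<Sum>k\<in>J. of_rat (c k) * x k) = (\<Sum>k\<in>J. c k * \<phi> j (x k))"
    "\<And>i j. i \<in> I \<Longrightarrow> j \<in> I \<Longrightarrow> \<phi> j (f i) = (if i = j then 1 else 0)"
proof -
  define B where "B = rat_space.extend_basis (f ` I)"
  note ind = rat_indep_independent[OF assms]
  have B: "rat_space.independent B" "rat_space.span B = UNIV" "f ` I \<subseteq> B"
    using rat_space.independent_extend_basis[OF ind] rat_space.span_extend_basis[OF ind]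
      rat_space.extend_basis_superset[OF ind] by (simp_all add: B_def)
  show thesis
  proof (rule that[of "\<lambda>j x. rat_space.representation B x (f j)"])
    fix j J and c :: "'j \<Rightarrow> rat" and x
    show "rat_space.representation B (\<Sum>k\<in>J. of_rat (c k) * x k) (f j) =
        (\<Sum>k\<in>J. c k * rat_space.representation B (x k) (f j))"
      using B by (simp add: rat_space.representation_sum rat_space.representation_scale)
  next
    fix i j assume ij: "i \<in> I" "j \<in> I"
    then have "f i \<in> B" using B by blast
    then show "rat_space.representation B (f i) (f j) = (if i = j then 1 else 0)"
      using inj_on_eq_iff[OF rat_indep_inj_on[OF assms] ij(2,1)]
      by (auto simp: rat_space.representation_basis[OF B(1)])
  qed
qed

text \<open>Independence is an open condition: in coordinates dual to the family at \<open>0\<close>, the family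
  at a small \<open>t\<close> has a strictly diagonally dominant, hence nonsingular, matrix.\<close>

lemma rat_indep_perturb:
  fixes u :: "'i \<Rightarrow> 'k::field_char_0 poly"
  assumes "rat_indep (\<lambda>i. poly (u i) 0) I" and fin: "finite I"
  shows "\<exists>t::rat. t \<noteq> 0 \<and> rat_indep (\<lambda>i. poly (u i) (of_rat t)) I"
proof -
  obtain \<phi> :: "'i \<Rightarrow> 'k \<Rightarrow> rat" where
    lin: "\<And>j J (c :: nat \<Rightarrow> rat) x. \<phi> j (\<Sum>k\<in>J. of_rat (c k) * x k) = (\<Sum>k\<in>J. c k * \<phi> j (x k))"
    and dual: "\<And>i j. i \<in> I \<Longrightarrow> j \<in> I \<Longrightarrow> \<phi> j (poly (u i) 0) = (if i = j then 1 else 0)"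
    using dual_functionals[OF assms] by metis
  have add: "\<phi> j (x + y) = \<phi> j x + \<phi> j y" and scale: "\<phi> j (of_rat q * x) = q * \<phi> j x" for j x y q
    using lin[of j "\<lambda>k. 1" "\<lambda>k. if k = 0 then x else y" "{0, 1}"]
      lin[of j "\<lambda>k. q" "\<lambda>k. x" "{0}"] by simp_all
  have zero: "\<phi> j 0 = 0" for j
    using scale[of j 0 0] by simp
  have sum: "\<phi> j (sum x J) = (\<Sum>k\<in>J. \<phi> j (x k))" for j J and x :: "'j \<Rightarrow> 'k"
    by (induction J rule: infinite_finite_induct) (auto simp: add zero)
  define e where "e = (\<lambda>j i t. \<Sum>k<degree (u i). t ^ k * \<phi> j (coeff (u i) (Suc k)))"
  define C where "C = (\<Sum>j\<in>I. \<Sum>i\<in>I. \<Sum>k<degree (u i). \<bar>\<phi> j (coeff (u i) (Suc k))\<bar>)"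
  have "C \<ge> 0" unfolding C_def by (intro sum_nonneg) auto
  define t where "t = 1 / (C + 1)"
  have t: "0 < t" "t \<le> 1" "t * C < 1" using \<open>C \<ge> 0\<close> by (auto simp: t_def field_simps)
  have expand: "poly (u i) (of_rat t) =
      poly (u i) 0 + of_rat t * (\<Sum>k<degree (u i). of_rat (t ^ k) * coeff (u i) (Suc k))" for i
    by (simp add: poly_altdef sum.atMost_shift poly_0_coeff_0 sum_distrib_left algebra_simps
        of_rat_power)
  have coords: "\<phi> j (poly (u i) (of_rat t)) = (if i = j then 1 else 0) + t * e j i t"
    if "i \<in> I" "j \<in> I" for i j
    by (simp add: expand add scale sum dual that e_def)
  have e_le: "(\<Sum>i\<in>I. \<bar>e j i t\<bar>) \<le> C" if j: "j \<in> I" for j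
  proof -
    have "\<bar>e j i t\<bar> \<le> (\<Sum>k<degree (u i). \<bar>\<phi> j (coeff (u i) (Suc k))\<bar>)" for i
      unfolding e_def using t
      by (intro sum_abs[THEN order_trans] sum_mono)
        (auto simp: abs_mult power_le_one power_abs intro!: mult_left_le_one_le)
    then have "(\<Sum>i\<in>I. \<bar>e j i t\<bar>) \<le> (\<Sum>i\<in>I. \<Sum>k<degree (u i). \<bar>\<phi> j (coeff (u i) (Suc k))\<bar>)"
      by (rule sum_mono)
    also have "\<dots> \<le> C"
      unfolding C_def using j fin
      by (intro member_le_sum[where f = "\<lambda>j. \<Sum>i\<in>I. \<Sum>k<degree (u i). \<bar>\<phi> j (coeff (u i) (Suc k))\<bar>"])
        (auto intro!: sum_nonneg)
    finally show ?thesis .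
  qed
  have "c i = 0" if c: "(\<Sum>i\<in>I. of_rat (c i) * poly (u i) (of_rat t)) = 0" and i: "i \<in> I" for c i
  proof -
    define M where "M = Max ((\<lambda>i. \<bar>c i\<bar>) ` I)"
    have le_M: "\<bar>c j\<bar> \<le> M" if "j \<in> I" for j
      using that fin by (simp add: M_def)
    obtain j where j: "j \<in> I" "\<bar>c j\<bar> = M"
    proof -
      have "M \<in> (\<lambda>i. \<bar>c i\<bar>) ` I"
        unfolding M_def using fin i by (intro Max_in) auto
      then show ?thesis using that by auto
    qed
    have "0 = \<phi> j (\<Sum>i\<in>I. of_rat (c i) * poly (u i) (of_rat t))"
      by (simp add: c zero)
    also have "\<dots> = (\<Sum>i\<in>I. c i * ((if i = j then 1 else 0) + t * e j i t))"
      by (simp add: sum scale coords j(1))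
    also have "\<dots> = (\<Sum>i\<in>I. (if i = j then c j else 0) + t * (c i * e j i t))"
      by (intro sum.cong) (auto simp: algebra_simps)
    also have "\<dots> = c j + t * (\<Sum>i\<in>I. c i * e j i t)"
      using j fin by (simp add: sum.distrib sum_distrib_left)
    finally have "c j = - (t * (\<Sum>i\<in>I. c i * e j i t))" by simp
    then have "M = t * \<bar>\<Sum>i\<in>I. c i * e j i t\<bar>"
      using j t by (simp add: abs_mult)
    also have "\<dots> \<le> t * (\<Sum>i\<in>I. M * \<bar>e j i t\<bar>)"
      using t le_M by (intro mult_left_mono sum_abs[THEN order_trans] sum_mono)
        (auto simp: abs_mult intro!: mult_right_mono)
    also have "\<dots> \<le> t * (M * C)"
      using t e_le[OF j(1)] j by (auto simp: sum_distrib_left[symmetric] intro!: mult_left_mono)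
    finally have "M * (1 - t * C) \<le> 0" by (simp add: algebra_simps)
    then have "M \<le> 0" using t by (simp add: mult_le_0_iff)
    then show "c i = 0" using le_M[OF i] by simp
  qed
  then have "rat_indep (\<lambda>i. poly (u i) (of_rat t)) I"
    by (auto simp: rat_indep_def)
  then show ?thesis using t by (intro exI[of _ t]) auto
qed

abbreviation rat_poly :: "rat poly \<Rightarrow> 'k::field_char_0 poly" where
  "rat_poly \<equiv> map_poly of_rat"

lemma poly_rat_poly_sum:
  "degree q < n \<Longrightarrow> poly (rat_poly q) x = (\<Sum>i<n. of_rat (coeff q i) * x ^ i)"
  unfolding poly_altdef by (rule sum.mono_neutral_cong_left) (auto simp: coeff_eq_0)

lemma sum_powers_rat_poly:
  fixes x :: "'k::field_char_0"
  assumes "n > 0"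
  shows "\<exists>q. degree q < n \<and> (\<forall>i<n. coeff q i = c i) \<and>
    poly (rat_poly q) x = (\<Sum>i<n. of_rat (c i) * x ^ i)"
proof -
  define q where "q = Poly (map c [0..<n])"
  have "degree q < n"
    using assms degree_Poly[of "map c [0..<n]"] unfolding q_def
    by (intro degree_lessI) (auto simp: nth_default_def)
  moreover have co: "coeff q i = c i" if "i < n" for i
    using that by (simp add: q_def nth_default_def)
  ultimately show ?thesis
    using poly_rat_poly_sum[of q n x] by (intro exI[of _ q]) simp
qed

lemma rat_indep_powers_iff:
  assumes "n > 0"
  shows "rat_indep (\<lambda>i. x ^ i) {..<n} \<longleftrightarrow> (\<forall>q. degree q < n \<longrightarrow> poly (rat_poly q) x = 0 \<longrightarrow> q = 0)"
proof safe
  fix q assume "rat_indep (\<lambda>i. x ^ i) {..<n}" "degree q < n" "poly (rat_poly q) x = 0"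
  then have "coeff q i = 0" if "i < n" for i
    using rat_indepD[of "\<lambda>i. x ^ i" "{..<n}" "coeff q" i] that by (simp add: poly_rat_poly_sum)
  then show "q = 0" using \<open>degree q < n\<close> by (metis leading_coeff_0_iff)
next
  assume *: "\<forall>q. degree q < n \<longrightarrow> poly (rat_poly q) x = 0 \<longrightarrow> q = 0"
  show "rat_indep (\<lambda>i. x ^ i) {..<n}"
    unfolding rat_indep_def
  proof (intro allI impI ballI)
    fix c :: "nat \<Rightarrow> rat" and i
    assume sum: "(\<Sum>i<n. of_rat (c i) * x ^ i) = 0" and i: "i \<in> {..<n}"
    obtain q where q: "degree q < n" "\<forall>i<n. coeff q i = c i"
      "poly (rat_poly q) x = (\<Sum>i<n. of_rat (c i) * x ^ i)"
      using sum_powers_rat_poly[OF assms, of c x] by auto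
    have "q = 0" using * q sum by auto
    then show "c i = 0" using q(2) i by simp
  qed
qed

text \<open>Multiplication by \<open>x\<close> acts on a finite spanning set by a rational matrix; a common
  denominator of its entries turns it into an integer matrix.\<close>

lemma number_field_clear_denominator:
  fixes x :: "'k::field_char_0"
  assumes "number_field TYPE('k)"
  obtains m where "m > 0" "algebraic_int (of_nat m * x)"
proof -
  obtain S :: "'k set" where S: "finite S" "rat_space.span S = UNIV"
    using assms by (auto simp: number_field_def)
  have "\<exists>c. x * s = (\<Sum>r\<in>S. of_rat (c r) * r)" for s
  proof -
    have "x * s \<in> rat_space.span S" using S by simp
    then show ?thesis unfolding rat_space.span_finite[OF S(1)] by auto
  qed
  then obtain c where c: "\<And>s. x * s = (\<Sum>r\<in>S. of_rat (c s r) * r)" by metis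
  define den where "den = (\<lambda>p. nat (snd (quotient_of (c (fst p) (snd p)))))"
  define m where "m = (\<Prod>p\<in>S \<times> S. den p)"
  have "m > 0"
    unfolding m_def den_def using quotient_of_denom_pos' by (intro prod_pos) auto
  have int: "of_nat m * c s r \<in> \<int>" if "s \<in> S" "r \<in> S" for s r
  proof -
    obtain a b where ab: "quotient_of (c s r) = (a, b)" by force
    have b: "b > 0" using quotient_of_denom_pos[OF ab] .
    have "c s r = of_int a / of_int b" by (rule quotient_of_div[OF ab])
    moreover have "nat b dvd m"
      unfolding m_def using that S(1) ab
      by (intro dvd_trans[OF _ dvd_prodI[of _ "(s, r)"]]) (auto simp: den_def)
    then obtain k where "m = nat b * k" by auto
    ultimately have "of_nat m * c s r = of_int (int k * a)" using b by simp
    then show ?thesis by (metis Ints_of_int)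
  qed
  define y where "y = of_nat m * x"
  have "algebraic_int y"
  proof (rule algebraic_int_if_stable[of S "\<lambda>s. s"])
    show "\<exists>s\<in>S. s \<noteq> 0"
    proof (rule ccontr)
      assume "\<not> ?thesis"
      then have "S \<subseteq> {0}" by auto
      then have "rat_space.span S \<subseteq> {0}"
        using rat_space.span_mono[of S "{0}"] by simp
      then show False using S by (metis UNIV_I one_neq_zero singletonD subsetD)
    qed
    fix s assume s: "s \<in> S"
    have "\<exists>n. of_nat m * c s r = of_int n" if "r \<in> S" for r
      using int[OF s that] by (auto elim: Ints_cases)
    then obtain n where n: "\<And>r. r \<in> S \<Longrightarrow> of_nat m * c s r = of_int (n r)" by metis
    have "y * s = (\<Sum>r\<in>S. of_rat (of_nat m * c s r) * r)"
      by (simp add: y_def mult.assoc c sum_distrib_left of_rat_mult)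
    also have "\<dots> = (\<Sum>r\<in>S. of_int (n r) * r)"
      by (intro sum.cong) (simp_all add: n)
    finally show "y * s \<in> int_span (\<lambda>s. s) S"
      by (auto simp: int_span_def)
  qed (use S in auto)
  then show thesis using that \<open>m > 0\<close> by (simp add: y_def)
qed

text \<open>Take \<open>\<theta>\<close> of the largest possible degree \<open>m\<close>, with minimal polynomial \<open>P\<close>. If \<open>\<rat>(\<theta>)\<close>
  were not everything, some \<open>\<beta>\<close> would have \<open>P'(\<theta>) \<beta> \<notin> \<rat>(\<theta>)\<close>. For \<open>\<gamma> = \<theta> + t \<beta>\<close> with small
  \<open>t \<noteq> 0\<close> the elements \<open>1, \<gamma>, \<dots>, \<gamma> ^ (m - 1), P(\<gamma>) / t\<close> are a small perturbation of
  \<open>1, \<theta>, \<dots>, \<theta> ^ (m - 1), P'(\<theta>) \<beta>\<close>, hence independent, and \<open>\<gamma>\<close> has degree larger than \<open>m\<close>.\<close>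

lemma primitive_element:
  assumes "number_field TYPE('k::field_char_0)"
  obtains \<theta> :: "'k::field_char_0" and P where "algebraic_int \<theta>" "lead_coeff P = 1" "degree P > 0"
    "poly (rat_poly P) \<theta> = 0" "\<And>q. degree q < degree P \<Longrightarrow> poly (rat_poly q) \<theta> = 0 \<Longrightarrow> q = 0"
    "\<And>x. \<exists>q. degree q < degree P \<and> x = poly (rat_poly q) \<theta>"
proof -
  obtain S :: "'k set" where S: "finite S" "rat_space.span S = UNIV"
    using assms by (auto simp: number_field_def)
  define good where "good = (\<lambda>n. n > 0 \<and> (\<exists>x::'k. rat_indep (\<lambda>i. x ^ i) {..<n}))"
  have "good 1" unfolding good_def
    by (auto intro!: exI[of _ 1] simp: rat_indep_def)
  moreover have bound: "n \<le> card S" if "good n" for n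
    using that rat_indep_card_le[OF S, of _ "{..<n}"] by (auto simp: good_def)
  ultimately obtain m where m: "good m" "\<And>n. good n \<Longrightarrow> n \<le> m"
    using ex_has_greatest_nat[of good 1 "\<lambda>n. n" "Suc (card S)"] by force
  then have "m > 0" by (simp add: good_def)
  obtain x0 :: 'k where x0: "rat_indep (\<lambda>i. x0 ^ i) {..<m}" using m by (auto simp: good_def)
  obtain k where k: "k > 0" "algebraic_int (of_nat k * x0)"
    by (rule number_field_clear_denominator[OF assms])
  define \<theta> where "\<theta> = of_nat k * x0"
  have \<theta>: "rat_indep (\<lambda>i. \<theta> ^ i) {..<m}"
    unfolding rat_indep_def
  proof (intro allI impI ballI)
    fix c :: "nat \<Rightarrow> rat" and i
    assume "(\<Sum>i<m. of_rat (c i) * \<theta> ^ i) = 0" "i \<in> {..<m}"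
    then have "(\<Sum>i<m. of_rat (c i * of_nat k ^ i) * x0 ^ i) = 0"
      by (simp add: \<theta>_def power_mult_distrib of_rat_mult of_rat_power mult.assoc)
    from rat_indepD[OF x0 this \<open>i \<in> _\<close>] show "c i = 0" using k by simp
  qed
  note minimal = \<theta>[unfolded rat_indep_powers_iff[OF \<open>m > 0\<close>], rule_format]
  have "\<not> rat_indep (\<lambda>i. \<theta> ^ i) {..<Suc m}"
    using m(2)[of "Suc m"] by (auto simp: good_def)
  then obtain Q where Q: "degree Q < Suc m" "poly (rat_poly Q) \<theta> = 0" "Q \<noteq> 0"
    by (auto simp: rat_indep_powers_iff)
  have "degree Q = m" using minimal[of Q] Q by (cases "degree Q < m") auto
  define P where "P = Polynomial.smult (inverse (lead_coeff Q)) Q"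
  have P: "degree P = m" "lead_coeff P = 1" "poly (rat_poly P) \<theta> = 0"
    using Q \<open>degree Q = m\<close> by (auto simp: P_def hom_distribs)
  have span: "\<exists>q. degree q < m \<and> x = poly (rat_poly q) \<theta>" for x
  proof (rule ccontr)
    assume x: "\<not> ?thesis"
    have dP: "degree (pderiv P) < m" "pderiv P \<noteq> 0"
      using P \<open>m > 0\<close> by (auto simp: degree_pderiv pderiv_eq_0_iff)
    then have P': "poly (rat_poly (pderiv P)) \<theta> \<noteq> 0" using minimal by blast
    define \<beta> where "\<beta> = x / poly (rat_poly (pderiv P)) \<theta>"
    define R where "R = pcompose (rat_poly P) [:\<theta>, \<beta>:]"
    obtain r R1 where R1: "R = pCons r R1" by (cases R)
    have "r = poly R 0" by (simp add: R1)
    then have "r = 0" by (simp add: R_def poly_pcompose P)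
    have "poly R1 0 = poly (pderiv R) 0" by (simp add: R1 pderiv_pCons)
    also have "\<dots> = x"
      unfolding R_def pderiv_pcompose using P'
      by (simp add: poly_pcompose pderiv_pCons \<beta>_def of_rat_hom.map_poly_pderiv)
    finally have R1_0: "poly R1 0 = x" .
    define u where "u = (\<lambda>i. if i < m then [:\<theta>, \<beta>:] ^ i else R1)"
    have "rat_indep (\<lambda>i. poly (u i) 0) {..<Suc m}"
      unfolding rat_indep_def
    proof (intro allI impI)
      fix c :: "nat \<Rightarrow> rat"
      assume "(\<Sum>i<Suc m. of_rat (c i) * poly (u i) 0) = 0"
      then have c: "(\<Sum>i<m. of_rat (c i) * \<theta> ^ i) + of_rat (c m) * x = 0"
        by (simp add: u_def R1_0)
      obtain q where q: "degree q < m"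
        "poly (rat_poly q) \<theta> = (\<Sum>i<m. of_rat (c i) * \<theta> ^ i)"
        using sum_powers_rat_poly[OF \<open>m > 0\<close>, of c \<theta>] by auto
      have "c m = 0"
      proof (rule ccontr)
        assume "c m \<noteq> 0"
        then have "x = - (poly (rat_poly q) \<theta>) / of_rat (c m)"
          using c q by (simp add: field_simps eq_neg_iff_add_eq_0 add.commute)
        also have "\<dots> = poly (rat_poly (Polynomial.smult (- inverse (c m)) q)) \<theta>"
          unfolding of_rat_hom.map_poly_hom_smult poly_smult
          by (simp add: of_rat_minus of_rat_inverse divide_inverse)
        finally show False using x q degree_smult_le le_less_trans by blast
      qed
      then show "\<forall>i\<in>{..<Suc m}. c i = 0"
        using c rat_indepD[OF \<theta>, of c] by (auto simp: less_Suc_eq)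
    qed
    then obtain t where t: "t \<noteq> 0" "rat_indep (\<lambda>i. poly (u i) (of_rat t)) {..<Suc m}"
      using rat_indep_perturb[of u "{..<Suc m}"] by auto
    define \<gamma> where "\<gamma> = \<theta> + of_rat t * \<beta>"
    have "poly R (of_rat t) = poly (rat_poly P) \<gamma>"
      by (simp add: R_def poly_pcompose \<gamma>_def)
    then have R1_t: "of_rat t * poly R1 (of_rat t) = poly (rat_poly P) \<gamma>"
      by (simp add: R1 \<open>r = 0\<close>)
    have "rat_indep (\<lambda>i. \<gamma> ^ i) {..<Suc m}"
      unfolding rat_indep_def
    proof (intro allI impI)
      fix c :: "nat \<Rightarrow> rat"
      assume "(\<Sum>i<Suc m. of_rat (c i) * \<gamma> ^ i) = 0"
      then have c: "(\<Sum>i<m. of_rat (c i) * \<gamma> ^ i) + of_rat (c m) * \<gamma> ^ m = 0" by simp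
      have "poly (rat_poly P) \<gamma> = (\<Sum>i<m. of_rat (coeff P i) * \<gamma> ^ i) + \<gamma> ^ m"
        using poly_rat_poly_sum[of P "Suc m" \<gamma>] P by simp
      then have \<gamma>: "\<gamma> ^ m = of_rat t * poly R1 (of_rat t) - (\<Sum>i<m. of_rat (coeff P i) * \<gamma> ^ i)"
        by (simp add: R1_t)
      have u_t: "poly (u i) (of_rat t) = \<gamma> ^ i" if "i < m" for i
        using that by (simp add: u_def \<gamma>_def)
      define d where "d = (\<lambda>i. if i < m then c i - c m * coeff P i else c m * t)"
      have "of_rat (d i) * poly (u i) (of_rat t) =
          of_rat (c i) * \<gamma> ^ i - of_rat (c m) * (of_rat (coeff P i) * \<gamma> ^ i)" if "i < m" for i
      proof -
        have "of_rat (d i) = of_rat (c i) - of_rat (c m) * (of_rat (coeff P i) :: 'k)"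
          using that by (simp add: d_def of_rat_diff of_rat_mult)
        then show ?thesis by (simp only: u_t[OF that] left_diff_distrib mult.assoc)
      qed
      then have "(\<Sum>i<m. of_rat (d i) * poly (u i) (of_rat t)) =
          (\<Sum>i<m. of_rat (c i) * \<gamma> ^ i - of_rat (c m) * (of_rat (coeff P i) * \<gamma> ^ i))"
        by (intro sum.cong) auto
      also have "\<dots> = (\<Sum>i<m. of_rat (c i) * \<gamma> ^ i) -
          of_rat (c m) * (\<Sum>i<m. of_rat (coeff P i) * \<gamma> ^ i)"
        by (simp add: sum_subtractf sum_distrib_left)
      finally have less_m: "(\<Sum>i<m. of_rat (d i) * poly (u i) (of_rat t)) =
          (\<Sum>i<m. of_rat (c i) * \<gamma> ^ i) - of_rat (c m) * (\<Sum>i<m. of_rat (coeff P i) * \<gamma> ^ i)" .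
      have rearrange: "X - C * Y + (C * T) * Z = X + C * (T * Z - Y)" for X Y Z C T :: 'k
        by (simp add: algebra_simps)
      have "of_rat (d m) * poly (u m) (of_rat t) = of_rat (c m) * of_rat t * poly R1 (of_rat t)"
        by (simp add: d_def u_def of_rat_mult)
      then have "(\<Sum>i<Suc m. of_rat (d i) * poly (u i) (of_rat t)) =
          (\<Sum>i<m. of_rat (c i) * \<gamma> ^ i) + of_rat (c m) * \<gamma> ^ m"
        unfolding \<gamma> by (simp only: sum.lessThan_Suc less_m rearrange)
      then have "(\<Sum>i<Suc m. of_rat (d i) * poly (u i) (of_rat t)) = 0" using c by simp
      note d = rat_indepD[OF t(2) this]
      have "c m = 0" using d[of m] t(1) by (simp add: d_def)
      moreover have "c i = 0" if "i < m" for i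
        using d[of i] that \<open>c m = 0\<close> by (simp add: d_def)
      ultimately show "\<forall>i\<in>{..<Suc m}. c i = 0" by (auto simp: less_Suc_eq)
    qed
    then show False using m(2)[of "Suc m"] by (auto simp: good_def)
  qed
  show thesis
    by (rule that[of \<theta> P]) (use P minimal span k \<open>m > 0\<close> in \<open>auto simp: \<theta>_def\<close>)
qed


section \<open>Complex embeddings and the lattice of integers\<close>

interpretation rat_poly_hom: map_poly_comm_ring_hom "of_rat :: rat \<Rightarrow> 'k::field_char_0" ..

lemma embedding_field_hom: "embedding \<sigma> \<Longrightarrow> field_hom \<sigma>"
proof -
  assume e: "embedding \<sigma>"
  have "\<sigma> 0 + \<sigma> 0 = \<sigma> 0" using e unfolding embedding_def by (metis add.right_neutral)
  then have "\<sigma> 0 = 0" by (metis add_left_cancel add.right_neutral)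
  then show "field_hom \<sigma>"
    using e by unfold_locales (auto simp: embedding_def)
qed

lemma embedding_of_rat:
  fixes \<sigma> :: "'k::field_char_0 \<Rightarrow> 'l::field_char_0"
  assumes "embedding \<sigma>"
  shows "\<sigma> (of_rat q) = of_rat q"
proof -
  interpret \<sigma>: field_hom \<sigma> using assms by (rule embedding_field_hom)
  have nat: "\<sigma> (of_nat n) = of_nat n" for n
    by (induction n) (auto simp: \<sigma>.hom_add)
  have int: "\<sigma> (of_int n) = of_int n" for n
    by (cases n rule: int_cases2) (auto simp: nat \<sigma>.hom_uminus)
  show ?thesis
    by (cases q) (simp add: of_rat_rat divide_inverse \<sigma>.hom_mult \<sigma>.hom_inverse int)
qed

lemma embedding_poly:
  fixes \<sigma> :: "'k::field_char_0 \<Rightarrow> 'l::field_char_0"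
  assumes "embedding \<sigma>"
  shows "\<sigma> (poly (rat_poly q) x) = poly (rat_poly q) (\<sigma> x)"
proof -
  interpret \<sigma>: field_hom \<sigma> using assms by (rule embedding_field_hom)
  show ?thesis
    by (simp add: poly_altdef \<sigma>.hom_sum \<sigma>.hom_mult \<sigma>.hom_power embedding_of_rat[OF assms])
qed

lemma embedding_algebraic_int:
  fixes \<sigma> :: "'k::field_char_0 \<Rightarrow> 'l::field_char_0"
  assumes "embedding \<sigma>" "algebraic_int x"
  shows "algebraic_int (\<sigma> x)"
proof -
  interpret \<sigma>: field_hom \<sigma> using assms(1) by (rule embedding_field_hom)
  obtain p where p: "poly (map_poly of_int p) x = 0" "lead_coeff p = 1"
    using assms(2) unfolding algebraic_int_altdef_ipoly by auto
  have "\<sigma> (of_int n) = of_int n" for n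
    using embedding_of_rat[OF assms(1), of "of_int n"] by simp
  then have "poly (map_poly of_int p) (\<sigma> x) = \<sigma> (poly (map_poly of_int p) x)"
    by (simp add: poly_altdef \<sigma>.hom_sum \<sigma>.hom_mult \<sigma>.hom_power)
  then show ?thesis
    using p unfolding algebraic_int_altdef_ipoly by (intro exI[of _ p]) simp
qed

definition embs :: "('k::field_char_0 \<Rightarrow> complex) set" where
  "embs = {\<tau>. embedding \<tau>}"

text \<open>An embedding is determined by the root of \<open>P\<close> to which it sends \<open>\<theta>\<close>; conversely \<open>\<theta>\<close> can
  be sent to every root, since the polynomials vanishing at \<open>\<theta>\<close> are the multiples of \<open>P\<close>.
  The roots are distinct because \<open>P'\<close> is invertible modulo \<open>P\<close>.\<close>

lemma embs_bij_roots:
  fixes \<theta> :: "'k::field_char_0"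
  assumes P: "lead_coeff P = 1" "degree P > 0" "poly (rat_poly P) \<theta> = 0"
    and minimal: "\<And>q. degree q < degree P \<Longrightarrow> poly (rat_poly q) \<theta> = 0 \<Longrightarrow> q = 0"
    and span: "\<And>x. \<exists>q. degree q < degree P \<and> x = poly (rat_poly q) \<theta>"
  shows "bij_betw (\<lambda>\<tau>. \<tau> \<theta>) embs {z::complex. poly (rat_poly P) z = 0}"
    and "card {z::complex. poly (rat_poly P) z = 0} = degree P"
proof -
  have multiple: "P dvd q" if "poly (rat_poly q) \<theta> = 0" for q
  proof -
    have "rat_poly q = rat_poly (q div P) * rat_poly P + (rat_poly (q mod P) :: 'k poly)"
      by (simp flip: rat_poly_hom.hom_mult rat_poly_hom.hom_add)
    then have "poly (rat_poly (q mod P)) \<theta> = 0" using that P by simp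
    moreover have "degree (q mod P) < degree P"
      using degree_mod_less'[of P q] P by (cases "q mod P = 0"; cases "P = 0") auto
    ultimately have "q mod P = 0" using minimal by blast
    then show ?thesis by (simp add: mod_eq_0_iff_dvd)
  qed
  have same_value: "poly (rat_poly q) z = poly (rat_poly r) z"
    if "poly (rat_poly q) \<theta> = poly (rat_poly r) \<theta>" "poly (rat_poly P) z = 0" for q r and z :: complex
  proof -
    have "P dvd q - r"
      using that by (intro multiple) (simp add: rat_poly_hom.hom_minus)
    then obtain s where "q - r = P * s" by (elim dvdE)
    then have "rat_poly q - rat_poly r = rat_poly P * (rat_poly s :: complex poly)"
      by (metis rat_poly_hom.hom_minus rat_poly_hom.hom_mult)
    then have "poly (rat_poly q) z - poly (rat_poly r) z = 0"
      using that by (metis mult_zero_left poly_diff poly_mult)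
    then show ?thesis by simp
  qed
  show "bij_betw (\<lambda>\<tau>. \<tau> \<theta>) embs {z::complex. poly (rat_poly P) z = 0}"
    unfolding bij_betw_def
  proof
    show "inj_on (\<lambda>\<tau>::'k \<Rightarrow> complex. \<tau> \<theta>) embs"
    proof (intro inj_onI ext)
      fix \<tau> \<tau>' :: "'k \<Rightarrow> complex" and x
      assume "\<tau> \<in> embs" "\<tau>' \<in> embs" "\<tau> \<theta> = \<tau>' \<theta>"
      then show "\<tau> x = \<tau>' x"
        using span[of x] by (auto simp: embs_def embedding_poly)
    qed
    show "(\<lambda>\<tau>::'k \<Rightarrow> complex. \<tau> \<theta>) ` embs = {z. poly (rat_poly P) z = 0}"
    proof safe
      fix \<tau> :: "'k \<Rightarrow> complex" assume "\<tau> \<in> embs"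
      then have \<tau>: "embedding \<tau>" by (simp add: embs_def)
      interpret \<tau>: field_hom \<tau> using \<tau> by (rule embedding_field_hom)
      show "poly (rat_poly P) (\<tau> \<theta>) = 0"
        using embedding_poly[OF \<tau>, of P \<theta>] P by simp
    next
      fix z :: complex assume z: "poly (rat_poly P) z = 0"
      obtain Q where Q: "\<And>x. poly (rat_poly (Q x)) \<theta> = x" using span by metis
      define \<tau> where "\<tau> = (\<lambda>x. poly (rat_poly (Q x)) z)"
      have \<tau>I: "\<tau> x = poly (rat_poly q) z" if "poly (rat_poly q) \<theta> = x" for q x
        unfolding \<tau>_def by (rule same_value) (use that z Q in auto)
      have "embedding \<tau>"
        unfolding embedding_def
      proof (intro conjI allI)
        show "\<tau> 1 = 1" using \<tau>I[of 1 1] by simp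
        show "\<tau> (x + y) = \<tau> x + \<tau> y" for x y
          using \<tau>I[of "Q x + Q y" "x + y"]
          by (simp add: Q rat_poly_hom.hom_add) (simp add: \<tau>_def)
        show "\<tau> (x * y) = \<tau> x * \<tau> y" for x y
          using \<tau>I[of "Q x * Q y" "x * y"]
          by (simp add: Q rat_poly_hom.hom_mult) (simp add: \<tau>_def)
      qed
      moreover have "\<tau> \<theta> = z"
        using \<tau>I[of "[:0, 1:]" \<theta>] by (simp add: of_rat_hom.map_poly_pCons_hom)
      ultimately show "z \<in> (\<lambda>\<tau>::'k \<Rightarrow> complex. \<tau> \<theta>) ` embs"
        by (intro image_eqI[of _ _ \<tau>]) (auto simp: embs_def)
    qed
  qed
  have dP: "degree (pderiv P) < degree P" "pderiv P \<noteq> 0"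
    using P by (auto simp: degree_pderiv pderiv_eq_0_iff)
  then have P': "poly (rat_poly (pderiv P)) \<theta> \<noteq> 0" using minimal by blast
  obtain B where B: "inverse (poly (rat_poly (pderiv P)) \<theta>) = poly (rat_poly B) \<theta>"
    using span by blast
  have "poly (rat_poly (pderiv P * B)) \<theta> = poly (rat_poly 1) \<theta>"
    using P' by (simp add: rat_poly_hom.hom_mult flip: B)
  note inverse_mod = same_value[OF this]
  have "poly (pderiv (rat_poly P)) z \<noteq> 0" if "poly (rat_poly P) z = 0" for z :: complex
    using inverse_mod[OF that] by (auto simp: rat_poly_hom.hom_mult of_rat_hom.map_poly_pderiv)
  then have sf: "rsquarefree (rat_poly P :: complex poly)"
    unfolding rsquarefree_roots by blast
  have "degree P = degree (rat_poly P :: complex poly)" by simp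
  also have "\<dots> = degree (\<Prod>z|poly (rat_poly P) z = 0. [:- z, 1 :: complex:])"
    using P by (subst (1) complex_poly_decompose_rsquarefree[OF sf, symmetric]) simp
  also have "\<dots> = card {z::complex. poly (rat_poly P) z = 0}"
    by (subst degree_prod_eq_sum_degree) auto
  finally show "card {z::complex. poly (rat_poly P) z = 0} = degree P" ..
qed

lemma power_basis:
  assumes "number_field TYPE('k::field_char_0)"
  obtains \<theta> :: "'k::field_char_0" and d and e :: "nat \<Rightarrow> 'k \<Rightarrow> complex" where
    "algebraic_int \<theta>" "d > 0" "rat_indep (\<lambda>i. \<theta> ^ i) {..<d}"
    "\<forall>x. \<exists>c. x = (\<Sum>i<d. of_rat (c i) * \<theta> ^ i)"
    "bij_betw e {..<d} embs" "inj_on (\<lambda>i. e i \<theta>) {..<d}"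
proof -
  obtain \<theta> :: 'k and P where \<theta>: "algebraic_int \<theta>"
    and P: "lead_coeff P = 1" "degree P > 0" "poly (rat_poly P) \<theta> = 0"
      "\<And>q. degree q < degree P \<Longrightarrow> poly (rat_poly q) \<theta> = 0 \<Longrightarrow> q = 0"
      "\<And>x. \<exists>q. degree q < degree P \<and> x = poly (rat_poly q) \<theta>"
    using primitive_element[OF assms] by metis
  note embs = embs_bij_roots[OF P]
  have "finite {z::complex. poly (rat_poly P) z = 0}"
    using P by (intro poly_roots_finite) auto
  then have "finite (embs :: ('k \<Rightarrow> complex) set)" "card (embs :: ('k \<Rightarrow> complex) set) = degree P"
    using embs bij_betw_finite[OF embs(1)] bij_betw_same_card[OF embs(1)] by auto
  then obtain e :: "nat \<Rightarrow> 'k \<Rightarrow> complex" where e: "bij_betw e {..<degree P} embs"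
    using ex_bij_betw_nat_finite[of "embs :: ('k \<Rightarrow> complex) set"] by (auto simp: atLeast0LessThan)
  have "inj_on (\<lambda>i. e i \<theta>) {..<degree P}"
    using comp_inj_on[of e "{..<degree P}" "\<lambda>\<tau>. \<tau> \<theta>"] e embs(1) by (simp add: bij_betw_def o_def)
  moreover have "rat_indep (\<lambda>i. \<theta> ^ i) {..<degree P}"
    unfolding rat_indep_powers_iff[OF P(2)] using P(4) by blast
  moreover have "\<exists>c. x = (\<Sum>i<degree P. of_rat (c i) * \<theta> ^ i)" for x
    using P(5)[of x] by (auto simp: poly_rat_poly_sum)
  ultimately show thesis using that \<theta> P(2) e by metis
qed

lemma finite_embs:
  assumes "number_field TYPE('k::field_char_0)"
  shows "finite (embs :: ('k \<Rightarrow> complex) set)"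
  using power_basis[OF assms] bij_betw_finite by (metis finite_lessThan)

text \<open>A vector in the kernel is a polynomial of degree less than \<open>n\<close> with \<open>n\<close> distinct roots.\<close>

lemma det_vandermonde_nonzero:
  fixes z :: "nat \<Rightarrow> 'a::field"
  assumes "inj_on z {..<n}" "n > 0"
  shows "det (mat n n (\<lambda>(i, j). z i ^ j)) \<noteq> 0"
proof
  let ?V = "mat n n (\<lambda>(i, j). z i ^ j)"
  assume "det ?V = 0"
  then obtain v where v: "v \<in> carrier_vec n" "v \<noteq> 0\<^sub>v n" "?V *\<^sub>v v = 0\<^sub>v n"
    using det_0_iff_vec_prod_zero_field[of ?V n] by auto
  define q where "q = Poly (map (vec_index v) [0..<n])"
  have deg: "degree q < n"
    using assms degree_Poly[of "map (vec_index v) [0..<n]"] unfolding q_def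
    by (intro degree_lessI) (auto simp: nth_default_def)
  have co: "coeff q i = v $ i" if "i < n" for i
    using that by (simp add: q_def nth_default_def)
  have "poly q x = (\<Sum>i<n. coeff q i * x ^ i)" for x
    unfolding poly_altdef using deg by (intro sum.mono_neutral_left) (auto simp: coeff_eq_0)
  then have poly: "poly q x = (\<Sum>i<n. v $ i * x ^ i)" for x
    by (simp add: co)
  have roots: "poly q (z i) = 0" if "i < n" for i
  proof -
    have "(?V *\<^sub>v v) $ i = (\<Sum>j = 0..<n. z i ^ j * v $ j)"
      using that v(1) by (simp add: scalar_prod_def)
    then show ?thesis using v(3) that by (simp add: poly atLeast0LessThan mult.commute)
  qed
  have "q = 0"
  proof (rule ccontr)
    assume "q \<noteq> 0"
    have "n = card (z ` {..<n})" using assms by (simp add: card_image)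
    also have "\<dots> \<le> card {x. poly q x = 0}"
      using \<open>q \<noteq> 0\<close> roots by (intro card_mono poly_roots_finite) auto
    also have "\<dots> \<le> degree q" using \<open>q \<noteq> 0\<close> by (intro card_poly_roots_bound) auto
    finally show False using deg by simp
  qed
  then have "v = 0\<^sub>v n" using v(1) co by (intro eq_vecI) auto
  with v(2) show False by simp
qed

lemma algebraic_int_det:
  fixes A :: "'a::field_char_0 mat"
  assumes "A \<in> carrier_mat n n" "\<And>i j. i < n \<Longrightarrow> j < n \<Longrightarrow> algebraic_int (A $$ (i, j))"
  shows "algebraic_int (det A)"
  unfolding det_def'[OF assms(1)]
  by (intro algebraic_int_sum algebraic_int_mult algebraic_int_prod assms(2))
    (auto dest: permutes_in_image simp: sign_def)

text \<open>The absolute value of the norm to the rationals.\<close>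

definition emb_norm :: "'k::field_char_0 \<Rightarrow> real" where
  "emb_norm x = (\<Prod>\<tau>\<in>embs. cmod (\<tau> x))"

lemma emb_norm_mult: "emb_norm (x * y) = emb_norm x * emb_norm y"
  by (simp add: emb_norm_def embs_def embedding_def norm_mult flip: prod.distrib)

lemma emb_norm_pos:
  assumes "number_field TYPE('k::field_char_0)" "(x::'k) \<noteq> 0"
  shows "emb_norm x > 0"
  unfolding emb_norm_def
proof (rule prod_pos)
  fix \<tau> :: "'k \<Rightarrow> complex" assume "\<tau> \<in> embs"
  then interpret \<tau>: field_hom \<tau> by (auto simp: embs_def intro: embedding_field_hom)
  show "0 < cmod (\<tau> x)" using assms by simp
qed

text \<open>The product of the conjugates is the determinant of multiplication by \<open>x\<close>: the matrix
  \<open>V\<close> of the conjugates of the powers of \<open>\<theta>\<close> diagonalises it. So the product is rational; being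
  an algebraic integer, it is an integer.\<close>

lemma emb_norm_integer_ge_1:
  assumes nf: "number_field TYPE('k::field_char_0)" and x: "algebraic_int (x::'k)" "x \<noteq> 0"
  shows "emb_norm x \<ge> 1"
proof -
  obtain \<theta> :: 'k and d and e :: "nat \<Rightarrow> 'k \<Rightarrow> complex" where
    basis: "algebraic_int \<theta>" "d > 0" "rat_indep (\<lambda>i. \<theta> ^ i) {..<d}" "\<forall>x. \<exists>c. x = (\<Sum>i<d. of_rat (c i) * \<theta> ^ i)"
    and e: "bij_betw e {..<d} embs" "inj_on (\<lambda>i. e i \<theta>) {..<d}"
    by (rule power_basis[OF nf])
  have emb: "embedding (e i)" if "i < d" for i
    using e(1) that by (auto simp: bij_betw_def embs_def)
  have "\<forall>j. \<exists>c. x * \<theta> ^ j = (\<Sum>k<d. of_rat (c k) * \<theta> ^ k)"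
    using basis(4) by blast
  then obtain c where c: "\<And>j. x * \<theta> ^ j = (\<Sum>k<d. of_rat (c j k) * \<theta> ^ k)"
    by (auto dest!: choice)
  define V where "V = mat d d (\<lambda>(i, j). e i \<theta> ^ j)"
  define R where "R = mat d d (\<lambda>(i, j). c j i)"
  define B :: "complex mat" where "B = map_mat of_rat R"
  define E where "E = mat d d (\<lambda>(i, j). if i = j then e i x else 0)"
  have carriers: "V \<in> carrier_mat d d" "R \<in> carrier_mat d d" "B \<in> carrier_mat d d" "E \<in> carrier_mat d d"
    by (auto simp: V_def R_def B_def E_def)
  have "E * V = V * B"
  proof (rule eq_matI)
    fix i j assume "i < dim_row (V * B)" "j < dim_col (V * B)"
    then have ij: "i < d" "j < d" using carriers by auto
    interpret e: field_hom "e i" using emb[OF ij(1)] by (rule embedding_field_hom)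
    have "(E * V) $$ (i, j) = (\<Sum>k = 0..<d. (if i = k then e i x else 0) * e k \<theta> ^ j)"
      using ij by (simp add: E_def V_def scalar_prod_def)
    also have "\<dots> = (\<Sum>k = 0..<d. if k = i then e i x * e i \<theta> ^ j else 0)"
      by (intro sum.cong) auto
    also have "\<dots> = e i (x * \<theta> ^ j)"
      using ij by (simp add: e.hom_mult e.hom_power)
    also have "\<dots> = (\<Sum>k<d. of_rat (c j k) * e i \<theta> ^ k)"
      by (simp add: c e.hom_sum e.hom_mult e.hom_power embedding_of_rat[OF emb[OF ij(1)]])
    also have "\<dots> = (V * B) $$ (i, j)"
      using ij by (simp add: V_def B_def R_def scalar_prod_def atLeast0LessThan mult.commute)
    finally show "(E * V) $$ (i, j) = (V * B) $$ (i, j)" .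
  qed (use carriers in auto)
  then have "det E * det V = det V * det B"
    by (metis det_mult[OF carriers(4,1)] det_mult[OF carriers(1,3)])
  moreover have "det V \<noteq> 0"
    unfolding V_def using e(2) basis(2) by (intro det_vandermonde_nonzero)
  ultimately have "det E = det B" by simp
  moreover have "det B = of_rat (det R)"
    unfolding B_def by (rule of_rat_hom.hom_det)
  moreover have "det E = (\<Prod>i<d. e i x)"
  proof -
    have "upper_triangular E" by (auto simp: E_def)
    then have "det E = (\<Prod>i = 0..<d. E $$ (i, i))"
      using det_upper_triangular[OF _ carriers(4)] carriers(4) by (simp add: prod_list_diag_prod)
    then show ?thesis by (simp add: E_def atLeast0LessThan)
  qed
  ultimately have rat: "(\<Prod>i<d. e i x) \<in> \<rat>" by auto
  have "algebraic_int (\<Prod>i<d. e i x)"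
    by (rule algebraic_int_prod) (use embedding_algebraic_int[OF emb x(1)] in auto)
  then obtain n where n: "(\<Prod>i<d. e i x) = of_int n"
    using rational_algebraic_int_is_int[OF _ rat] by (auto elim: Ints_cases)
  have "emb_norm x = (\<Prod>i<d. cmod (e i x))"
    unfolding emb_norm_def by (rule prod.reindex_bij_betw[OF e(1), symmetric])
  also have "\<dots> = \<bar>of_int n\<bar>"
    by (simp add: n prod_norm)
  finally have "emb_norm x = \<bar>of_int n\<bar>" .
  with emb_norm_pos[OF nf x(2)] show ?thesis by simp
qed

text \<open>By Cramer's rule the coordinates of an integer become algebraic integers after
  multiplication by \<open>det V\<close>, hence after multiplication by a positive integer divisible
  by \<open>det V\<close>; rational algebraic integers are integers.\<close>

lemma integer_lattice:
  assumes nf: "number_field TYPE('k::field_char_0)"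
  obtains w :: "nat \<Rightarrow> 'k::field_char_0" and D where
    "\<And>i. algebraic_int (w i)" "rat_indep w {..<card (embs :: ('k \<Rightarrow> complex) set)}" "D > 0"
    "\<And>x. algebraic_int x \<Longrightarrow> of_nat D * x \<in> int_span w {..<card (embs :: ('k \<Rightarrow> complex) set)}"
proof -
  obtain \<theta> :: 'k and d and e :: "nat \<Rightarrow> 'k \<Rightarrow> complex" where
    basis: "algebraic_int \<theta>" "d > 0" "rat_indep (\<lambda>i. \<theta> ^ i) {..<d}"
      "\<forall>x. \<exists>c. x = (\<Sum>i<d. of_rat (c i) * \<theta> ^ i)"
    and e: "bij_betw e {..<d} embs" "inj_on (\<lambda>i. e i \<theta>) {..<d}"
    by (rule power_basis[OF nf])
  have d: "card (embs :: ('k \<Rightarrow> complex) set) = d"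
    using bij_betw_same_card[OF e(1)] by simp
  have emb: "embedding (e i)" if "i < d" for i
    using e(1) that by (auto simp: bij_betw_def embs_def)
  define V where "V = mat d d (\<lambda>(i, j). e i \<theta> ^ j)"
  have V: "V \<in> carrier_mat d d" by (simp add: V_def)
  have "det V \<noteq> 0"
    unfolding V_def using e(2) basis(2) by (intro det_vandermonde_nonzero)
  have V_int: "algebraic_int (V $$ (i, j))" if "i < d" "j < d" for i j
    using embedding_algebraic_int[OF emb[OF that(1)] basis(1)] that
    by (simp add: V_def algebraic_int_power)
  obtain D y where D: "D > 0" "algebraic_int y" "det V * y = of_nat D"
    using algebraic_int_dvd_nat[OF algebraic_int_det[OF V V_int] \<open>det V \<noteq> 0\<close>] by blast
  have "of_nat D * x \<in> int_span (\<lambda>i. \<theta> ^ i) {..<d}" if x: "algebraic_int x" for x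
  proof -
    obtain c where c: "x = (\<Sum>i<d. of_rat (c i) * \<theta> ^ i)" using basis by blast
    define q :: "complex vec" where "q = vec d (\<lambda>i. of_rat (c i))"
    have q: "q \<in> carrier_vec d" by (simp add: q_def)
    have Vq: "(V *\<^sub>v q) $ i = e i x" if "i < d" for i
    proof -
      interpret e: field_hom "e i" using emb[OF that] by (rule embedding_field_hom)
      show ?thesis
        using that by (simp add: V_def q_def scalar_prod_def c e.hom_sum e.hom_mult e.hom_power
            embedding_of_rat[OF emb] atLeast0LessThan mult.commute)
    qed
    have "of_nat D * c k \<in> \<int>" if k: "k < d" for k
    proof -
      have "algebraic_int (det (replace_col V (V *\<^sub>v q) k))"
      proof (rule algebraic_int_det)
        show "replace_col V (V *\<^sub>v q) k \<in> carrier_mat d d"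
          using V by (simp add: replace_col_def)
        show "algebraic_int (replace_col V (V *\<^sub>v q) k $$ (i, j))" if "i < d" "j < d" for i j
          using V V_int[OF that] that Vq[OF that(1)] embedding_algebraic_int[OF emb[OF that(1)] x]
          by (simp add: replace_col_def del: index_mult_mat_vec)
      qed
      then have "algebraic_int (y * (q $ k * det V))"
        using D cramer_lemma_mat[OF V q k] by (simp add: algebraic_int_mult)
      also have "y * (q $ k * det V) = of_rat (of_nat D * c k)"
        using k by (simp add: q_def of_rat_mult algebra_simps flip: D(3))
      finally have "of_rat (of_nat D * c k) \<in> (\<int> :: complex set)"
        by (rule rational_algebraic_int_is_int) auto
      then obtain n where "of_rat (of_nat D * c k) = (of_rat (of_int n) :: complex)"
        by (auto elim!: Ints_cases)
      then show ?thesis by (metis Ints_of_int of_rat_eq_iff)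
    qed
    then have "\<exists>n. of_nat D * c k = of_int n" if "k < d" for k
      using that by (auto elim: Ints_cases)
    then obtain n where n: "\<And>k. k < d \<Longrightarrow> of_nat D * c k = of_int (n k)" by metis
    have "of_nat D * x = (\<Sum>i<d. of_rat (of_nat D * c i) * \<theta> ^ i)"
      by (simp add: c sum_distrib_left of_rat_mult mult.assoc)
    also have "\<dots> = (\<Sum>i<d. of_int (n i) * \<theta> ^ i)"
      by (intro sum.cong) (simp_all add: n)
    finally show ?thesis by (auto simp: int_span_def)
  qed
  moreover have "algebraic_int (\<theta> ^ i)" for i using basis by (intro algebraic_int_power)
  ultimately show thesis using that[of "\<lambda>i. \<theta> ^ i" D] basis D d by simp
qed


section \<open>The index of a principal ideal is the product of the conjugates\<close>

definition add_subgroup :: "'a::ab_group_add set \<Rightarrow> bool" where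
  "add_subgroup A \<longleftrightarrow> 0 \<in> A \<and> (\<forall>x\<in>A. \<forall>y\<in>A. x - y \<in> A)"

lemma add_subgroupD:
  assumes "add_subgroup A"
  shows "0 \<in> A" "x \<in> A \<Longrightarrow> y \<in> A \<Longrightarrow> x - y \<in> A" "x \<in> A \<Longrightarrow> - x \<in> A"
    "x \<in> A \<Longrightarrow> y \<in> A \<Longrightarrow> x + y \<in> A"
proof -
  show "0 \<in> A" and diff: "\<And>x y. x \<in> A \<Longrightarrow> y \<in> A \<Longrightarrow> x - y \<in> A"
    using assms by (auto simp: add_subgroup_def)
  then show neg: "\<And>x. x \<in> A \<Longrightarrow> - x \<in> A" by (metis diff_0)
  show "x \<in> A \<Longrightarrow> y \<in> A \<Longrightarrow> x + y \<in> A" using diff[of x "- y"] neg by simp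
qed

definition add_coset :: "'a::ab_group_add set \<Rightarrow> 'a \<Rightarrow> 'a set" where
  "add_coset B x = {y. y - x \<in> B}"

definition finite_index :: "'a::ab_group_add set \<Rightarrow> 'a set \<Rightarrow> bool" where
  "finite_index A B \<longleftrightarrow> finite (add_coset B ` A)"

definition index :: "'a::ab_group_add set \<Rightarrow> 'a set \<Rightarrow> nat" where
  "index A B = card (add_coset B ` A)"

lemma add_coset_eq_iff:
  assumes "add_subgroup B"
  shows "add_coset B x = add_coset B y \<longleftrightarrow> x - y \<in> B"
proof
  assume "add_coset B x = add_coset B y"
  moreover have "x \<in> add_coset B x" using add_subgroupD[OF assms] by (simp add: add_coset_def)
  ultimately show "x - y \<in> B" by (simp add: add_coset_def)
next
  assume xy: "x - y \<in> B"
  have "z - x \<in> B \<longleftrightarrow> z - y \<in> B" for z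
    using add_subgroupD(4)[OF assms, of "z - x" "x - y"] add_subgroupD(2)[OF assms, of "z - y" "x - y"] xy
    by auto
  then show "add_coset B x = add_coset B y" by (simp add: add_coset_def)
qed

lemma image_factor:
  assumes "finite (h ` A)" "\<And>x y. x \<in> A \<Longrightarrow> y \<in> A \<Longrightarrow> h x = h y \<Longrightarrow> f x = f y"
  shows "finite (f ` A)" "card (f ` A) \<le> card (h ` A)"
proof -
  have "f ` A \<subseteq> (\<lambda>v. f (inv_into A h v)) ` (h ` A)"
  proof safe
    fix x assume "x \<in> A"
    then have "f x = f (inv_into A h (h x))"
      by (intro assms(2)) (auto simp: inv_into_into f_inv_into_f)
    then show "f x \<in> (\<lambda>v. f (inv_into A h v)) ` h ` A"
      using \<open>x \<in> A\<close> by blast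
  qed
  then show "finite (f ` A)" "card (f ` A) \<le> card (h ` A)"
    by (rule finite_surj[OF assms(1)], rule surj_card_le[OF assms(1)])
qed

text \<open>Sums of representatives of \<open>A / B\<close> and of \<open>B / C\<close> represent \<open>A / C\<close>.\<close>

lemma index_mult:
  assumes A: "add_subgroup A" and B: "add_subgroup B" and C: "add_subgroup C"
    and sub: "C \<subseteq> B" "B \<subseteq> A" and fin: "finite_index A B" "finite_index B C"
  shows "finite_index A C" "index A C = index A B * index B C"
proof -
  define r where "r = (\<lambda>X. SOME x. x \<in> A \<and> add_coset B x = X)"
  define s where "s = (\<lambda>X. SOME x. x \<in> B \<and> add_coset C x = X)"
  have r: "r X \<in> A" "add_coset B (r X) = X" if "X \<in> add_coset B ` A" for X
  proof -
    have "\<exists>x. x \<in> A \<and> add_coset B x = X" using that by auto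
    from someI_ex[OF this] show "r X \<in> A" "add_coset B (r X) = X" by (auto simp: r_def)
  qed
  have s: "s X \<in> B" "add_coset C (s X) = X" if "X \<in> add_coset C ` B" for X
  proof -
    have "\<exists>x. x \<in> B \<and> add_coset C x = X" using that by auto
    from someI_ex[OF this] show "s X \<in> B" "add_coset C (s X) = X" by (auto simp: s_def)
  qed
  have "bij_betw (\<lambda>(X, Y). add_coset C (r X + s Y)) (add_coset B ` A \<times> add_coset C ` B) (add_coset C ` A)"
    unfolding bij_betw_def
  proof
    show "inj_on (\<lambda>(X, Y). add_coset C (r X + s Y)) (add_coset B ` A \<times> add_coset C ` B)"
    proof (rule inj_onI, clarify)
      fix a b a' b'
      assume in_AB: "a \<in> A" "a' \<in> A" "b \<in> B" "b' \<in> B"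
        and eq: "add_coset C (r (add_coset B a) + s (add_coset C b)) =
          add_coset C (r (add_coset B a') + s (add_coset C b'))"
      define x y x' y' where defs: "x = r (add_coset B a)" "y = s (add_coset C b)"
        "x' = r (add_coset B a')" "y' = s (add_coset C b')"
      have y: "y \<in> B" "y' \<in> B" and xa: "add_coset B x = add_coset B a" "add_coset B x' = add_coset B a'"
        and yb: "add_coset C y = add_coset C b" "add_coset C y' = add_coset C b'"
        using in_AB r s by (auto simp: defs)
      have C': "(x + y) - (x' + y') \<in> C" using eq C by (simp add: add_coset_eq_iff defs)
      have "(x + y - (x' + y')) + (y' - y) \<in> B"
        using C' sub y add_subgroupD(2)[OF B y(2,1)] by (intro add_subgroupD(4)[OF B]) auto
      then have "add_coset B x = add_coset B x'" using B by (simp add: add_coset_eq_iff algebra_simps)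
      then have ab: "add_coset B a = add_coset B a'" using xa by simp
      then have "x = x'" by (simp add: defs)
      then have "add_coset C y = add_coset C y'" using C' C by (simp add: add_coset_eq_iff)
      then have "add_coset C b = add_coset C b'" using yb by simp
      with ab show "add_coset B a = add_coset B a' \<and> add_coset C b = add_coset C b'" by simp
    qed
    show "(\<lambda>(X, Y). add_coset C (r X + s Y)) ` (add_coset B ` A \<times> add_coset C ` B) = add_coset C ` A"
    proof safe
      fix a b assume "a \<in> A" "b \<in> B"
      then have "r (add_coset B a) + s (add_coset C b) \<in> A"
        using r s sub by (intro add_subgroupD[OF A]) auto
      then show "add_coset C (r (add_coset B a) + s (add_coset C b)) \<in> add_coset C ` A" by blast
    next
      fix a assume a: "a \<in> A"
      define x where "x = r (add_coset B a)"
      have "add_coset B a = add_coset B x" using r a by (simp add: x_def)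
      then have b: "a - x \<in> B" using B by (simp add: add_coset_eq_iff)
      then have "add_coset C (s (add_coset C (a - x))) = add_coset C (a - x)" using s by simp
      then have "s (add_coset C (a - x)) - (a - x) \<in> C" using C by (simp add: add_coset_eq_iff)
      then have "add_coset C (x + s (add_coset C (a - x))) = add_coset C a"
        using C by (simp add: add_coset_eq_iff algebra_simps)
      then show "add_coset C a \<in> (\<lambda>(X, Y). add_coset C (r X + s Y)) ` (add_coset B ` A \<times> add_coset C ` B)"
        using a b by (intro image_eqI[of _ _ "(add_coset B a, add_coset C (a - x))"]) (auto simp: x_def)
    qed
  qed
  note bij = this
  show "finite_index A C"
    using bij_betw_finite[OF bij] fin by (simp add: finite_index_def)
  show "index A C = index A B * index B C"
    using bij_betw_same_card[OF bij] by (simp add: index_def card_cartesian_product)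
qed

lemma index_scale:
  fixes a :: "'k::field"
  assumes "a \<noteq> 0"
  shows "index ((*) a ` A) ((*) a ` B) = index A B"
    "finite_index ((*) a ` A) ((*) a ` B) \<longleftrightarrow> finite_index A B"
proof -
  have "add_coset ((*) a ` B) (a * x) = (*) a ` add_coset B x" for x
  proof safe
    fix y assume "y \<in> add_coset ((*) a ` B) (a * x)"
    then obtain b where "b \<in> B" "y - a * x = a * b" by (auto simp: add_coset_def)
    then have "y = a * (x + b)" "x + b \<in> add_coset B x" by (auto simp: add_coset_def algebra_simps)
    then show "y \<in> (*) a ` add_coset B x" by blast
  qed (auto simp: add_coset_def simp flip: right_diff_distrib)
  then have "add_coset ((*) a ` B) ` ((*) a ` A) = (`) ((*) a) ` (add_coset B ` A)"
    by (simp add: image_image)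
  moreover have "inj_on ((`) ((*) a)) (add_coset B ` A)"
    using assms by (intro inj_on_image) (auto simp: inj_on_def)
  ultimately show "index ((*) a ` A) ((*) a ` B) = index A B"
    "finite_index ((*) a ` A) ((*) a ` B) \<longleftrightarrow> finite_index A B"
    by (simp_all add: index_def finite_index_def card_image finite_image_iff)
qed

definition alg_ints :: "'k::field_char_0 set" where
  "alg_ints = {x. algebraic_int x}"

lemma alg_ints_closed:
  "0 \<in> alg_ints" "1 \<in> alg_ints" "of_nat n \<in> alg_ints" "of_int i \<in> alg_ints"
  "x \<in> alg_ints \<Longrightarrow> y \<in> alg_ints \<Longrightarrow> x + y \<in> alg_ints"
  "x \<in> alg_ints \<Longrightarrow> y \<in> alg_ints \<Longrightarrow> x - y \<in> alg_ints"
  "x \<in> alg_ints \<Longrightarrow> y \<in> alg_ints \<Longrightarrow> x * y \<in> alg_ints"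
  "x \<in> alg_ints \<Longrightarrow> x ^ n \<in> alg_ints"
  by (auto simp: alg_ints_def intro: algebraic_int_add algebraic_int_diff algebraic_int_mult
      algebraic_int_power)

definition multiples :: "'k::field_char_0 \<Rightarrow> 'k set" where
  "multiples a = (*) a ` alg_ints"

lemma add_subgroup_alg_ints: "add_subgroup alg_ints"
  by (simp add: add_subgroup_def alg_ints_closed)

lemma add_subgroup_multiples: "add_subgroup (multiples a)"
  unfolding add_subgroup_def multiples_def
proof (intro conjI ballI)
  show "0 \<in> (*) a ` alg_ints" using alg_ints_closed(1) by force
next
  fix x y assume "x \<in> (*) a ` alg_ints" "y \<in> (*) a ` alg_ints"
  then obtain u v where "u \<in> alg_ints" "v \<in> alg_ints" "x = a * u" "y = a * v" by auto
  then show "x - y \<in> (*) a ` alg_ints"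
    by (intro image_eqI[of _ _ "u - v"]) (auto simp: algebra_simps alg_ints_closed)
qed

lemma multiples_mult_subset: "b \<in> alg_ints \<Longrightarrow> multiples (a * b) \<subseteq> multiples a"
  by (auto simp: multiples_def mult.assoc alg_ints_closed)

lemma multiples_subset: "a \<in> alg_ints \<Longrightarrow> multiples a \<subseteq> alg_ints"
  by (auto simp: multiples_def alg_ints_closed)

lemma index_principal_mult:
  assumes "a \<in> alg_ints" "b \<in> alg_ints" "a \<noteq> 0"
    and "finite_index alg_ints (multiples a)" "finite_index alg_ints (multiples b)"
  shows "index alg_ints (multiples (a * b)) = index alg_ints (multiples a) * index alg_ints (multiples b)"
proof -
  have scale: "index (multiples a) (multiples (a * b)) = index alg_ints (multiples b)"
    "finite_index (multiples a) (multiples (a * b)) \<longleftrightarrow> finite_index alg_ints (multiples b)"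
    using index_scale[OF assms(3), of alg_ints "multiples b"] by (simp_all add: multiples_def image_image mult.assoc)
  show ?thesis
    using index_mult(2)[OF add_subgroup_alg_ints add_subgroup_multiples[of a] add_subgroup_multiples[of "a * b"]]
      multiples_mult_subset[OF assms(2)] multiples_subset[OF assms(1)] assms(4,5) scale by simp
qed

text \<open>Let \<open>W\<close> be a lattice with \<open>D O \<subseteq> W \<subseteq> O\<close>. Two elements \<open>x\<close>, \<open>y\<close> of \<open>O\<close> are congruent modulo
  \<open>m\<close> as soon as the coordinates of \<open>D x\<close> and \<open>D y\<close> on \<open>W\<close> are congruent modulo \<open>D m\<close>. The constant \<open>D ^ d\<close> is
  harmless: it disappears on passing to powers of \<open>m\<close>.\<close>

lemma finite_index_principal_nat:
  assumes nf: "number_field TYPE('k::field_char_0)"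
  obtains D where "\<forall>m>0. finite_index alg_ints (multiples (of_nat m :: 'k)) \<and>
    index alg_ints (multiples (of_nat m :: 'k)) \<le> (D * m) ^ card (embs :: ('k \<Rightarrow> complex) set)"
proof -
  define d where "d = card (embs :: ('k \<Rightarrow> complex) set)"
  obtain w :: "nat \<Rightarrow> 'k" and D where w: "\<And>i. algebraic_int (w i)" and D: "D > 0"
    "\<And>x. algebraic_int x \<Longrightarrow> of_nat D * x \<in> int_span w {..<d}"
    using integer_lattice[OF nf] unfolding d_def by metis
  have "\<forall>x. \<exists>c::nat \<Rightarrow> int. algebraic_int x \<longrightarrow> of_nat D * x = (\<Sum>i<d. of_int (c i) * w i)"
    using D(2) by (auto simp: int_span_def)
  from choice[OF this] obtain c :: "'k \<Rightarrow> nat \<Rightarrow> int"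
    where c: "\<forall>x. algebraic_int x \<longrightarrow> of_nat D * x = (\<Sum>i<d. of_int (c x i) * w i)" ..
  have "finite_index alg_ints (multiples (of_nat m :: 'k)) \<and>
    index alg_ints (multiples (of_nat m :: 'k)) \<le> (D * m) ^ d" if m: "m > 0" for m
  proof -
    define h where "h = (\<lambda>x. \<lambda>i\<in>{..<d}. c x i mod int (D * m))"
    have same: "add_coset (multiples (of_nat m)) x = add_coset (multiples (of_nat m)) y"
      if x: "x \<in> alg_ints" and y: "y \<in> alg_ints" and hxy: "h x = h y" for x y
    proof -
      have "int (D * m) dvd c x i - c y i" if "i < d" for i
        using fun_cong[OF hxy, of i] that by (simp add: h_def mod_eq_dvd_iff)
      then have "\<forall>i. \<exists>k. i < d \<longrightarrow> c x i - c y i = int (D * m) * k"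
        by (auto elim!: dvdE)
      from choice[OF this] obtain k
        where k: "\<forall>i. i < d \<longrightarrow> c x i - c y i = int (D * m) * k i" ..
      have "of_nat D * (x - y) = (\<Sum>i<d. of_int (c x i - c y i) * w i)"
        using x y c by (simp add: alg_ints_def algebra_simps sum_subtractf)
      also have "\<dots> = (\<Sum>i<d. of_int (int (D * m) * k i) * w i)"
        by (intro sum.cong) (auto simp: k)
      also have "\<dots> = of_nat D * (of_nat m * (\<Sum>i<d. of_int (k i) * w i))"
        by (simp add: sum_distrib_left mult.assoc)
      finally have "x - y = of_nat m * (\<Sum>i<d. of_int (k i) * w i)" using D(1) by simp
      moreover have "(\<Sum>i<d. of_int (k i) * w i) \<in> alg_ints"
        using w by (auto simp: alg_ints_def intro!: algebraic_int_sum algebraic_int_mult)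
      ultimately have "x - y \<in> multiples (of_nat m)" by (auto simp: multiples_def)
      then show ?thesis by (simp add: add_coset_eq_iff add_subgroup_multiples)
    qed
    have sub: "h ` alg_ints \<subseteq> PiE {..<d} (\<lambda>_. {0..<int (D * m)})"
      using D(1) m by (auto simp: h_def split: if_splits)
    then have fin: "finite (h ` alg_ints)"
      by (rule finite_subset) (simp add: finite_PiE)
    have "card (h ` alg_ints) \<le> card (PiE {..<d} (\<lambda>_. {0..<int (D * m)}))"
      using sub by (intro card_mono) (simp_all add: finite_PiE)
    also have "\<dots> = (D * m) ^ d" by (simp add: card_PiE nat_mult_distrib)
    finally have "card (h ` alg_ints) \<le> (D * m) ^ d" .
    moreover have "card (add_coset (multiples (of_nat m :: 'k)) ` alg_ints) \<le> card (h ` alg_ints)"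
      by (rule image_factor(2)[OF fin]) (rule same)
    moreover have "finite (add_coset (multiples (of_nat m :: 'k)) ` alg_ints)"
      by (rule image_factor(1)[OF fin]) (rule same)
    ultimately show ?thesis by (simp add: finite_index_def index_def)
  qed
  then show thesis using that[of D] unfolding d_def by blast
qed

lemma finite_index_superset:
  assumes "add_subgroup B" "add_subgroup C" "C \<subseteq> B" "finite_index A C"
  shows "finite_index A B"
  using assms image_factor(1)[of "add_coset C" A "add_coset B"]
  by (auto simp: finite_index_def add_coset_eq_iff)

lemma finite_index_principal:
  assumes nf: "number_field TYPE('k::field_char_0)" and a: "a \<in> alg_ints" "(a::'k) \<noteq> 0"
  shows "finite_index alg_ints (multiples a)"
proof -
  obtain m y where m: "m > 0" "algebraic_int y" "a * y = of_nat m"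
    using algebraic_int_dvd_nat[of a] a by (auto simp: alg_ints_def)
  have "multiples (of_nat m) \<subseteq> multiples a"
    using multiples_mult_subset[of y a] m by (simp add: alg_ints_def)
  moreover have "finite_index alg_ints (multiples (of_nat m :: 'k))"
    using finite_index_principal_nat[OF nf] m(1) by metis
  ultimately show ?thesis
    using finite_index_superset add_subgroup_multiples by blast
qed

lemma index_principal_power:
  assumes nf: "number_field TYPE('k::field_char_0)" and a: "a \<in> alg_ints" "(a::'k) \<noteq> 0"
  shows "index alg_ints (multiples (a ^ k)) = index alg_ints (multiples a) ^ k"
proof (induction k)
  case 0
  have "add_coset alg_ints ` alg_ints = {alg_ints :: 'k set}"
  proof -
    have "add_coset alg_ints x = add_coset alg_ints (0::'k)" if "x \<in> alg_ints" for x :: 'k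
      using that by (simp add: add_coset_eq_iff add_subgroup_alg_ints)
    moreover have "add_coset alg_ints (0::'k) = alg_ints" by (simp add: add_coset_def)
    ultimately show ?thesis using alg_ints_closed(1) by auto
  qed
  then show ?case by (simp add: index_def multiples_def)
next
  case (Suc k)
  then show ?case
    using index_principal_mult[of a "a ^ k"] a finite_index_principal[OF nf] alg_ints_closed(8)[OF a(1), of k]
    by simp
qed

lemma le_if_powers_le:
  fixes x y C :: real
  assumes "x > 0" "y > 0" "\<And>k. x ^ k \<le> C * y ^ k"
  shows "x \<le> y"
proof (rule ccontr)
  assume "\<not> x \<le> y"
  then have "x / y > 1" using assms by simp
  then obtain k where "C < (x / y) ^ k" using real_arch_pow by blast
  then have "C * y ^ k < x ^ k" using assms by (simp add: power_divide field_simps)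
  then show False using assms(3)[of k] by simp
qed

text \<open>Let \<open>N = [O : a O]\<close> and \<open>T ^ d \<le> N < (T + 1) ^ d\<close>. Among the combinations of \<open>d\<close> lattice
  vectors with coefficients from \<open>0\<close> to \<open>T\<close>, two are congruent modulo \<open>a\<close>. Their difference is a nonzero multiple
  of \<open>a\<close>, whose norm is at least that of \<open>a\<close>, and it has norm at most a constant times \<open>N\<close>.\<close>

lemma emb_norm_le_index:
  assumes nf: "number_field TYPE('k::field_char_0)"
  obtains C where "\<forall>a\<in>alg_ints. (a::'k) \<noteq> 0 \<longrightarrow> emb_norm a \<le> C * real (index alg_ints (multiples a))"
proof -
  define d where "d = card (embs :: ('k \<Rightarrow> complex) set)"
  obtain w :: "nat \<Rightarrow> 'k" where w: "\<And>i. algebraic_int (w i)" "rat_indep w {..<d}"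
    using integer_lattice[OF nf] unfolding d_def by metis
  define C where "C = (\<Prod>\<tau>\<in>(embs :: ('k \<Rightarrow> complex) set). \<Sum>i<d. cmod (\<tau> (w i)))"
  have "C \<ge> 0" unfolding C_def by (intro prod_nonneg sum_nonneg) auto
  have "d > 0"
    using power_basis[OF nf] bij_betw_same_card unfolding d_def
    by (metis card_lessThan)
  have "emb_norm a \<le> C * real (index alg_ints (multiples a))" if a: "a \<in> alg_ints" "a \<noteq> 0" for a :: 'k
  proof -
    define N where "N = index alg_ints (multiples a)"
    have fin: "finite (add_coset (multiples a) ` alg_ints)"
      using finite_index_principal[OF nf a] by (simp add: finite_index_def)
    have "\<exists>T. N < Suc T ^ d"
      using \<open>d > 0\<close> by (intro exI[of _ N]) (metis less_Suc_eq_le less_le_trans self_le_power zero_less_Suc Suc_le_eq One_nat_def)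
    define T where "T = (LEAST T. N < Suc T ^ d)"
    have T: "N < Suc T ^ d" unfolding T_def by (rule LeastI_ex) fact
    have T': "T ^ d \<le> N"
    proof (cases T)
      case (Suc t)
      then show ?thesis using not_less_Least[of t "\<lambda>T. N < Suc T ^ d"] by (simp add: T_def[symmetric])
    qed (use \<open>d > 0\<close> in \<open>simp add: zero_power\<close>)
    define F where "F = PiE {..<d} (\<lambda>_. {0..T})"
    define h where "h = (\<lambda>c. add_coset (multiples a) (\<Sum>i<d. of_nat (c i) * w i))"
    have "h ` F \<subseteq> add_coset (multiples a) ` alg_ints"
      unfolding h_def using w
      by (auto simp: alg_ints_def intro!: imageI algebraic_int_sum algebraic_int_mult)
    then have "card (h ` F) \<le> N" unfolding N_def index_def by (intro card_mono fin)
    also have "\<dots> < card F" using T by (simp add: F_def card_PiE)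
    finally have "\<not> inj_on h F" using card_image by fastforce
    then obtain c c' where c: "c \<in> F" "c' \<in> F" "c \<noteq> c'" "h c = h c'" by (auto simp: inj_on_def)
    define z where "z = (\<Sum>i<d. of_rat (of_nat (c i) - of_nat (c' i)) * w i)"
    have z_diff: "z = (\<Sum>i<d. of_nat (c i) * w i) - (\<Sum>i<d. of_nat (c' i) * w i)"
      by (simp add: z_def of_rat_diff left_diff_distrib sum_subtractf)
    then have "z \<in> multiples a"
      using c(4) by (simp add: h_def add_coset_eq_iff add_subgroup_multiples)
    then obtain y where y: "y \<in> alg_ints" "z = a * y" by (auto simp: multiples_def)
    have "z \<noteq> 0"
    proof
      assume "z = 0"
      have "c i = c' i" if "i < d" for i
        using rat_indepD[OF w(2), of "\<lambda>i. of_nat (c i) - of_nat (c' i)" i] that \<open>z = 0\<close>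
        by (simp add: z_def)
      then have "c = c'" using c(1,2) unfolding F_def by (intro PiE_ext) auto
      with c(3) show False by simp
    qed
    then have "emb_norm y \<ge> 1" using emb_norm_integer_ge_1[OF nf, of y] y by (auto simp: alg_ints_def)
    then have "emb_norm a \<le> emb_norm z"
      using emb_norm_pos[OF nf a(2)] y by (simp add: emb_norm_mult)
    also have "emb_norm z \<le> (\<Prod>\<tau>\<in>(embs :: ('k \<Rightarrow> complex) set). real T * (\<Sum>i<d. cmod (\<tau> (w i))))"
      unfolding emb_norm_def
    proof (intro prod_mono conjI)
      fix \<tau> :: "'k \<Rightarrow> complex" assume "\<tau> \<in> embs"
      then have \<tau>: "embedding \<tau>" by (simp add: embs_def)
      interpret \<tau>: field_hom \<tau> using \<tau> by (rule embedding_field_hom)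
      have "cmod (\<tau> z) = cmod (\<Sum>i<d. of_rat (of_nat (c i) - of_nat (c' i)) * \<tau> (w i))"
        by (simp add: z_def \<tau>.hom_sum \<tau>.hom_mult embedding_of_rat[OF \<tau>])
      also have "\<dots> \<le> (\<Sum>i<d. real T * cmod (\<tau> (w i)))"
      proof (intro sum_norm_le)
        fix i assume i: "i \<in> {..<d}"
        have "c i \<le> T" "c' i \<le> T"
          using PiE_mem[OF c(1)[unfolded F_def] i] PiE_mem[OF c(2)[unfolded F_def] i] by simp_all
        then have "\<bar>real (c i) - real (c' i)\<bar> \<le> real T" by linarith
        moreover have "of_rat (of_nat (c i) - of_nat (c' i)) = complex_of_real (real (c i) - real (c' i))"
          by (simp add: of_rat_diff)
        ultimately have "cmod (of_rat (of_nat (c i) - of_nat (c' i))) \<le> real T"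
          by (simp only: norm_of_real)
        then show "cmod (of_rat (of_nat (c i) - of_nat (c' i)) * \<tau> (w i)) \<le> real T * cmod (\<tau> (w i))"
          by (simp add: norm_mult mult_right_mono)
      qed
      finally show "cmod (\<tau> z) \<le> real T * (\<Sum>i<d. cmod (\<tau> (w i)))"
        by (simp add: sum_distrib_left)
    qed auto
    also have "\<dots> = real T ^ d * C" by (simp add: prod.distrib C_def d_def)
    also have "\<dots> \<le> C * real N"
      using T' \<open>C \<ge> 0\<close> by (simp add: mult.commute mult_left_mono flip: of_nat_power)
    finally show ?thesis by (simp add: N_def)
  qed
  then show thesis using that by blast
qed

text \<open>Both sides are multiplicative. Passing to powers removes the constant, so the norm is at
  most the index. For positive integers the opposite inequality is visible on the lattice, and
  every \<open>a\<close> divides a positive integer.\<close>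

theorem index_principal:
  assumes nf: "number_field TYPE('k::field_char_0)" and a: "a \<in> alg_ints" "(a::'k) \<noteq> 0"
  shows "real (index alg_ints (multiples a)) = emb_norm a"
proof -
  define n where "n = (\<lambda>x::'k. real (index alg_ints (multiples x)))"
  have n_pos: "n x > 0" if "x \<in> alg_ints" "x \<noteq> 0" for x
    using finite_index_principal[OF nf that] alg_ints_closed(1)
    by (auto simp: n_def index_def finite_index_def card_gt_0_iff)
  obtain C where C: "\<forall>a\<in>alg_ints. (a::'k) \<noteq> 0 \<longrightarrow> emb_norm a \<le> C * n a"
    using emb_norm_le_index[OF nf] unfolding n_def by blast
  have "emb_norm (1::'k) = 1" by (simp add: emb_norm_def embs_def embedding_def)
  then have emb_norm_power: "emb_norm (x ^ k) = emb_norm x ^ k" for x :: 'k and k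
    by (induction k) (auto simp: emb_norm_mult)
  have le: "emb_norm x \<le> n x" if x: "x \<in> alg_ints" "x \<noteq> 0" for x
  proof (rule le_if_powers_le)
    show "emb_norm x ^ k \<le> C * n x ^ k" for k
      using C[rule_format, of "x ^ k"] x index_principal_power[OF nf x]
      by (simp add: emb_norm_power n_def alg_ints_closed)
  qed (use emb_norm_pos[OF nf x(2)] n_pos[OF x] in auto)
  define d where "d = card (embs :: ('k \<Rightarrow> complex) set)"
  obtain D where D: "\<forall>m>0. index alg_ints (multiples (of_nat m :: 'k)) \<le> (D * m) ^ d"
    using finite_index_principal_nat[OF nf] unfolding d_def by metis
  have nat: "n (of_nat m) \<le> emb_norm (of_nat m :: 'k)" if m: "m > 0" for m
  proof (rule le_if_powers_le)
    have "cmod (\<tau> (of_nat m)) = real m" if "\<tau> \<in> embs" for \<tau> :: "'k \<Rightarrow> complex"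
      using embedding_of_rat[of \<tau> "of_nat m"] that by (simp add: embs_def)
    then have norm: "emb_norm (of_nat m :: 'k) = real m ^ d"
      by (simp add: emb_norm_def d_def)
    show "n (of_nat m) ^ k \<le> real D ^ d * emb_norm (of_nat m :: 'k) ^ k" for k
    proof -
      have "n (of_nat m) ^ k = n (of_nat (m ^ k))"
        using index_principal_power[OF nf, of "of_nat m" k] m by (simp add: n_def alg_ints_closed)
      also have "\<dots> \<le> real ((D * m ^ k) ^ d)"
        unfolding n_def using D[rule_format, of "m ^ k"] m by (intro of_nat_mono) simp
      finally show ?thesis by (simp add: norm power_mult_distrib power_mult[symmetric] mult.commute)
    qed
  qed (use m emb_norm_pos[OF nf, of "of_nat m :: 'k"] n_pos[of "of_nat m"] alg_ints_closed(3) in auto)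
  obtain m y where m: "m > 0" "algebraic_int y" "a * y = of_nat m"
    using algebraic_int_dvd_nat[of a] a by (auto simp: alg_ints_def)
  have y: "y \<in> alg_ints" "y \<noteq> 0" using m by (auto simp: alg_ints_def)
  have "n a * n y = n (of_nat m)"
    using index_principal_mult[OF a(1) y(1) a(2) finite_index_principal[OF nf a] finite_index_principal[OF nf y]]
    by (simp add: n_def m(3))
  also have "\<dots> \<le> emb_norm a * emb_norm y"
    using nat[OF m(1)] by (simp add: emb_norm_mult flip: m(3))
  finally have "n a * n y \<le> emb_norm a * n y"
    using mult_left_mono[OF le[OF y], of "emb_norm a"] emb_norm_pos[OF nf a(2)] by linarith
  then have "n a \<le> emb_norm a" using n_pos[OF y] by simp
  with le[OF a] show ?thesis by (simp add: n_def)
qed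


section \<open>Prime ideals of the ring of integers\<close>

text \<open>Ideals and nonzero prime ideals of \<open>integer_ring\<close> as subsets of the field, with the field
  operations; \<open>ideal_integer_ring_iff\<close> and \<open>primeideal_integer_ring_iff\<close> relate them to the locales.\<close>

definition int_ideal :: "'k::field_char_0 set \<Rightarrow> bool" where
  "int_ideal I \<longleftrightarrow> add_subgroup I \<and> I \<subseteq> alg_ints \<and> (\<forall>x\<in>alg_ints. \<forall>y\<in>I. x * y \<in> I)"

definition int_prime :: "'k::field_char_0 set \<Rightarrow> bool" where
  "int_prime p \<longleftrightarrow> int_ideal p \<and> 1 \<notin> p \<and> p \<noteq> {0} \<and>
    (\<forall>a\<in>alg_ints. \<forall>b\<in>alg_ints. a * b \<in> p \<longrightarrow> a \<in> p \<or> b \<in> p)"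

lemma int_idealD:
  assumes "int_ideal I"
  shows "add_subgroup I" "0 \<in> I" "x \<in> I \<Longrightarrow> x \<in> alg_ints" "x \<in> alg_ints \<Longrightarrow> y \<in> I \<Longrightarrow> x * y \<in> I"
    "x \<in> alg_ints \<Longrightarrow> y \<in> I \<Longrightarrow> y * x \<in> I"
    "x \<in> I \<Longrightarrow> y \<in> I \<Longrightarrow> x + y \<in> I" "x \<in> I \<Longrightarrow> y \<in> I \<Longrightarrow> x - y \<in> I"
  using assms add_subgroupD[of I] by (auto simp: int_ideal_def mult.commute)

lemma integer_ring_simps:
  "carrier integer_ring = alg_ints" "x \<otimes>\<^bsub>integer_ring\<^esub> y = x * y" "x \<oplus>\<^bsub>integer_ring\<^esub> y = x + y"
  "\<zero>\<^bsub>integer_ring\<^esub> = 0" "\<one>\<^bsub>integer_ring\<^esub> = 1"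
  by (simp_all add: integer_ring_def alg_ints_def)

lemma cring_integer_ring: "cring (integer_ring :: 'k::field_char_0 ring)"
proof (rule cringI)
  show "abelian_group (integer_ring :: 'k ring)"
  proof (rule abelian_groupI)
    fix x :: 'k assume "x \<in> carrier integer_ring"
    then show "\<exists>y\<in>carrier integer_ring. y \<oplus>\<^bsub>integer_ring\<^esub> x = \<zero>\<^bsub>integer_ring\<^esub>"
      by (intro bexI[of _ "- x"]) (auto simp: integer_ring_simps alg_ints_def)
  qed (auto simp: integer_ring_simps alg_ints_closed)
  show "Group.comm_monoid (integer_ring :: 'k ring)"
    by (rule comm_monoidI) (auto simp: integer_ring_simps alg_ints_closed)
qed (auto simp: integer_ring_simps algebra_simps)

lemma ideal_integer_ring_iff: "ideal I integer_ring \<longleftrightarrow> int_ideal I"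
proof
  assume "ideal I integer_ring"
  then interpret ideal I "integer_ring :: 'a ring" .
  have mult: "x * y \<in> I" if "x \<in> alg_ints" "y \<in> I" for x y
    using I_l_closed[of y x] that by (simp add: integer_ring_simps)
  have add: "x + y \<in> I" if "x \<in> I" "y \<in> I" for x y
    using additive_subgroup.a_closed[OF is_additive_subgroup, of x y] that by (simp add: integer_ring_simps)
  have "x - y \<in> I" if "x \<in> I" "y \<in> I" for x y
    using add[OF that(1) mult[of "- 1" y]] that alg_ints_closed(4)[of "- 1"] by simp
  then show "int_ideal I"
    using additive_subgroup.zero_closed[OF is_additive_subgroup] a_subset mult
    by (auto simp: int_ideal_def add_subgroup_def integer_ring_simps)
next
  assume I: "int_ideal I"
  interpret cring "integer_ring :: 'a ring" by (rule cring_integer_ring)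
  show "ideal I integer_ring"
  proof (rule idealI)
    show "subgroup I (add_monoid integer_ring)"
    proof
      fix x assume x: "x \<in> I"
      have "inv\<^bsub>add_monoid integer_ring\<^esub> x = - x"
        using minus_equality[of "- x" x] int_idealD(3)[OF I x]
        by (simp add: a_inv_def integer_ring_simps alg_ints_def)
      then show "inv\<^bsub>add_monoid integer_ring\<^esub> x \<in> I"
        using add_subgroupD(3)[OF int_idealD(1)[OF I] x] by simp
    qed (use int_idealD[OF I] in \<open>auto simp: integer_ring_simps\<close>)
  qed (use int_idealD[OF I] in \<open>auto simp: integer_ring_simps ring_axioms\<close>)
qed

lemma primeideal_integer_ring_iff:
  "primeideal p integer_ring \<and> p \<noteq> {0} \<longleftrightarrow> int_prime p"
proof -
  have carrier: "alg_ints = p \<longleftrightarrow> 1 \<in> p" if "int_ideal p"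
    using int_idealD(3)[OF that] int_idealD(4)[OF that, of _ 1] alg_ints_closed(2) by auto
  show ?thesis
  proof
    assume p: "primeideal p integer_ring \<and> p \<noteq> {0}"
    then interpret primeideal p "integer_ring :: 'a ring" by simp
    have "int_ideal p" using is_ideal by (simp add: ideal_integer_ring_iff)
    then show "int_prime p"
      using I_notcarr I_prime carrier p by (auto simp: int_prime_def integer_ring_simps)
  next
    assume p: "int_prime p"
    then have ideal: "int_ideal p" and p': "1 \<notin> p" "p \<noteq> {0}"
      "\<And>a b. a \<in> alg_ints \<Longrightarrow> b \<in> alg_ints \<Longrightarrow> a * b \<in> p \<Longrightarrow> a \<in> p \<or> b \<in> p"
      by (auto simp: int_prime_def)
    have "primeideal p integer_ring"
      by (rule primeidealI)
        (use ideal carrier p' cring_integer_ring in \<open>simp_all add: integer_ring_simps ideal_integer_ring_iff\<close>)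
    with p' show "primeideal p integer_ring \<and> p \<noteq> {0}" by simp
  qed
qed

lemma ideal_norm_eq_index: "ideal_norm p = index alg_ints p"
proof -
  have "p +>\<^bsub>integer_ring\<^esub> x = add_coset p x" for x :: 'a
    by (auto simp: a_r_coset_def' integer_ring_simps add_coset_def intro!: bexI[of _ "_ - x"])
  then have "carrier (integer_ring Quot p) = add_coset p ` alg_ints"
    by (auto simp: FactRing_def A_RCOSETS_def' integer_ring_simps)
  then show ?thesis by (simp add: ideal_norm_def index_def)
qed

lemma multiples_subset_ideal: "int_ideal I \<Longrightarrow> a \<in> I \<Longrightarrow> multiples a \<subseteq> I"
  by (auto simp: multiples_def int_idealD)

lemma int_ideal_multiples:
  fixes a :: "'k::field_char_0"
  assumes a: "a \<in> alg_ints"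
  shows "int_ideal (multiples a)"
  unfolding int_ideal_def
proof (intro conjI ballI)
  show "multiples a \<subseteq> alg_ints" using multiples_subset[OF a] .
  fix x y :: 'k assume "x \<in> alg_ints" "y \<in> multiples a"
  then obtain z where "z \<in> alg_ints" "y = a * z" by (auto simp: multiples_def)
  then have "x * y = a * (x * z)" "x * z \<in> alg_ints"
    using \<open>x \<in> alg_ints\<close> by (auto simp: alg_ints_closed)
  then show "x * y \<in> multiples a" by (auto simp: multiples_def)
qed (rule add_subgroup_multiples)

lemma int_ideal_alg_ints: "int_ideal alg_ints"
  by (auto simp: int_ideal_def add_subgroup_alg_ints alg_ints_closed)

lemma int_primeD:
  assumes "int_prime p"
  shows "int_ideal p" "1 \<notin> p" "a \<in> alg_ints \<Longrightarrow> b \<in> alg_ints \<Longrightarrow> a * b \<in> p \<Longrightarrow> a \<in> p \<or> b \<in> p"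
  using assms by (auto simp: int_prime_def)

lemma int_prime_power:
  assumes "int_prime p" "a \<in> alg_ints" "a ^ n \<in> p"
  shows "a \<in> p"
  using assms(3)
proof (induction n)
  case (Suc n)
  then show ?case using int_primeD(3)[OF assms(1,2) alg_ints_closed(8)[OF assms(2), of n]] by auto
qed (use int_primeD[OF assms(1)] in simp)

lemma pigeonhole_coset:
  assumes "add_subgroup B" "finite_index A B" "\<And>n::nat. f n \<in> A"
  obtains i j where "i < j" "f i - f j \<in> B"
proof -
  have "finite (range (\<lambda>n. add_coset B (f n)))"
    by (rule finite_subset[of _ "add_coset B ` A"]) (use assms in \<open>auto simp: finite_index_def\<close>)
  then have "\<not> inj (\<lambda>n. add_coset B (f n))"
    using finite_imageD by auto
  then obtain i j where ij: "i \<noteq> j" "add_coset B (f i) = add_coset B (f j)"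
    by (auto simp: inj_on_def)
  then have "f i - f j \<in> B" "f j - f i \<in> B"
    using add_coset_eq_iff[OF assms(1), of "f i" "f j"] add_coset_eq_iff[OF assms(1), of "f j" "f i"]
    by simp_all
  then show thesis using that ij(1) by (cases "i < j") (auto simp: not_less order_le_less)
qed

lemma int_ideal_nonzero_element:
  assumes "int_ideal I" "I \<noteq> {0}"
  obtains a where "a \<in> I" "a \<noteq> 0" "a \<in> alg_ints"
  using assms int_idealD[OF assms(1)] by blast

definition prime_power :: "'k::field_char_0 set \<Rightarrow> nat \<Rightarrow> 'k set" where
  "prime_power p m = p [^]\<^bsub>ideals_set integer_ring\<^esub> m"

lemma prime_power_0: "prime_power p 0 = alg_ints"
  by (simp add: prime_power_def ideals_set_def integer_ring_simps)

lemma prime_power_Suc: "prime_power p (Suc m) = prime_power p m \<cdot>\<^bsub>integer_ring\<^esub> p"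
  by (simp add: prime_power_def ideals_set_def)

lemma int_ideal_prime_power:
  assumes "int_ideal p"
  shows "int_ideal (prime_power p m)"
proof (induction m)
  case 0
  then show ?case by (simp add: prime_power_0 int_ideal_alg_ints)
next
  case (Suc m)
  interpret cring "integer_ring :: 'a ring" by (rule cring_integer_ring)
  show ?case
    using ideal_prod_is_ideal[of "prime_power p m" p] Suc assms
    by (simp add: prime_power_Suc ideal_integer_ring_iff)
qed

lemma prime_power_mult: "x \<in> prime_power p m \<Longrightarrow> y \<in> p \<Longrightarrow> x * y \<in> prime_power p (Suc m)"
  using ideal_prod.prod[of x "prime_power p m" y p integer_ring]
  by (simp add: prime_power_Suc integer_ring_simps)

lemma power_in_prime_power: "v \<in> p \<Longrightarrow> v ^ m \<in> prime_power p m"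
proof (induction m)
  case (Suc m)
  then show ?case using prime_power_mult[of "v ^ m" p m v] by (simp add: mult.commute)
qed (simp add: prime_power_0 alg_ints_closed)

lemma prime_power_decreasing:
  assumes "int_ideal p" "m \<le> n"
  shows "prime_power p n \<subseteq> prime_power p m"
  using assms(2)
proof (induction n rule: dec_induct)
  case (step n)
  interpret cring "integer_ring :: 'a ring" by (rule cring_integer_ring)
  have "prime_power p (Suc n) \<subseteq> prime_power p n"
    using ideal_prod_inter[of "prime_power p n" p] int_ideal_prime_power[OF assms(1)] assms(1)
    by (simp add: prime_power_Suc ideal_integer_ring_iff)
  with step show ?case by blast
qed simp

text \<open>If \<open>s\<close> carries \<open>p\<close> into the multiples of \<open>v\<close>, then inverting \<open>s\<close> makes \<open>p ^ m\<close> divisible by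
  \<open>v ^ m\<close>.\<close>

lemma prime_power_local:
  assumes "\<forall>x\<in>p. s * x \<in> multiples v" "x \<in> prime_power p m"
  shows "s ^ m * x \<in> multiples (v ^ m)"
  using assms(2)
proof (induction m arbitrary: x)
  case 0
  then show ?case by (simp add: prime_power_0 multiples_def)
next
  case (Suc m)
  from Suc.prems have "x \<in> prime_power p m \<cdot>\<^bsub>integer_ring\<^esub> p" by (simp add: prime_power_Suc)
  then show ?case
  proof (induction rule: ideal_prod.induct)
    case (prod i j)
    obtain y where y: "y \<in> alg_ints" "s ^ m * i = v ^ m * y"
      using Suc.IH[OF prod(1)] by (auto simp: multiples_def)
    obtain z where z: "z \<in> alg_ints" "s * j = v * z"
      using bspec[OF assms(1) prod(2)] by (auto simp: multiples_def)
    have "s ^ Suc m * (i * j) = (s ^ m * i) * (s * j)" by (simp add: algebra_simps)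
    also have "\<dots> = v ^ Suc m * (y * z)" unfolding y(2) z(2) by (simp add: algebra_simps)
    finally show ?case
      using y z by (auto simp: multiples_def integer_ring_simps alg_ints_closed)
  next
    case (sum x y)
    then show ?case
      using add_subgroupD(4)[OF add_subgroup_multiples]
      by (simp add: distrib_left integer_ring_simps)
  qed
qed


section \<open>The local ring at a prime is a discrete valuation ring\<close>

context
  assumes nf: "number_field TYPE('k::field_char_0)"
begin

lemma finite_index_ideal:
  assumes "int_ideal I" "I \<noteq> {0::'k}"
  shows "finite_index alg_ints I"
proof -
  obtain a where a: "a \<in> I" "a \<noteq> 0" "a \<in> alg_ints"
    using int_ideal_nonzero_element[OF assms] by metis
  then show ?thesis
    using finite_index_superset[OF int_idealD(1)[OF assms(1)] add_subgroup_multiples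
        multiples_subset_ideal[OF assms(1) a(1)] finite_index_principal[OF nf a(3,2)]] by simp
qed

text \<open>In the finite ring \<open>O / a O\<close> the powers of an element of \<open>p\<close> repeat, so they annihilate
  \<open>b\<close> up to factors outside \<open>p\<close>. Killing the elements of \<open>X\<close> one after the other keeps the
  annihilator of \<open>b\<close> inside \<open>p\<close>.\<close>

lemma annihilator_finite:
  assumes p: "int_prime p" and a: "(a::'k) \<in> p" "a \<noteq> 0" and X: "finite X" "X \<subseteq> p"
  shows "\<exists>b\<in>alg_ints. (\<forall>t\<in>alg_ints. t * b \<in> multiples a \<longrightarrow> t \<in> p) \<and> (\<forall>x\<in>X. x * b \<in> multiples a)"
  using X
proof (induction X rule: finite_induct)
  case empty
  show ?case
    using multiples_subset_ideal[OF int_primeD(1)[OF p] a(1)]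
    by (intro bexI[of _ 1]) (auto simp: alg_ints_closed)
next
  case (insert x X)
  note ideal_p = int_idealD[OF int_primeD(1)[OF p]]
  have a_int: "a \<in> alg_ints" and x_int: "x \<in> alg_ints" using a insert ideal_p by auto
  note ideal_a = int_idealD[OF int_ideal_multiples[OF a_int]]
  obtain b where b: "b \<in> alg_ints" "\<forall>t\<in>alg_ints. t * b \<in> multiples a \<longrightarrow> t \<in> p"
    "\<forall>x\<in>X. x * b \<in> multiples a"
    using insert by auto
  define Q where "Q = (\<lambda>k. \<forall>t\<in>alg_ints. t * (b * x ^ k) \<in> multiples a \<longrightarrow> t \<in> p)"
  have "\<exists>k. \<not> Q k"
  proof -
    obtain i j where ij: "i < j" "x ^ i - x ^ j \<in> multiples a"
      using pigeonhole_coset[OF add_subgroup_multiples finite_index_principal[OF nf a_int a(2)],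
          of "\<lambda>n. x ^ n"] x_int alg_ints_closed(8) by metis
    have "x ^ j = x ^ (j - i) * x ^ i" using ij(1) by (simp flip: power_add)
    moreover have "(1 - u) * (b * w) = b * (w - u * w)" for u w
      by (simp add: algebra_simps)
    ultimately have eq: "(1 - x ^ (j - i)) * (b * x ^ i) = b * (x ^ i - x ^ j)"
      by simp
    have "(1 - x ^ (j - i)) * (b * x ^ i) \<in> multiples a"
      unfolding eq by (rule ideal_a(4)[OF b(1) ij(2)])
    moreover have "1 - x ^ (j - i) \<in> alg_ints"
      using x_int by (intro alg_ints_closed)
    moreover have "1 - x ^ (j - i) \<notin> p"
    proof
      assume "1 - x ^ (j - i) \<in> p"
      moreover have "x ^ (j - i) \<in> p"
      proof -
        have "j - i = Suc (j - i - 1)" using ij(1) by simp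
        then have "x ^ (j - i) = x ^ (j - i - 1) * x" by (metis power_Suc2)
        then show ?thesis using ideal_p(4) insert.prems alg_ints_closed(8)[OF x_int] by simp
      qed
      ultimately have "1 \<in> p" using ideal_p(6) by fastforce
      then show False using int_primeD(2)[OF p] by simp
    qed
    ultimately have "\<not> Q i" by (auto simp: Q_def)
    then show ?thesis by blast
  qed
  moreover have "Q 0" using b by (simp add: Q_def)
  ultimately obtain i where i: "Q i" "\<not> Q (Suc i)"
    by (metis nat_induct)
  then obtain s where s: "s \<in> alg_ints" "s * (b * x ^ Suc i) \<in> multiples a" "s \<notin> p"
    by (auto simp: Q_def)
  define b' where "b' = s * (b * x ^ i)"
  have "b' \<in> alg_ints"
    unfolding b'_def using s b x_int by (intro alg_ints_closed)
  moreover have "t \<in> p" if t: "t \<in> alg_ints" "t * b' \<in> multiples a" for t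
  proof -
    have "(t * s) * (b * x ^ i) \<in> multiples a" using t(2) by (simp add: b'_def mult.assoc)
    then have "t * s \<in> p" using i(1) t(1) s(1) alg_ints_closed(7) by (auto simp: Q_def)
    then show ?thesis using int_primeD(3)[OF p t(1) s(1)] s(3) by blast
  qed
  moreover have "y * b' \<in> multiples a" if y: "y \<in> insert x X" for y
  proof (cases "y = x")
    case True
    then show ?thesis using s(2) by (simp add: b'_def algebra_simps)
  next
    case False
    then have "y * b \<in> multiples a" using b(3) y by blast
    moreover have "s * x ^ i \<in> alg_ints" using s x_int by (auto intro!: alg_ints_closed)
    ultimately have "(s * x ^ i) * (y * b) \<in> multiples a" by (rule ideal_a(4)[rotated])
    then show ?thesis by (simp add: b'_def algebra_simps)
  qed
  ultimately show ?case by (intro bexI[of _ b'] conjI ballI impI)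
qed

text \<open>With \<open>b\<close> annihilating \<open>p\<close> modulo \<open>a\<close>, the element \<open>\<tau> = b / a\<close> is not an integer but
  \<open>\<tau> p \<subseteq> O\<close>. If \<open>\<tau> p \<subseteq> p\<close>, all \<open>a \<tau> ^ n\<close> would be integers, two of them congruent modulo \<open>a\<close>,
  and \<open>\<tau>\<close> would be a root of the monic equation \<open>X ^ j - X ^ i = c\<close> with \<open>c\<close> an integer. So
  \<open>s = \<tau> v \<notin> p\<close> for some \<open>v \<in> p\<close>, and \<open>s x = v (\<tau> x)\<close> for all \<open>x \<in> p\<close>.\<close>

lemma local_uniformizer:
  assumes p: "int_prime (p::'k set)"
  obtains s v where "s \<in> alg_ints" "s \<notin> p" "v \<in> p" "v \<noteq> 0" "\<forall>x\<in>p. s * x \<in> multiples v"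
proof -
  note ideal_p = int_idealD[OF int_primeD(1)[OF p]]
  obtain a where a: "a \<in> p" "a \<noteq> 0" "a \<in> alg_ints"
    using int_ideal_nonzero_element[of p] p by (auto simp: int_prime_def)
  note ideal_a = int_idealD[OF int_ideal_multiples[OF a(3)]]
  note fin_a = finite_index_principal[OF nf a(3,2)]
  have "p \<subseteq> alg_ints" using ideal_p by blast
  then have "finite (add_coset (multiples a) ` p)"
    using fin_a by (auto simp: finite_index_def intro: finite_subset)
  then obtain X where X: "X \<subseteq> p" "finite X" "add_coset (multiples a) ` p = add_coset (multiples a) ` X"
    using finite_subset_image[of "add_coset (multiples a) ` p" "add_coset (multiples a)" p] by auto
  obtain b where b: "b \<in> alg_ints" "\<And>t. t \<in> alg_ints \<Longrightarrow> t * b \<in> multiples a \<Longrightarrow> t \<in> p"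
    "\<And>x. x \<in> X \<Longrightarrow> x * b \<in> multiples a"
    using annihilator_finite[OF p a(1,2) X(2,1)] by auto
  have b_p: "x * b \<in> multiples a" if x: "x \<in> p" for x
  proof -
    have "add_coset (multiples a) x \<in> add_coset (multiples a) ` X" using X(3) x by blast
    then obtain y where y: "y \<in> X" "add_coset (multiples a) x = add_coset (multiples a) y" by auto
    then have "x - y \<in> multiples a" by (simp add: add_coset_eq_iff add_subgroup_multiples)
    then have "b * (x - y) + y * b \<in> multiples a"
      by (rule ideal_a(6)[OF ideal_a(4)[OF b(1)] b(3)[OF y(1)]])
    then show ?thesis by (simp add: algebra_simps)
  qed
  define \<tau> where "\<tau> = b / a"
  have \<tau>_p: "\<tau> * x \<in> alg_ints" if "x \<in> p" for x
    using b_p[OF that] a by (auto simp: multiples_def \<tau>_def field_simps)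
  have \<tau>_notin: "\<tau> \<notin> alg_ints"
  proof
    assume "\<tau> \<in> alg_ints"
    then have "1 * b \<in> multiples a" using a by (auto simp: multiples_def \<tau>_def intro!: image_eqI[of _ _ \<tau>])
    then show False using b(2)[of 1] int_primeD(2)[OF p] alg_ints_closed(2) by blast
  qed
  have "\<exists>v\<in>p. \<tau> * v \<notin> p"
  proof (rule ccontr)
    assume "\<not> ?thesis"
    then have stable: "\<And>v. v \<in> p \<Longrightarrow> \<tau> * v \<in> p" by blast
    have pow: "a * \<tau> ^ n \<in> p" for n
    proof (induction n)
      case (Suc n)
      then show ?case using stable[of "a * \<tau> ^ n"] by (simp add: algebra_simps)
    qed (use a in simp)
    obtain i j where ij: "i < j" "a * \<tau> ^ i - a * \<tau> ^ j \<in> multiples a"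
      using pigeonhole_coset[OF add_subgroup_multiples fin_a, of "\<lambda>n. a * \<tau> ^ n"] pow ideal_p(3) by metis
    then obtain z where z: "z \<in> alg_ints" "a * (\<tau> ^ i - \<tau> ^ j) = a * z"
      by (auto simp: multiples_def right_diff_distrib)
    then have z': "algebraic_int (- z)" "\<tau> ^ j - \<tau> ^ i = - z"
      using a(2) by (auto simp: alg_ints_def)
    define P where "P = monom (1::'k) j + monom (- 1) i"
    have deg: "degree P = j"
      unfolding P_def using ij(1)
      by (subst degree_add_eq_left) (auto simp: degree_monom_eq)
    have "algebraic_int \<tau>"
    proof (rule algebraic_int_root[OF z'(1)])
      show "poly P \<tau> = - z" using z'(2) by (simp add: P_def poly_monom)
      show "\<forall>i. coeff P i \<in> \<int>" by (simp add: P_def)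
      show "lead_coeff P = 1" unfolding deg using ij(1) by (simp add: P_def)
      show "degree P > 0" using deg ij(1) by simp
    qed
    then show False using \<tau>_notin by (simp add: alg_ints_def)
  qed
  then obtain v where v: "v \<in> p" "\<tau> * v \<notin> p" by blast
  show thesis
  proof (rule that[of "\<tau> * v" v])
    show "\<tau> * v \<in> alg_ints" using \<tau>_p v(1) by blast
    show "v \<noteq> 0" using v ideal_p(2) by auto
    show "\<forall>x\<in>p. \<tau> * v * x \<in> multiples v"
    proof
      fix x assume "x \<in> p"
      then show "\<tau> * v * x \<in> multiples v"
        using \<tau>_p[of x] by (auto simp: multiples_def intro!: image_eqI[of _ _ "\<tau> * x"])
    qed
  qed (use v in auto)
qed

text \<open>A finite integral domain is a field: the powers of \<open>s\<close> repeat modulo \<open>p\<close>.\<close>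

lemma inverse_mod_prime:
  assumes p: "int_prime (p::'k set)" and s: "s \<in> alg_ints" "s \<notin> p"
  obtains t where "t \<in> alg_ints" "1 - s * t \<in> p"
proof -
  have "p \<noteq> {0}" using p by (simp add: int_prime_def)
  obtain i j where ij: "i < j" "s ^ i - s ^ j \<in> p"
    using pigeonhole_coset[OF int_idealD(1)[OF int_primeD(1)[OF p]]
        finite_index_ideal[OF int_primeD(1)[OF p] \<open>p \<noteq> {0}\<close>], of "\<lambda>n. s ^ n"]
      alg_ints_closed(8)[OF s(1)] by metis
  have "j = i + Suc (j - i - 1)" using ij(1) by simp
  then have eq: "s ^ j = s ^ i * (s * s ^ (j - i - 1))" by (metis power_add power_Suc)
  have "s ^ i * (1 - s * s ^ (j - i - 1)) \<in> p"
    using ij(2) unfolding eq by (simp add: algebra_simps)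
  moreover have "s ^ i \<in> alg_ints" "1 - s * s ^ (j - i - 1) \<in> alg_ints"
    using s by (auto intro!: alg_ints_closed)
  moreover have "s ^ i \<notin> p" using int_prime_power[OF p s(1)] s(2) by blast
  ultimately have "1 - s * s ^ (j - i - 1) \<in> p" using int_primeD(3)[OF p] by blast
  then show thesis using that alg_ints_closed(8)[OF s(1)] by blast
qed

text \<open>With \<open>t\<close> inverse to \<open>s\<close> modulo \<open>p\<close>, the identity \<open>x = x (1 - s t) + t (s x)\<close> lifts \<open>x\<close> from
  \<open>p ^ k\<close> to \<open>p ^ (k + 1)\<close> as long as \<open>k < m\<close>.\<close>

lemma prime_power_saturated:
  assumes p: "int_prime (p::'k set)" and s: "s \<in> alg_ints" "s \<notin> p"
    and x: "x \<in> alg_ints" "s * x \<in> prime_power p m"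
  shows "x \<in> prime_power p m"
proof -
  obtain t where t: "t \<in> alg_ints" "1 - s * t \<in> p" by (rule inverse_mod_prime[OF p s])
  note ideal = int_idealD[OF int_ideal_prime_power[OF int_primeD(1)[OF p]]]
  have "k \<le> m \<Longrightarrow> x \<in> prime_power p k" for k
  proof (induction k)
    case (Suc k)
    then have "x * (1 - s * t) \<in> prime_power p (Suc k)"
      using prime_power_mult t(2) by simp
    moreover have "s * x \<in> prime_power p (Suc k)"
      using x(2) prime_power_decreasing[OF int_primeD(1)[OF p] Suc.prems] by blast
    then have "t * (s * x) \<in> prime_power p (Suc k)" using ideal(4) t(1) by blast
    ultimately have "x * (1 - s * t) + t * (s * x) \<in> prime_power p (Suc k)" by (rule ideal(6))
    then show ?case by (simp add: algebra_simps)
  qed (simp add: prime_power_0 x)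
  then show ?thesis by simp
qed

text \<open>The powers of \<open>v\<close> repeat modulo \<open>x\<close>. If \<open>x\<close> were in every power of \<open>p\<close>, some \<open>v ^ i\<close> would
  lie in \<open>p ^ (i + 1)\<close>, which is impossible in the local ring.\<close>

lemma prime_power_bounded:
  assumes p: "int_prime (p::'k set)" and x: "x \<in> alg_ints" "x \<noteq> 0"
  shows "\<exists>m. x \<notin> prime_power p m"
proof (rule ccontr)
  assume "\<not> ?thesis"
  then have all: "x \<in> prime_power p m" for m by blast
  obtain s v where sv: "s \<in> alg_ints" "s \<notin> p" "v \<in> p" "v \<noteq> 0" "\<forall>x\<in>p. s * x \<in> multiples v"
    using local_uniformizer[OF p] by metis
  have v: "v \<in> alg_ints" using sv int_idealD(3)[OF int_primeD(1)[OF p]] by blast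
  note ideal = int_idealD[OF int_ideal_prime_power[OF int_primeD(1)[OF p]]]
  obtain i j where ij: "i < j" "v ^ i - v ^ j \<in> multiples x"
    using pigeonhole_coset[OF add_subgroup_multiples finite_index_principal[OF nf x], of "\<lambda>n. v ^ n"]
      alg_ints_closed(8)[OF v] by metis
  have "v ^ i - v ^ j \<in> prime_power p (Suc i)"
    using ij(2) all multiples_subset_ideal[OF int_ideal_prime_power[OF int_primeD(1)[OF p]]] by blast
  moreover have "v ^ j \<in> prime_power p (Suc i)"
    using power_in_prime_power[OF sv(3), of j] prime_power_decreasing[OF int_primeD(1)[OF p], of "Suc i" j] ij(1)
    by auto
  ultimately have "v ^ i - v ^ j + v ^ j \<in> prime_power p (Suc i)" by (rule ideal(6))
  then have "s ^ Suc i * v ^ i \<in> multiples (v ^ Suc i)"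
    using prime_power_local[OF sv(5), where m = "Suc i"] by simp
  then obtain y where y: "y \<in> alg_ints" "s ^ Suc i * v ^ i = v ^ Suc i * y" by (auto simp: multiples_def)
  then have "v ^ i * s ^ Suc i = v ^ i * (v * y)" by (simp add: algebra_simps)
  then have "s ^ Suc i = v * y" using sv(4) by simp
  then have "s ^ Suc i \<in> p" using int_idealD(5)[OF int_primeD(1)[OF p] y(1) sv(3)] by simp
  then show False using int_prime_power[OF p sv(1)] sv(2) by blast
qed

lemma prime_power_iff_integer_ord:
  assumes p: "int_prime (p::'k set)" and x: "x \<in> alg_ints" "x \<noteq> 0"
  shows "x \<in> prime_power p m \<longleftrightarrow> m \<le> integer_ord p x"
proof -
  define P where "P = (\<lambda>m. x \<in> prime_power p m)"
  obtain M where M: "\<not> P M" using prime_power_bounded[OF p x] by (auto simp: P_def)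
  have down: "P m" if "P n" "m \<le> n" for m n
    using that prime_power_decreasing[OF int_primeD(1)[OF p]] by (auto simp: P_def)
  have bound: "n \<le> M" if "P n" for n
    using down[OF that, of M] M by (cases "n \<le> M") auto
  have ord: "integer_ord p x = (GREATEST m. P m)"
    by (simp add: integer_ord_def P_def prime_power_def)
  have "P 0" using x by (simp add: P_def prime_power_0)
  then have "P (integer_ord p x)" unfolding ord using bound by (rule GreatestI_nat)
  moreover have "n \<le> integer_ord p x" if "P n" for n
    unfolding ord using that bound by (rule Greatest_le_nat)
  ultimately have "P m \<longleftrightarrow> m \<le> integer_ord p x" using down[of "integer_ord p x" m] by blast
  then show ?thesis by (simp only: P_def)
qed

definition uniformizer :: "'k set \<Rightarrow> 'k" where
  "uniformizer p = (SOME v. v \<in> p \<and> v \<noteq> 0 \<and>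
    (\<exists>s\<in>alg_ints - p. \<forall>x\<in>p. s * x \<in> multiples v))"

lemma uniformizer:
  assumes p: "int_prime (p::'k set)"
  shows "uniformizer p \<in> p" "uniformizer p \<noteq> 0" "uniformizer p \<in> alg_ints"
    "\<exists>s\<in>alg_ints - p. \<forall>x\<in>p. s * x \<in> multiples (uniformizer p)"
proof -
  obtain s v where "s \<in> alg_ints" "s \<notin> p" "v \<in> p" "v \<noteq> 0" "\<forall>x\<in>p. s * x \<in> multiples v"
    by (rule local_uniformizer[OF p])
  then have "\<exists>v. v \<in> p \<and> v \<noteq> 0 \<and> (\<exists>s\<in>alg_ints - p. \<forall>x\<in>p. s * x \<in> multiples v)"
    by (intro exI[of _ v] conjI bexI[of _ s]) simp_all
  from someI_ex[OF this, folded uniformizer_def] show "uniformizer p \<in> p" "uniformizer p \<noteq> 0"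
    "\<exists>s\<in>alg_ints - p. \<forall>x\<in>p. s * x \<in> multiples (uniformizer p)"
    by simp_all
  then show "uniformizer p \<in> alg_ints" using int_idealD(3)[OF int_primeD(1)[OF p]] by blast
qed

text \<open>In the local ring every nonzero \<open>x\<close> is a power of the uniformizer times a unit. Here the
  denominators are cleared: \<open>s\<close> and \<open>y\<close> are units of the local ring. The next lemma says that
  the exponent is determined by such an equation, which makes the order additive.\<close>

lemma integer_ord_witness:
  assumes p: "int_prime (p::'k set)" and x: "x \<in> alg_ints" "x \<noteq> 0"
  obtains s y where "s \<in> alg_ints - p" "y \<in> alg_ints - p" "s * x = uniformizer p ^ integer_ord p x * y"
proof -
  note ideal_p = int_idealD[OF int_primeD(1)[OF p]]
  define v where "v = uniformizer p"
  define m where "m = integer_ord p x"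
  obtain s where s: "s \<in> alg_ints" "s \<notin> p" "\<forall>x\<in>p. s * x \<in> multiples v"
    using uniformizer(4)[OF p] by (auto simp: v_def)
  have "x \<in> prime_power p m" using prime_power_iff_integer_ord[OF p x] by (simp add: m_def)
  then have "s ^ m * x \<in> multiples (v ^ m)" by (rule prime_power_local[OF s(3)])
  then obtain y where y: "y \<in> alg_ints" "s ^ m * x = v ^ m * y" by (auto simp: multiples_def)
  have "y \<notin> p"
  proof
    assume "y \<in> p"
    then obtain z where z: "z \<in> alg_ints" "s * y = v * z" using s(3) by (auto simp: multiples_def)
    have "s ^ Suc m * x = s * (s ^ m * x)" by (simp add: algebra_simps)
    also have "\<dots> = v ^ m * (s * y)" unfolding y(2) by (simp add: algebra_simps)
    also have "\<dots> = v ^ Suc m * z" unfolding z(2) by (simp add: algebra_simps)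
    also have "\<dots> \<in> prime_power p (Suc m)"
      unfolding v_def
      by (intro int_idealD(5)[OF int_ideal_prime_power[OF int_primeD(1)[OF p]] z(1)]
          power_in_prime_power uniformizer(1)[OF p])
    finally have "x \<in> prime_power p (Suc m)"
      using prime_power_saturated[OF p, of "s ^ Suc m" x "Suc m"] s x int_prime_power[OF p s(1)]
        alg_ints_closed(8)[OF s(1)] by blast
    then show False using prime_power_iff_integer_ord[OF p x, of "Suc m"] by (simp add: m_def)
  qed
  moreover have "s ^ m \<notin> p" using int_prime_power[OF p s(1)] s(2) by blast
  ultimately show thesis
    using that[of "s ^ m" y] y alg_ints_closed(8)[OF s(1), of m] unfolding m_def v_def by blast
qed

lemma integer_ord_eqI:
  assumes p: "int_prime (p::'k set)" and x: "x \<in> alg_ints" "x \<noteq> 0"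
    and s: "s \<in> alg_ints - p" and y: "y \<in> alg_ints - p" and eq: "s * x = uniformizer p ^ m * y"
  shows "integer_ord p x = m"
proof -
  note ideal = int_idealD[OF int_ideal_prime_power[OF int_primeD(1)[OF p]]]
  define v where "v = uniformizer p"
  have v: "v \<in> p" "v \<noteq> 0" "v \<in> alg_ints" using uniformizer[OF p] by (simp_all add: v_def)
  have "s * x \<in> prime_power p m"
    unfolding eq using ideal(5) power_in_prime_power[OF v(1)] y by (auto simp: v_def)
  then have le: "m \<le> integer_ord p x"
    using prime_power_saturated[OF p, of s x m] s x prime_power_iff_integer_ord[OF p x] by auto
  obtain t z where t: "t \<in> alg_ints - p" "z \<in> alg_ints - p" "t * x = v ^ integer_ord p x * z"
    using integer_ord_witness[OF p x] v_def by metis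
  have "\<not> m < integer_ord p x"
  proof
    assume "m < integer_ord p x"
    then obtain k where k: "integer_ord p x = m + Suc k" by (metis less_imp_Suc_add add_Suc_right)
    have "v ^ m * (t * y) = t * (s * x)" by (simp add: eq v_def algebra_simps)
    also have "\<dots> = s * (t * x)" by (simp add: algebra_simps)
    also have "\<dots> = v ^ m * (v * (v ^ k * (s * z)))" by (simp add: t k power_add algebra_simps)
    finally have "t * y = v * (v ^ k * (s * z))" using v by simp
    moreover have "v ^ k * (s * z) \<in> alg_ints" using v s t by (intro alg_ints_closed) auto
    ultimately have "t * y \<in> p"
      using int_idealD(5)[OF int_primeD(1)[OF p] _ v(1)] by simp
    then show False using int_primeD(3)[OF p, of t y] t y by auto
  qed
  with le show ?thesis by simp
qed

lemma int_prime_diff_mult: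
  "int_prime p \<Longrightarrow> s \<in> alg_ints - p \<Longrightarrow> t \<in> alg_ints - p \<Longrightarrow> s * t \<in> alg_ints - p"
  using int_primeD(3)[of p s t] alg_ints_closed(7)[of s t] by auto

lemma integer_ord_mult:
  assumes p: "int_prime (p::'k set)" and x: "x \<in> alg_ints" "x \<noteq> 0" and y: "y \<in> alg_ints" "y \<noteq> 0"
  shows "integer_ord p (x * y) = integer_ord p x + integer_ord p y"
proof -
  obtain s u where su: "s \<in> alg_ints - p" "u \<in> alg_ints - p" "s * x = uniformizer p ^ integer_ord p x * u"
    using integer_ord_witness[OF p x] by metis
  obtain t w where tw: "t \<in> alg_ints - p" "w \<in> alg_ints - p" "t * y = uniformizer p ^ integer_ord p y * w"
    using integer_ord_witness[OF p y] by metis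
  have "(s * t) * (x * y) = (s * x) * (t * y)" by (simp add: algebra_simps)
  also have "\<dots> = uniformizer p ^ (integer_ord p x + integer_ord p y) * (u * w)"
    by (simp add: su tw power_add algebra_simps)
  finally have eq: "(s * t) * (x * y) =
      uniformizer p ^ (integer_ord p x + integer_ord p y) * (u * w)" .
  show ?thesis
    by (rule integer_ord_eqI[OF p _ _ int_prime_diff_mult[OF p su(1) tw(1)]
          int_prime_diff_mult[OF p su(2) tw(2)] eq]) (use x y in \<open>auto simp: alg_ints_closed\<close>)
qed

lemma integer_ord_unit:
  assumes p: "int_prime (p::'k set)" and x: "x \<in> alg_ints - p"
  shows "integer_ord p x = 0"
proof -
  have "1 \<in> alg_ints - p" using int_primeD(2)[OF p] alg_ints_closed(2) by simp
  then show ?thesis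
    using x int_idealD(2)[OF int_primeD(1)[OF p]] by (intro integer_ord_eqI[OF p, of x 1 x]) auto
qed

lemma integer_ord_uniformizer:
  assumes p: "int_prime (p::'k set)"
  shows "integer_ord p (uniformizer p) = 1"
proof -
  have "1 \<in> alg_ints - p" using int_primeD(2)[OF p] alg_ints_closed(2) by simp
  then show ?thesis
    using uniformizer[OF p] by (intro integer_ord_eqI[OF p, of _ 1 1]) auto
qed

lemma integer_ord_add:
  assumes p: "int_prime (p::'k set)" and x: "x \<in> alg_ints" "x \<noteq> 0" and y: "y \<in> alg_ints" "y \<noteq> 0"
    and xy: "x + y \<noteq> 0"
  shows "min (integer_ord p x) (integer_ord p y) \<le> integer_ord p (x + y)"
proof -
  define m where "m = min (integer_ord p x) (integer_ord p y)"
  have "x \<in> prime_power p m" "y \<in> prime_power p m"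
    using prime_power_iff_integer_ord[OF p] x y by (auto simp: m_def)
  then have "x + y \<in> prime_power p m"
    by (rule int_idealD(6)[OF int_ideal_prime_power[OF int_primeD(1)[OF p]]])
  then show ?thesis
    using prime_power_iff_integer_ord[OF p alg_ints_closed(5)[OF x(1) y(1)] xy] by (simp add: m_def)
qed

end


section \<open>Factorisation of the index\<close>

text \<open>The exponent of \<open>p\<close> in the factorisation of the ideal \<open>I\<close>.\<close>

definition ideal_ord :: "'k::field_char_0 set \<Rightarrow> 'k set \<Rightarrow> nat" where
  "ideal_ord p I = (LEAST m. \<exists>x\<in>I. x \<noteq> 0 \<and> integer_ord p x = m)"

lemma ideal_ord_le: "x \<in> I \<Longrightarrow> x \<noteq> 0 \<Longrightarrow> ideal_ord p I \<le> integer_ord p x"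
  unfolding ideal_ord_def by (rule Least_le) blast

lemma ideal_ord_attained:
  assumes "x \<in> I" "x \<noteq> 0"
  obtains y where "y \<in> I" "y \<noteq> 0" "integer_ord p y = ideal_ord p I"
proof -
  have "\<exists>m. \<exists>x\<in>I. x \<noteq> 0 \<and> integer_ord p x = m" using assms by blast
  from LeastI_ex[OF this] show thesis using that by (auto simp: ideal_ord_def)
qed

context
  assumes nf: "number_field TYPE('k::field_char_0)"
begin

lemma ideal_ord_multiples:
  assumes p: "int_prime (p::'k set)" and a: "a \<in> alg_ints" "a \<noteq> 0"
  shows "ideal_ord p (multiples a) = integer_ord p a"
proof (rule antisym)
  have a_in: "a \<in> multiples a" using alg_ints_closed(2) by (force simp: multiples_def)
  then show "ideal_ord p (multiples a) \<le> integer_ord p a" using a(2) by (rule ideal_ord_le)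
  obtain y where y: "y \<in> multiples a" "y \<noteq> 0" "integer_ord p y = ideal_ord p (multiples a)"
    by (rule ideal_ord_attained[OF a_in a(2)])
  then obtain z where "z \<in> alg_ints" "y = a * z" by (auto simp: multiples_def)
  then show "integer_ord p a \<le> ideal_ord p (multiples a)"
    using integer_ord_mult[OF nf p a, of z] y by auto
qed

lemma ideal_ord_alg_ints:
  assumes p: "int_prime (p::'k set)"
  shows "ideal_ord p alg_ints = 0"
proof -
  have "1 \<in> alg_ints - p" using int_primeD(2)[OF p] alg_ints_closed(2) by simp
  then show ?thesis
    using ideal_ord_le[of 1 alg_ints p] integer_ord_unit[OF nf p, of 1] by simp
qed

lemma int_prime_maximal:
  assumes p: "int_prime (p::'k set)" and q: "int_prime q" and sub: "p \<subseteq> q"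
  shows "p = q"
proof (rule ccontr)
  assume "p \<noteq> q"
  then obtain x where x: "x \<in> q" "x \<notin> p" using sub by blast
  have "x \<in> alg_ints" using x int_idealD(3)[OF int_primeD(1)[OF q]] by blast
  then obtain t where t: "t \<in> alg_ints" "1 - x * t \<in> p" using inverse_mod_prime[OF nf p _ x(2)] by blast
  note ideal_q = int_idealD[OF int_primeD(1)[OF q]]
  have "1 - x * t + x * t \<in> q" using t sub x ideal_q(5,6) by blast
  then show False using int_primeD(2)[OF q] by simp
qed

lemma finite_index_subset: "finite_index A C \<Longrightarrow> B \<subseteq> A \<Longrightarrow> finite_index B C"
  by (auto simp: finite_index_def intro: finite_subset)

lemma index_pos: "finite_index A B \<Longrightarrow> x \<in> A \<Longrightarrow> index A B > 0"
  by (auto simp: finite_index_def index_def card_gt_0_iff)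

lemma index_ideals_mult:
  assumes "int_ideal (I::'k set)" "I \<noteq> {0}" "int_ideal J" "I \<subseteq> J"
  shows "index alg_ints I = index alg_ints J * index J I" "finite_index J I"
proof -
  have J: "J \<subseteq> alg_ints" using int_idealD(3)[OF assms(3)] by blast
  have "J \<noteq> {0}" using assms int_idealD(2)[OF assms(1)] by blast
  show fin: "finite_index J I"
    using finite_index_subset[OF finite_index_ideal[OF nf assms(1,2)] J] .
  show "index alg_ints I = index alg_ints J * index J I"
    by (rule index_mult(2)[OF add_subgroup_alg_ints int_idealD(1)[OF assms(3)] int_idealD(1)[OF assms(1)]
          assms(4) J finite_index_ideal[OF nf assms(3) \<open>J \<noteq> {0}\<close>] fin])
qed

lemma index_strict_mono:
  assumes "int_ideal (I::'k set)" "I \<noteq> {0}" "int_ideal J" "I \<subset> J"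
  shows "index alg_ints J < index alg_ints I"
proof -
  obtain x where x: "x \<in> J" "x \<notin> I" using assms(4) by blast
  have "I \<subseteq> J" "J \<noteq> {0}" using assms(4) int_idealD(2)[OF assms(1)] by blast+
  note idx = index_ideals_mult[OF assms(1-3) \<open>I \<subseteq> J\<close>]
  have "add_coset I x \<noteq> add_coset I 0"
    using x add_coset_eq_iff[OF int_idealD(1)[OF assms(1)]] by simp
  then have "2 \<le> card {add_coset I x, add_coset I 0}" by simp
  also have "\<dots> \<le> index J I"
    unfolding index_def using idx(2) x int_idealD(2)[OF assms(3)]
    by (intro card_mono) (auto simp: finite_index_def)
  finally have "2 \<le> index J I" .
  moreover have "index alg_ints J > 0"
    using index_pos[OF finite_index_ideal[OF nf assms(3) \<open>J \<noteq> {0}\<close>] alg_ints_closed(1)] .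
  ultimately show ?thesis using idx(1) by simp
qed

lemma index_alg_ints: "index (alg_ints::'k set) alg_ints = 1"
  using index_principal_power[OF nf alg_ints_closed(2), of 0] by (simp add: multiples_def)

lemma index_prime_ge_2:
  assumes p: "int_prime (p::'k set)"
  shows "index alg_ints p \<ge> 2"
proof -
  have "p \<subset> alg_ints"
    using int_idealD(3)[OF int_primeD(1)[OF p]] int_primeD(2)[OF p] alg_ints_closed(2) by blast
  moreover have "p \<noteq> {0}" using p by (simp add: int_prime_def)
  ultimately show ?thesis
    using index_strict_mono[OF int_primeD(1)[OF p] _ int_ideal_alg_ints] index_alg_ints by fastforce
qed

text \<open>Among the ideals \<open>(I : z)\<close> with \<open>z \<notin> I\<close> one of least index is maximal and hence prime. If
  \<open>p = (I : y)\<close> is such a prime, \<open>x \<mapsto> x y\<close> identifies \<open>O / p\<close> with \<open>J / I\<close> for \<open>J = I + y O\<close>.\<close>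

lemma ideal_prime_quotient:
  assumes I: "int_ideal (I::'k set)" "I \<noteq> {0}" "I \<noteq> alg_ints"
  obtains p y J where "int_prime p" "p = {x \<in> alg_ints. x * y \<in> I}" "y \<in> alg_ints" "y \<notin> I"
    "int_ideal J" "I \<subseteq> J" "y \<in> J" "\<forall>z\<in>J. \<exists>x\<in>alg_ints. z - x * y \<in> I" "index J I = index alg_ints p"
proof -
  note ideal_I = int_idealD[OF I(1)]
  define colon where "colon = (\<lambda>z. {x \<in> alg_ints. x * z \<in> I})"
  have ideal_colon: "int_ideal (colon z)" for z
    using ideal_I
    by (auto simp: int_ideal_def add_subgroup_def colon_def alg_ints_closed left_diff_distrib mult.assoc)
  have I_colon: "I \<subseteq> colon z" if "z \<in> alg_ints" for z
    using that ideal_I by (auto simp: colon_def)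
  then have colon_nz: "colon z \<noteq> {0}" if "z \<in> alg_ints" for z
    using that I(2) ideal_I(2) by blast
  obtain z0 where "z0 \<in> alg_ints" "z0 \<notin> I" using I(3) ideal_I(3) by blast
  then obtain y where y: "y \<in> alg_ints" "y \<notin> I"
    and least: "\<And>z. z \<in> alg_ints \<Longrightarrow> z \<notin> I \<Longrightarrow> index alg_ints (colon y) \<le> index alg_ints (colon z)"
    using ex_has_least_nat[of "\<lambda>z. z \<in> alg_ints \<and> z \<notin> I" z0 "\<lambda>z. index alg_ints (colon z)"] by blast
  define p where "p = colon y"
  have "int_prime p"
    unfolding int_prime_def
  proof (intro conjI ballI impI)
    show "int_ideal p" by (simp add: p_def ideal_colon)
    show "1 \<notin> p" using y by (simp add: p_def colon_def)
    show "p \<noteq> {0}" using colon_nz y by (simp add: p_def)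
    fix a b assume ab: "a \<in> alg_ints" "b \<in> alg_ints" "a * b \<in> p"
    show "a \<in> p \<or> b \<in> p"
    proof (rule disjCI)
      assume "b \<notin> p"
      then have by_notin: "b * y \<notin> I" using ab by (simp add: p_def colon_def)
      have by_int: "b * y \<in> alg_ints" using ab y alg_ints_closed(7) by blast
      have "colon y \<subseteq> colon (b * y)"
      proof
        fix x assume "x \<in> colon y"
        then have "x \<in> alg_ints" "b * (x * y) \<in> I" using ideal_I(4)[OF ab(2)] by (auto simp: colon_def)
        then show "x \<in> colon (b * y)" by (simp add: colon_def algebra_simps)
      qed
      then have "colon y = colon (b * y)"
        using index_strict_mono[OF ideal_colon colon_nz[OF y(1)] ideal_colon, of "b * y"]
          least[OF by_int by_notin] by fastforce
      moreover have "a \<in> colon (b * y)" using ab by (simp add: p_def colon_def mult.assoc)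
      ultimately show "a \<in> p" by (simp add: p_def)
    qed
  qed
  define J where "J = {z. \<exists>x\<in>alg_ints. z - x * y \<in> I}"
  have J_mem: "z \<in> J \<longleftrightarrow> (\<exists>x\<in>alg_ints. z - x * y \<in> I)" for z by (simp add: J_def)
  have "int_ideal J"
    unfolding int_ideal_def add_subgroup_def
  proof (intro conjI ballI subsetI)
    show "0 \<in> J" unfolding J_mem using ideal_I(2) alg_ints_closed(1) by (intro bexI[of _ 0]) auto
  next
    fix u v assume "u \<in> J" "v \<in> J"
    then obtain a b where ab: "a \<in> alg_ints" "b \<in> alg_ints" "u - a * y \<in> I" "v - b * y \<in> I"
      by (auto simp: J_mem)
    have "(u - a * y) - (v - b * y) \<in> I" by (rule ideal_I(7)[OF ab(3,4)])
    then show "u - v \<in> J"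
      unfolding J_mem using ab alg_ints_closed(6)
      by (intro bexI[of _ "a - b"]) (auto simp: algebra_simps)
  next
    fix u assume "u \<in> J"
    then obtain a where a: "a \<in> alg_ints" "u - a * y \<in> I" by (auto simp: J_mem)
    show "u \<in> alg_ints"
      using alg_ints_closed(5)[OF ideal_I(3)[OF a(2)] alg_ints_closed(7)[OF a(1) y(1)]] by simp
  next
    fix x u :: 'k assume x: "x \<in> alg_ints" and "u \<in> J"
    then obtain a where a: "a \<in> alg_ints" "u - a * y \<in> I" by (auto simp: J_mem)
    have "x * (u - a * y) \<in> I" by (rule ideal_I(4)[OF x a(2)])
    then show "x * u \<in> J"
      unfolding J_mem using a x alg_ints_closed(7)
      by (intro bexI[of _ "x * a"]) (auto simp: algebra_simps)
  qed
  moreover have "I \<subseteq> J" unfolding J_def using alg_ints_closed(1) by (auto intro!: bexI[of _ 0])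
  moreover have "y \<in> J" unfolding J_mem using alg_ints_closed(2) ideal_I(2) by (intro bexI[of _ 1]) auto
  moreover have "index J I = index alg_ints p"
  proof -
    define f where "f = (\<lambda>x. add_coset I (x * y))"
    have f_eq: "f x = f x' \<longleftrightarrow> add_coset p x = add_coset p x'" if "x \<in> alg_ints" "x' \<in> alg_ints" for x x'
      using that add_coset_eq_iff[OF ideal_I(1)] add_coset_eq_iff[OF int_idealD(1)[OF ideal_colon]]
      by (simp add: f_def p_def colon_def left_diff_distrib alg_ints_closed)
    have "add_coset I ` J = f ` alg_ints"
    proof safe
      fix z assume "z \<in> J"
      then obtain x where "x \<in> alg_ints" "z - x * y \<in> I" by (auto simp: J_mem)
      then show "add_coset I z \<in> f ` alg_ints"
        using add_coset_eq_iff[OF ideal_I(1), of z "x * y"] by (auto simp: f_def)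
    next
      fix x :: 'k assume "x \<in> alg_ints"
      then have "x * y \<in> J" unfolding J_mem using ideal_I(2) by (intro bexI[of _ x]) auto
      then show "f x \<in> add_coset I ` J" by (auto simp: f_def)
    qed
    moreover have "card (f ` alg_ints) = card (add_coset p ` alg_ints)"
    proof (rule antisym)
      have fin: "finite (add_coset p ` alg_ints)"
        using finite_index_ideal[OF nf ideal_colon colon_nz[OF y(1)]] by (simp add: finite_index_def p_def)
      show "card (f ` alg_ints) \<le> card (add_coset p ` alg_ints)"
        by (rule image_factor(2)[OF fin]) (simp add: f_eq)
      have "finite (f ` alg_ints)"
        by (rule image_factor(1)[OF fin]) (simp add: f_eq)
      then show "card (add_coset p ` alg_ints) \<le> card (f ` alg_ints)"
        by (rule image_factor(2)) (simp add: f_eq)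
    qed
    ultimately show ?thesis by (simp add: index_def)
  qed
  ultimately show thesis
    using that[of p y J] \<open>int_prime p\<close> y by (simp add: p_def colon_def J_mem)
qed

text \<open>Since \<open>p J \<subseteq> I \<subseteq> J\<close>, the orders can only differ at \<open>p\<close>, where the uniformizer shows that they
  differ by at most one.\<close>

lemma ideal_ord_quotient:
  assumes I: "int_ideal (I::'k set)" "I \<noteq> {0}"
    and p: "int_prime p" "p = {x \<in> alg_ints. x * y \<in> I}" and y: "y \<in> alg_ints" "y \<notin> I"
    and J: "int_ideal J" "I \<subseteq> J" "y \<in> J" "\<forall>z\<in>J. \<exists>x\<in>alg_ints. z - x * y \<in> I"
    and q: "int_prime q"
  shows "ideal_ord q I = ideal_ord q J + (if q = p then 1 else 0)"
proof -
  note ideal_I = int_idealD[OF I(1)]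
  obtain a where a: "a \<in> I" "a \<noteq> 0" using I by (auto elim: int_ideal_nonzero_element)
  obtain w where w: "w \<in> I" "w \<noteq> 0" "integer_ord q w = ideal_ord q I" by (rule ideal_ord_attained[OF a])
  obtain z where z: "z \<in> J" "z \<noteq> 0" "integer_ord q z = ideal_ord q J"
    using ideal_ord_attained[of a J q] a J(2) by blast
  have int: "w \<in> alg_ints" "z \<in> alg_ints" using w z ideal_I(3) int_idealD(3)[OF J(1)] by blast+
  have ge: "ideal_ord q J \<le> ideal_ord q I" using ideal_ord_le[of w J q] w J(2) by auto
  have pJ: "s * u \<in> I" if s: "s \<in> p" and u: "u \<in> J" for s u
  proof -
    obtain x where x: "x \<in> alg_ints" "u - x * y \<in> I" using J(4) u by blast
    have s': "s \<in> alg_ints" "s * y \<in> I" using s p(2) by auto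
    have "s * (u - x * y) + x * (s * y) \<in> I" by (rule ideal_I(6)[OF ideal_I(4)[OF s'(1) x(2)] ideal_I(4)[OF x(1) s'(2)]])
    then show ?thesis by (simp add: algebra_simps)
  qed
  show ?thesis
  proof (cases "q = p")
    case False
    then obtain s where s: "s \<in> p" "s \<notin> q" using int_prime_maximal[OF p(1) q] by blast
    then have s': "s \<in> alg_ints" "s \<noteq> 0" using p(2) int_idealD(2)[OF int_primeD(1)[OF q]] by auto
    have "ideal_ord q I \<le> integer_ord q (s * z)"
      using pJ[OF s(1) z(1)] s' z by (intro ideal_ord_le) auto
    also have "\<dots> = ideal_ord q J"
      using integer_ord_mult[OF nf q s' int(2) z(2)] integer_ord_unit[OF nf q, of s] s s' z by simp
    finally show ?thesis using ge False by simp
  next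
    case True
    define v where "v = uniformizer p"
    note v = uniformizer[OF nf p(1), folded v_def]
    have "ideal_ord q I \<le> integer_ord q (v * z)"
      using pJ[OF v(1) z(1)] v(2) z by (intro ideal_ord_le) auto
    also have "\<dots> = ideal_ord q J + 1"
      using integer_ord_mult[OF nf q v(3,2) int(2) z(2)] integer_ord_uniformizer[OF nf p(1)] True z
      by (simp add: v_def)
    finally have le: "ideal_ord q I \<le> ideal_ord q J + 1" .
    (* If the orders agreed, w would divide y locally at p, putting a multiple of y by an
       element outside p into I, although p = (I : y). *)
    have "ideal_ord q I \<noteq> ideal_ord q J"
    proof
      assume eq: "ideal_ord q I = ideal_ord q J"
      define j where "j = ideal_ord q J"
      have y0: "y \<noteq> 0" using y ideal_I(2) by auto
      obtain s e where s: "s \<in> alg_ints - p" "e \<in> alg_ints - p" "s * w = v ^ j * e"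
        using integer_ord_witness[OF nf p(1) int(1) w(2)] w(3) eq True unfolding j_def v_def by metis
      obtain t f where t: "t \<in> alg_ints - p" "f \<in> alg_ints - p" "t * y = v ^ integer_ord p y * f"
        using integer_ord_witness[OF nf p(1) y(1) y0] unfolding v_def by metis
      have "j \<le> integer_ord p y" using ideal_ord_le[OF J(3) y0, of q] True by (simp add: j_def)
      then obtain k where k: "integer_ord p y = j + k" using le_Suc_ex by blast
      have "(e * t) * y = e * (t * y)" by (simp add: mult.assoc)
      also have "\<dots> = (v ^ j * e) * (v ^ k * f)" by (simp add: t(3) k power_add algebra_simps)
      also have "\<dots> = (s * v ^ k * f) * w" unfolding s(3)[symmetric] by (simp add: algebra_simps)
      also have "\<dots> \<in> I"
        using s t v(3) by (intro ideal_I(4)[OF _ w(1)] alg_ints_closed) auto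
      finally have "e * t \<in> p" using s t p(2) alg_ints_closed(7) by auto
      then show False using int_primeD(3)[OF p(1), of e t] s t by auto
    qed
    with ge le show ?thesis using True by simp
  qed
qed

text \<open>Each step from \<open>I\<close> to the larger ideal \<open>J\<close> above removes one factor \<open>N(p)\<close> from the index and
  lowers the order at \<open>p\<close> alone by one.\<close>

lemma index_factorisation:
  assumes "int_ideal (I::'k set)" "I \<noteq> {0}"
  shows "finite {q. int_prime q \<and> ideal_ord q I \<noteq> 0} \<and>
    index alg_ints I = (\<Prod>q | int_prime q \<and> ideal_ord q I \<noteq> 0. index alg_ints q ^ ideal_ord q I)"
  using assms
proof (induction "index alg_ints I" arbitrary: I rule: less_induct)
  case (less I)
  show ?case
  proof (cases "I = alg_ints")
    case True
    have empty: "{q. int_prime q \<and> ideal_ord q I \<noteq> 0} = {}"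
      using ideal_ord_alg_ints True by auto
    show ?thesis unfolding empty using True index_alg_ints by simp
  next
    case False
    obtain p y J where p: "int_prime p" "p = {x \<in> alg_ints. x * y \<in> I}" "y \<in> alg_ints" "y \<notin> I"
      and J: "int_ideal J" "I \<subseteq> J" "y \<in> J" "\<forall>z\<in>J. \<exists>x\<in>alg_ints. z - x * y \<in> I"
        "index J I = index alg_ints p"
      by (rule ideal_prime_quotient[OF less.prems False])
    have "J \<noteq> {0}" using J(2) less.prems int_idealD(2)[OF less.prems(1)] by blast
    have "index alg_ints J < index alg_ints I"
      using index_strict_mono[OF less.prems J(1)] J(2,3) p(4) by blast
    note IH = less.hyps[OF this J(1) \<open>J \<noteq> {0}\<close>]
    note ord = ideal_ord_quotient[OF less.prems p J(1-4)]
    define S where "S = (\<lambda>I::'k set. {q. int_prime q \<and> ideal_ord q I \<noteq> 0})"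
    have "q \<in> S I \<longleftrightarrow> q \<in> insert p (S J)" for q
      using ord[of q] p(1) by (cases "q = p") (auto simp: S_def)
    then have S: "S I = insert p (S J)" by blast
    have fin: "finite (S J)" using IH by (simp add: S_def)
    have "index alg_ints I = index alg_ints J * index alg_ints p"
      using index_ideals_mult(1)[OF less.prems J(1,2)] J(5) by simp
    also have "index alg_ints J = (\<Prod>q\<in>S J. index alg_ints q ^ ideal_ord q J)"
      using IH by (simp add: S_def)
    also have "\<dots> = (\<Prod>q\<in>S I. index alg_ints q ^ ideal_ord q J)"
      unfolding S using fin p(1) by (intro prod.mono_neutral_left) (auto simp: S_def)
    also have "index alg_ints p = (\<Prod>q\<in>S I. if q = p then index alg_ints q else 1)"
      using fin by (simp add: S prod.delta')
    also have "(\<Prod>q\<in>S I. index alg_ints q ^ ideal_ord q J) * \<dots> =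
        (\<Prod>q\<in>S I. index alg_ints q ^ ideal_ord q J * (if q = p then index alg_ints q else 1))"
      by (simp add: prod.distrib)
    also have "\<dots> = (\<Prod>q\<in>S I. index alg_ints q ^ ideal_ord q I)"
      by (intro prod.cong) (auto simp: S_def ord)
    finally show ?thesis using fin S by (simp add: S_def)
  qed
qed

lemma norm_factorisation:
  assumes a: "a \<in> alg_ints" "(a::'k) \<noteq> 0"
  shows "finite {q. int_prime q \<and> integer_ord q a \<noteq> 0}"
    "emb_norm a = (\<Prod>q | int_prime q \<and> integer_ord q a \<noteq> 0. real (index alg_ints q) ^ integer_ord q a)"
proof -
  have "a \<in> multiples a" using alg_ints_closed(2) by (force simp: multiples_def)
  then have "multiples a \<noteq> {0}" using a(2) by auto
  note factor = index_factorisation[OF int_ideal_multiples[OF a(1)] this]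
  have S: "{q. int_prime q \<and> ideal_ord q (multiples a) \<noteq> 0} = {q. int_prime q \<and> integer_ord q a \<noteq> 0}"
    using ideal_ord_multiples[OF _ a] by auto
  show "finite {q. int_prime q \<and> integer_ord q a \<noteq> 0}" using factor unfolding S by blast
  have "emb_norm a = real (index alg_ints (multiples a))"
    by (rule index_principal[OF nf a, symmetric])
  also have "\<dots> = (\<Prod>q | int_prime q \<and> integer_ord q a \<noteq> 0. real (index alg_ints q) ^ integer_ord q a)"
    using factor unfolding S by (auto intro!: prod.cong simp: ideal_ord_multiples[OF _ a])
  finally show "emb_norm a = (\<Prod>q | int_prime q \<and> integer_ord q a \<noteq> 0. real (index alg_ints q) ^ integer_ord q a)" .
qed

end


section \<open>Absolute values and the product formula\<close>

text \<open>At an infinite place the normalised absolute value is the power with exponent \<open>place_deg\<close> of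
  the usual one, pulled back along \<open>place_emb\<close>. The value 0 of \<open>place_deg\<close> at the finite places
  makes factors of the form \<open>\<epsilon> ^ place_deg v\<close> trivial there.\<close>

fun place_emb :: "'k::field_char_0 place \<Rightarrow> 'k \<Rightarrow> complex" where
  "place_emb (Real_Place \<sigma>) = complex_of_real \<circ> \<sigma>"
| "place_emb (Complex_Place T) = (SOME \<tau>. \<tau> \<in> T)"
| "place_emb (Finite_Place p) = undefined"

fun place_deg :: "'k place \<Rightarrow> nat" where
  "place_deg (Real_Place \<sigma>) = 1"
| "place_deg (Complex_Place T) = 2"
| "place_deg (Finite_Place p) = 0"

definition inf_places :: "'k::field_char_0 place set" where
  "inf_places = {Real_Place \<sigma> |\<sigma>. embedding \<sigma>}
    \<union> {Complex_Place {\<tau>, cnj \<circ> \<tau>} |\<tau>. embedding \<tau> \<and> \<not> range \<tau> \<subseteq> \<real>}"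

definition fin_places :: "'k::field_char_0 place set" where
  "fin_places = Finite_Place ` {p. int_prime p}"

lemma places_eq: "places = inf_places \<union> fin_places"
  by (auto simp: places_def inf_places_def fin_places_def simp flip: primeideal_integer_ring_iff)

lemma embedding_of_real: "embedding \<sigma> \<Longrightarrow> embedding (complex_of_real \<circ> \<sigma>)"
  by (auto simp: embedding_def)

lemma embedding_cnj: "embedding \<tau> \<Longrightarrow> embedding (cnj \<circ> \<tau>)"
  by (auto simp: embedding_def)

lemma place_emb_Complex:
  obtains "place_emb (Complex_Place {\<tau>, cnj \<circ> \<tau>}) = \<tau>" |
    "place_emb (Complex_Place {\<tau>, cnj \<circ> \<tau>}) = cnj \<circ> \<tau>"
  using someI_ex[of "\<lambda>\<tau>'. \<tau>' \<in> {\<tau>, cnj \<circ> \<tau>}"] by auto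

lemma inf_place_cases:
  assumes "v \<in> inf_places"
  shows "embedding (place_emb v)" "place_abs v x = cmod (place_emb v x) ^ place_deg v"
    "place_deg v = 1 \<and> range (place_emb v) \<subseteq> \<real> \<or> place_deg v = 2"
proof -
  consider \<sigma> where "v = Real_Place \<sigma>" "embedding \<sigma>"
    | \<tau> where "v = Complex_Place {\<tau>, cnj \<circ> \<tau>}" "embedding \<tau>"
    using assms by (auto simp: inf_places_def)
  then show "embedding (place_emb v)"
  proof cases
    case (2 \<tau>)
    show ?thesis
      unfolding 2(1) by (rule place_emb_Complex[of \<tau>]) (simp_all add: embedding_cnj 2(2))
  qed (simp add: embedding_of_real)
  show "place_abs v x = cmod (place_emb v x) ^ place_deg v"
    using assms by (auto simp: inf_places_def)
  show "place_deg v = 1 \<and> range (place_emb v) \<subseteq> \<real> \<or> place_deg v = 2"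
    using assms by (auto simp: inf_places_def)
qed

definition restrict_place :: "('k::field_char_0 \<Rightarrow> complex) \<Rightarrow> 'k place" where
  "restrict_place \<tau> = (if range \<tau> \<subseteq> \<real> then Real_Place (Re \<circ> \<tau>) else Complex_Place {\<tau>, cnj \<circ> \<tau>})"

lemma inf_places_eq: "inf_places = restrict_place ` embs"
proof safe
  fix v :: "'a place" assume "v \<in> inf_places"
  then consider \<sigma> where "v = Real_Place \<sigma>" "embedding \<sigma>"
    | \<tau> where "v = Complex_Place {\<tau>, cnj \<circ> \<tau>}" "embedding \<tau>" "\<not> range \<tau> \<subseteq> \<real>"
    by (auto simp: inf_places_def)
  then show "v \<in> restrict_place ` embs"
  proof cases
    case (1 \<sigma>)
    have "restrict_place (complex_of_real \<circ> \<sigma>) = v" by (auto simp: restrict_place_def 1 o_def)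
    then show ?thesis using embedding_of_real[OF 1(2)] by (auto simp: embs_def)
  next
    case (2 \<tau>)
    then have "v = restrict_place \<tau>" by (simp add: restrict_place_def)
    then show ?thesis using 2(2) unfolding embs_def by blast
  qed
next
  fix \<tau> :: "'a \<Rightarrow> complex" assume "\<tau> \<in> embs"
  then have \<tau>: "embedding \<tau>" by (simp add: embs_def)
  show "restrict_place \<tau> \<in> inf_places"
  proof (cases "range \<tau> \<subseteq> \<real>")
    case True
    then have im: "Im (\<tau> x) = 0" for x by (auto simp: complex_is_Real_iff image_subset_iff)
    have "embedding (Re \<circ> \<tau>)" using \<tau> im by (auto simp: embedding_def)
    then show ?thesis using True by (auto simp: restrict_place_def inf_places_def)
  next
    case False
    then show ?thesis using \<tau> by (auto simp: restrict_place_def inf_places_def)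
  qed
qed

text \<open>One embedding restricts to a real place, two conjugate ones to a complex place: this is the
  exponent in the normalisation.\<close>

lemma place_abs_restrict_place:
  assumes "\<tau> \<in> embs"
  shows "place_abs (restrict_place \<tau>) x = (\<Prod>\<tau>'\<in>{\<tau>' \<in> embs. restrict_place \<tau>' = restrict_place \<tau>}. cmod (\<tau>' x))"
proof (cases "range \<tau> \<subseteq> \<real>")
  case True
  then have re: "complex_of_real (Re (\<tau> y)) = \<tau> y" for y
    by (auto simp: image_subset_iff Reals_def)
  have "\<tau>' = \<tau>" if "restrict_place \<tau>' = restrict_place \<tau>" for \<tau>'
  proof -
    have "range \<tau>' \<subseteq> \<real>" and eq: "Re \<circ> \<tau>' = Re \<circ> \<tau>"
      using that True by (auto simp: restrict_place_def split: if_splits)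
    then have "complex_of_real (Re (\<tau>' y)) = \<tau>' y" for y
      by (auto simp: image_subset_iff Reals_def)
    then show ?thesis using re fun_cong[OF eq] by (metis comp_apply ext)
  qed
  then have "{\<tau>' \<in> embs. restrict_place \<tau>' = restrict_place \<tau>} = {\<tau>}" using assms by blast
  moreover have "\<bar>Re (\<tau> x)\<bar> = cmod (\<tau> x)" by (metis norm_of_real re)
  ultimately show ?thesis using True by (simp add: restrict_place_def)
next
  case False
  then obtain y where y: "\<tau> y \<notin> \<real>" by blast
  then have ne: "cnj \<circ> \<tau> \<noteq> \<tau>" by (metis Reals_cnj_iff comp_apply)
  have cnj2: "cnj \<circ> (cnj \<circ> \<tau>) = \<tau>" by auto
  have not_real: "\<not> range (cnj \<circ> \<tau>) \<subseteq> \<real>"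
    using y by (auto simp: complex_is_Real_iff image_subset_iff)
  have "\<tau>' = \<tau> \<or> \<tau>' = cnj \<circ> \<tau>" if "restrict_place \<tau>' = restrict_place \<tau>" for \<tau>'
    using that False by (auto simp: restrict_place_def split: if_splits)
  moreover have "restrict_place (cnj \<circ> \<tau>) = restrict_place \<tau>"
    using False not_real cnj2 by (auto simp: restrict_place_def)
  ultimately have "{\<tau>' \<in> embs. restrict_place \<tau>' = restrict_place \<tau>} = {\<tau>, cnj \<circ> \<tau>}"
    using assms embedding_cnj by (auto simp: embs_def)
  moreover have "cmod (place_emb (Complex_Place {\<tau>, cnj \<circ> \<tau>}) x) = cmod (\<tau> x)"
    by (rule place_emb_Complex[of \<tau>]) auto
  ultimately show ?thesis
    using False ne by (simp add: restrict_place_def power2_eq_square)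
qed

lemma prod_inf_places:
  assumes "number_field TYPE('k::field_char_0)"
  shows "finite (inf_places :: 'k place set)" "(\<Prod>v\<in>inf_places. place_abs v (x::'k)) = emb_norm x"
proof -
  note fin = finite_embs[OF assms]
  show "finite (inf_places :: 'k place set)" using fin by (simp add: inf_places_eq)
  have "emb_norm x = (\<Prod>v\<in>restrict_place ` embs. \<Prod>\<tau>\<in>{\<tau> \<in> embs. restrict_place \<tau> = v}. cmod (\<tau> x))"
    unfolding emb_norm_def by (rule prod.image_gen[OF fin])
  also have "\<dots> = (\<Prod>v\<in>restrict_place ` embs. place_abs v x)"
    by (intro prod.cong refl) (auto simp: place_abs_restrict_place)
  finally show "(\<Prod>v\<in>inf_places. place_abs v x) = emb_norm x" by (simp add: inf_places_eq)
qed

lemma inf_places_nonempty: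
  assumes "number_field TYPE('k::field_char_0)"
  shows "inf_places \<noteq> ({} :: 'k place set)"
proof -
  obtain \<theta> :: 'k and d and e :: "nat \<Rightarrow> 'k \<Rightarrow> complex" where
    "algebraic_int \<theta>" "d > 0" "rat_indep (\<lambda>i. \<theta> ^ i) {..<d}"
    "\<forall>x. \<exists>c. x = (\<Sum>i<d. of_rat (c i) * \<theta> ^ i)" and e: "bij_betw e {..<d} embs"
    "inj_on (\<lambda>i. e i \<theta>) {..<d}"
    by (rule power_basis[OF assms])
  then have "e 0 \<in> embs" using \<open>d > 0\<close> by (auto simp: bij_betw_def)
  then show ?thesis by (auto simp: inf_places_eq)
qed

context
  assumes nf: "number_field TYPE('k::field_char_0)"
begin

lemma integer_fraction:
  obtains a m where "a \<in> alg_ints" "m > 0" "(x::'k) = a / of_nat m"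
proof -
  obtain m where m: "m > 0" "algebraic_int (of_nat m * x)"
    by (rule number_field_clear_denominator[OF nf])
  then show thesis using that[of "of_nat m * x" m] by (simp add: alg_ints_def)
qed

lemma ord_at_divide:
  assumes p: "int_prime (p::'k set)" and a: "a \<in> alg_ints" "a \<noteq> 0" and b: "b \<in> alg_ints" "b \<noteq> 0"
  shows "ord_at p (a / b) = int (integer_ord p a) - int (integer_ord p b)"
  unfolding ord_at_def
proof (rule the_equality)
  show "\<exists>a'\<in>carrier integer_ring. \<exists>b'\<in>carrier integer_ring. a' \<noteq> 0 \<and> b' \<noteq> 0 \<and> a / b = a' / b' \<and>
      int (integer_ord p a) - int (integer_ord p b) = int (integer_ord p a') - int (integer_ord p b')"
    using a b by (auto simp: integer_ring_simps)
next
  fix k assume "\<exists>a'\<in>carrier integer_ring. \<exists>b'\<in>carrier integer_ring. a' \<noteq> 0 \<and> b' \<noteq> 0 \<and> a / b = a' / b' \<and>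
      k = int (integer_ord p a') - int (integer_ord p b')"
  then obtain a' b' where ab': "a' \<in> alg_ints" "b' \<in> alg_ints" "a' \<noteq> 0" "b' \<noteq> 0" "a / b = a' / b'"
    and k: "k = int (integer_ord p a') - int (integer_ord p b')"
    by (auto simp: integer_ring_simps)
  have "a * b' = a' * b" using ab' b by (simp add: field_simps)
  then have "integer_ord p a + integer_ord p b' = integer_ord p a' + integer_ord p b"
    using integer_ord_mult[OF nf p] a b ab' by metis
  then show "k = int (integer_ord p a) - int (integer_ord p b)" using k by simp
qed

lemma ord_at_integer:
  "int_prime (p::'k set) \<Longrightarrow> a \<in> alg_ints \<Longrightarrow> a \<noteq> 0 \<Longrightarrow> ord_at p a = int (integer_ord p a)"
  using ord_at_divide[of p a 1] alg_ints_closed(2) integer_ord_unit[OF nf, of p 1] int_primeD(2)[of p]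
  by simp

lemma ord_at_mult:
  assumes p: "int_prime (p::'k set)" and x: "x \<noteq> 0" and y: "y \<noteq> 0"
  shows "ord_at p (x * y) = ord_at p x + ord_at p y"
proof -
  obtain a m where a: "a \<in> alg_ints" "m > 0" "x = a / of_nat m" by (rule integer_fraction)
  obtain b n where b: "b \<in> alg_ints" "n > 0" "y = b / of_nat n" by (rule integer_fraction)
  have [simp]: "a \<noteq> 0" "b \<noteq> 0" "of_nat m \<noteq> (0::'k)" "of_nat n \<noteq> (0::'k)" using a b x y by auto
  have "x * y = (a * b) / (of_nat m * of_nat n)" by (simp add: a b)
  also have "ord_at p \<dots> = int (integer_ord p (a * b)) - int (integer_ord p (of_nat m * of_nat n))"
    by (rule ord_at_divide[OF p]) (use a b x y in \<open>auto simp: alg_ints_closed\<close>)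
  also have "integer_ord p (a * b) = integer_ord p a + integer_ord p b"
    by (rule integer_ord_mult[OF nf p]) (use a b x y in auto)
  also have "integer_ord p (of_nat m * of_nat n :: 'k) = integer_ord p (of_nat m :: 'k) + integer_ord p (of_nat n :: 'k)"
    by (rule integer_ord_mult[OF nf p]) (use a b x y in \<open>auto simp: alg_ints_closed\<close>)
  also have "int (integer_ord p a + integer_ord p b) -
      int (integer_ord p (of_nat m :: 'k) + integer_ord p (of_nat n :: 'k)) = ord_at p x + ord_at p y"
    using ord_at_divide[OF p a(1) _ alg_ints_closed(3), of m] ord_at_divide[OF p b(1) _ alg_ints_closed(3), of n]
      a(2) b(2) x y by (simp add: a(3) b(3))
  finally show ?thesis .
qed

lemma ord_at_add:
  assumes p: "int_prime (p::'k set)" and x: "x \<noteq> 0" and y: "y \<noteq> 0" and xy: "x + y \<noteq> 0"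
  shows "min (ord_at p x) (ord_at p y) \<le> ord_at p (x + y)"
proof -
  obtain a m where a: "a \<in> alg_ints" "m > 0" "x = a / of_nat m" by (rule integer_fraction)
  obtain b n where b: "b \<in> alg_ints" "n > 0" "y = b / of_nat n" by (rule integer_fraction)
  have [simp]: "a \<noteq> 0" "b \<noteq> 0" "of_nat m \<noteq> (0::'k)" "of_nat n \<noteq> (0::'k)" using a b x y by auto
  define M where "M = of_nat m * (of_nat n :: 'k)"
  have M: "M \<in> alg_ints" "M \<noteq> 0" using a(2) b(2) by (simp_all add: M_def alg_ints_closed)
  have eqs: "x = (a * of_nat n) / M" "y = (b * of_nat m) / M"
    by (simp_all add: a b M_def)
  then have eq: "x + y = (a * of_nat n + b * of_nat m) / M" by (simp add: add_divide_distrib)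
  have ints: "a * of_nat n \<in> alg_ints" "a * of_nat n \<noteq> 0" "b * of_nat m \<in> alg_ints" "b * of_nat m \<noteq> 0"
    using a b by (simp_all add: alg_ints_closed)
  have sum: "a * of_nat n + b * of_nat m \<noteq> 0" using eq xy by auto
  have "ord_at p x = int (integer_ord p (a * of_nat n)) - int (integer_ord p M)"
    "ord_at p y = int (integer_ord p (b * of_nat m)) - int (integer_ord p M)"
    "ord_at p (x + y) = int (integer_ord p (a * of_nat n + b * of_nat m)) - int (integer_ord p M)"
    using ord_at_divide[OF p ints(1,2) M] ord_at_divide[OF p ints(3,4) M]
      ord_at_divide[OF p alg_ints_closed(5)[OF ints(1,3)] sum M] unfolding eq by (simp_all only: eqs)
  then show ?thesis using integer_ord_add[OF nf p ints sum] by simp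
qed

lemma ideal_norm_ge_2: "int_prime (p::'k set) \<Longrightarrow> ideal_norm p \<ge> 2"
  by (simp add: ideal_norm_eq_index index_prime_ge_2[OF nf])

lemma place_abs_mult:
  assumes "v \<in> places"
  shows "place_abs v (x * y :: 'k) = place_abs v x * place_abs v y"
proof (cases "v \<in> inf_places")
  case True
  note v = inf_place_cases[OF True]
  show ?thesis using v(1) by (simp add: v(2) embedding_def norm_mult power_mult_distrib)
next
  case False
  then obtain p where p: "v = Finite_Place p" "int_prime p"
    using assms by (auto simp: places_eq fin_places_def)
  show ?thesis
  proof (cases "x = 0 \<or> y = 0")
    case False
    then show ?thesis
      using ideal_norm_ge_2[OF p(2)]
      by (simp add: p(1) ord_at_mult[OF p(2)] power_int_add[symmetric])
  qed (auto simp: p(1))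
qed

lemma place_abs_pos:
  assumes "v \<in> places" "(x::'k) \<noteq> 0"
  shows "place_abs v x > 0"
proof (cases "v \<in> inf_places")
  case True
  note v = inf_place_cases[OF True]
  interpret e: field_hom "place_emb v" using v(1) by (rule embedding_field_hom)
  show ?thesis using assms(2) by (simp add: v(2))
next
  case False
  then obtain p where p: "v = Finite_Place p" "int_prime p"
    using assms by (auto simp: places_eq fin_places_def)
  show ?thesis using ideal_norm_ge_2[OF p(2)] assms(2) by (simp add: p(1))
qed

lemma place_abs_0:
  assumes "v \<in> places"
  shows "place_abs v (0::'k) = 0"
proof (cases "v \<in> inf_places")
  case True
  note v = inf_place_cases[OF True]
  interpret e: field_hom "place_emb v" using v(1) by (rule embedding_field_hom)
  show ?thesis using v(3) by (auto simp: v(2))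
next
  case False
  then show ?thesis using assms by (auto simp: places_eq fin_places_def)
qed

lemma place_abs_nonneg: "v \<in> places \<Longrightarrow> place_abs v (x::'k) \<ge> 0"
  using place_abs_pos[of v x] place_abs_0[of v] by (cases "x = 0") auto

lemma place_abs_add_finite:
  assumes "v \<in> fin_places"
  shows "place_abs v (x + y :: 'k) \<le> max (place_abs v x) (place_abs v y)"
proof -
  obtain p where p: "v = Finite_Place p" "int_prime p"
    using assms by (auto simp: fin_places_def)
  have v: "v \<in> places" using assms by (simp add: places_eq)
  show ?thesis
  proof (cases "x = 0 \<or> y = 0 \<or> x + y = 0")
    case True
    then show ?thesis using place_abs_nonneg[OF v] place_abs_0[OF v] by (auto simp: le_max_iff_disj)
  next
    case False
    then have le: "- ord_at p (x + y) \<le> - ord_at p x \<or> - ord_at p (x + y) \<le> - ord_at p y"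
      using ord_at_add[OF p(2), of x y] by auto
    have "real (ideal_norm p) powi k \<le> real (ideal_norm p) powi l" if "k \<le> l" for k l
      using ideal_norm_ge_2[OF p(2)] that by (intro power_int_increasing) auto
    then show ?thesis using le False by (auto simp: p(1) le_max_iff_disj)
  qed
qed

lemma place_abs_minus: "v \<in> places \<Longrightarrow> place_abs v (- x :: 'k) = place_abs v x"
proof -
  assume v: "v \<in> places"
  have "place_abs v (1 :: 'k) = 1"
    using place_abs_mult[OF v, of 1 1] place_abs_pos[OF v, of 1] by simp
  then have "(place_abs v (- 1 :: 'k))\<^sup>2 = 1"
    using place_abs_mult[OF v, of "- 1" "- 1"] by (simp add: power2_eq_square)
  then have "place_abs v (- 1 :: 'k) = 1"
    using place_abs_pos[OF v, of "- 1"] by (auto simp: power2_eq_1_iff)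
  then show ?thesis using place_abs_mult[OF v, of "- 1" x] by simp
qed

end

definition place_prod :: "('k::field_char_0 place \<Rightarrow> real) \<Rightarrow> real" where
  "place_prod f = (\<Prod>v\<in>{v \<in> places. f v \<noteq> 1}. f v)"

lemma place_prod_eq:
  assumes "finite F" "F \<subseteq> places" "{v \<in> places. f v \<noteq> 1} \<subseteq> F"
  shows "place_prod f = prod f F"
  unfolding place_prod_def using assms by (intro prod.mono_neutral_left) auto

lemma place_prod_mult:
  assumes "finite {v \<in> places. f v \<noteq> 1}" "finite {v \<in> places. g v \<noteq> 1}"
  shows "place_prod (\<lambda>v. f v * g v) = place_prod f * place_prod g"
proof -
  define F where "F = {v \<in> places. f v \<noteq> 1} \<union> {v \<in> places. g v \<noteq> 1}"
  have "place_prod h = prod h F" if "\<And>v. v \<in> places \<Longrightarrow> f v = 1 \<Longrightarrow> g v = 1 \<Longrightarrow> h v = 1" for h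
    using that assms by (intro place_prod_eq) (auto simp: F_def)
  then show ?thesis by (simp add: prod.distrib)
qed

lemma place_prod_cong: "(\<And>v. v \<in> places \<Longrightarrow> f v = g v) \<Longrightarrow> place_prod f = place_prod g"
  unfolding place_prod_def by (rule prod.cong) auto

lemma place_prod_pos: "(\<And>v. v \<in> places \<Longrightarrow> f v > 0) \<Longrightarrow> place_prod f > 0"
  unfolding place_prod_def by (rule prod_pos) auto

context
  assumes nf: "number_field TYPE('k::field_char_0)"
begin

text \<open>The infinite places contribute the product of the conjugates, which is \<open>[O : a O]\<close>; by the
  factorisation of this index the finite places contribute its inverse.\<close>

lemma product_formula_integer:
  assumes a: "a \<in> alg_ints" "(a::'k) \<noteq> 0"
  shows "finite {v \<in> places. place_abs v a \<noteq> 1}" "place_prod (\<lambda>v. place_abs v a) = 1"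
proof -
  define S where "S = {q. int_prime q \<and> integer_ord q a \<noteq> 0}"
  note factor = norm_factorisation[OF nf a, folded S_def]
  define F where "F = inf_places \<union> Finite_Place ` S"
  have abs: "place_abs (Finite_Place q) a = inverse (real (index alg_ints q) ^ integer_ord q a)"
    if "int_prime q" for q
    using a ord_at_integer[OF nf that a] by (simp add: ideal_norm_eq_index power_int_minus)
  have F: "finite F" "F \<subseteq> places"
    using prod_inf_places(1)[OF nf] factor(1)
    by (auto simp: F_def places_eq fin_places_def S_def)
  have sub: "{v \<in> places. place_abs v a \<noteq> 1} \<subseteq> F"
  proof
    fix v assume v: "v \<in> {v \<in> places. place_abs v a \<noteq> 1}"
    show "v \<in> F"
    proof (cases "v \<in> inf_places")
      case False
      then obtain q where q: "v = Finite_Place q" "int_prime q"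
        using v by (auto simp: places_eq fin_places_def)
      then have "integer_ord q a \<noteq> 0" using v abs[OF q(2)] by (cases "integer_ord q a = 0") auto
      then show ?thesis using q by (auto simp: F_def S_def)
    qed (simp add: F_def)
  qed
  show "finite {v \<in> places. place_abs v a \<noteq> 1}" by (rule finite_subset[OF sub F(1)])
  have "place_prod (\<lambda>v. place_abs v a) = (\<Prod>v\<in>F. place_abs v a)"
    by (rule place_prod_eq[OF F sub])
  also have "\<dots> = (\<Prod>v\<in>inf_places. place_abs v a) * (\<Prod>v\<in>Finite_Place ` S. place_abs v a)"
    unfolding F_def using prod_inf_places(1)[OF nf] factor(1)
    by (intro prod.union_disjoint) (auto simp: inf_places_def)
  also have "(\<Prod>v\<in>Finite_Place ` S. place_abs v a) = (\<Prod>q\<in>S. place_abs (Finite_Place q) a)"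
    by (subst prod.reindex) (auto simp: inj_on_def)
  also have "\<dots> = (\<Prod>q\<in>S. inverse (real (index alg_ints q) ^ integer_ord q a))"
    by (intro prod.cong refl abs) (simp add: S_def)
  also have "\<dots> = inverse (emb_norm a)"
    unfolding factor(2)
    using prod_inversef[of "\<lambda>q. real (index alg_ints q) ^ integer_ord q a" S] by (simp add: o_def)
  also have "(\<Prod>v\<in>inf_places. place_abs v a) = emb_norm a"
    by (rule prod_inf_places(2)[OF nf])
  finally show "place_prod (\<lambda>v. place_abs v a) = 1"
    using emb_norm_pos[OF nf a(2)] by simp
qed

theorem product_formula:
  assumes x: "(x::'k) \<noteq> 0"
  shows "finite {v \<in> places. place_abs v x \<noteq> 1}" "place_prod (\<lambda>v. place_abs v x) = 1"
proof -
  obtain a m where a: "a \<in> alg_ints" "m > 0" "x = a / of_nat m" by (rule integer_fraction[OF nf])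
  have nz: "a \<noteq> 0" "of_nat m \<noteq> (0::'k)" using a x by auto
  note fa = product_formula_integer[OF a(1) nz(1)]
  note fm = product_formula_integer[OF alg_ints_closed(3) nz(2)]
  have eq: "place_abs v x * place_abs v (of_nat m) = place_abs v a" if "v \<in> places" for v
    using place_abs_mult[OF nf that, of x "of_nat m"] a(3) nz by simp
  have "{v \<in> places. place_abs v x \<noteq> 1} \<subseteq>
      {v \<in> places. place_abs v a \<noteq> 1} \<union> {v \<in> places. place_abs v (of_nat m :: 'k) \<noteq> 1}"
    using eq by force
  then show fin: "finite {v \<in> places. place_abs v x \<noteq> 1}"
    using fa(1) fm(1) finite_subset by blast
  have "place_prod (\<lambda>v. place_abs v x) * place_prod (\<lambda>v. place_abs v (of_nat m :: 'k)) =
      place_prod (\<lambda>v. place_abs v a)"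
    using place_prod_mult[OF fin fm(1)] place_prod_cong[of _ "\<lambda>v. place_abs v a", OF eq] by simp
  then show "place_prod (\<lambda>v. place_abs v x) = 1" using fa(2) fm(2) by simp
qed

end


section \<open>Heights\<close>

lemma place_abs_le_local_max:
  "finite I \<Longrightarrow> i \<in> I \<Longrightarrow> place_abs v (x i) \<le> local_max I x v"
  by (simp add: local_max_def)

lemma coord_height_eq: "coord_height I x = place_prod (local_max I x)"
  by (simp add: coord_height_def place_prod_def)

definition place_deg_sum :: "'k::field_char_0 itself \<Rightarrow> nat" where
  "place_deg_sum _ = (\<Sum>v\<in>(inf_places :: 'k place set). place_deg v)"

context
  assumes nf: "number_field TYPE('k::field_char_0)"
begin

lemma local_max_pos:
  fixes x :: "'i \<Rightarrow> 'k"
  assumes "finite I" "i \<in> I" "x i \<noteq> 0" "v \<in> places"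
  shows "local_max I x v > 0"
  using place_abs_pos[OF nf assms(4,3)] place_abs_le_local_max[OF assms(1,2), of v x] by linarith

lemma finite_local_max_support:
  fixes x :: "'i \<Rightarrow> 'k"
  assumes "finite I" "i \<in> I" "x i \<noteq> 0"
  shows "finite {v \<in> places. local_max I x v \<noteq> 1}"
proof (rule finite_subset)
  show "{v \<in> places. local_max I x v \<noteq> 1} \<subseteq> (\<Union>j\<in>{j \<in> I. x j \<noteq> 0}. {v \<in> places. place_abs v (x j) \<noteq> 1})"
  proof (rule ccontr)
    assume "\<not> ?thesis"
    then obtain v where v: "v \<in> places" "local_max I x v \<noteq> 1"
      and one: "\<And>j. j \<in> I \<Longrightarrow> x j \<noteq> 0 \<Longrightarrow> place_abs v (x j) = 1" by auto
    have "local_max I x v = 1"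
      unfolding local_max_def
    proof (rule Max_eqI)
      show "1 \<in> (\<lambda>i. place_abs v (x i)) ` I" using one[OF assms(2,3)] assms(2) by force
      fix r assume "r \<in> (\<lambda>i. place_abs v (x i)) ` I"
      then obtain j where "j \<in> I" "r = place_abs v (x j)" by blast
      then show "r \<le> 1" using one[of j] place_abs_0[OF nf v(1)] by (cases "x j = 0") auto
    qed (use assms in simp)
    with v show False by simp
  qed
  show "finite (\<Union>j\<in>{j \<in> I. x j \<noteq> 0}. {v \<in> places. place_abs v (x j) \<noteq> 1})"
    using assms(1) product_formula(1)[OF nf] by auto
qed

lemma coord_height_pos:
  fixes x :: "'i \<Rightarrow> 'k"
  assumes "finite I" "i \<in> I" "x i \<noteq> 0"
  shows "coord_height I x > 0"
  unfolding coord_height_eq by (rule place_prod_pos) (rule local_max_pos[where x = x, OF assms])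

lemma local_max_scale:
  fixes x :: "'i \<Rightarrow> 'k"
  assumes "finite I" "I \<noteq> {}" "v \<in> places"
  shows "local_max I (\<lambda>i. c * x i) v = place_abs v c * local_max I x v"
proof -
  have "mono ((*) (place_abs v c))"
    using place_abs_nonneg[OF nf assms(3)] by (auto intro: monoI mult_left_mono)
  from mono_Max_commute[OF this, of "(\<lambda>i. place_abs v (x i)) ` I"] assms show ?thesis
    by (simp add: local_max_def place_abs_mult[OF nf] image_image)
qed

lemma coord_height_scale:
  fixes x :: "'i \<Rightarrow> 'k"
  assumes "finite I" "i \<in> I" "x i \<noteq> 0" "c \<noteq> 0"
  shows "coord_height I (\<lambda>i. c * x i) = coord_height I x"
proof -
  have "I \<noteq> {}" using assms(2) by auto
  then have "coord_height I (\<lambda>i. c * x i) = place_prod (\<lambda>v. place_abs v c * local_max I x v)"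
    unfolding coord_height_eq by (intro place_prod_cong local_max_scale assms(1))
  also have "\<dots> = coord_height I x"
    using place_prod_mult[OF product_formula(1)[OF nf assms(4)] finite_local_max_support[where x = x, OF assms(1-3)]]
      product_formula(2)[OF nf assms(4)] by (simp add: coord_height_eq)
  finally show ?thesis .
qed

lemma place_deg_sum_pos: "place_deg_sum TYPE('k) > 0"
proof -
  obtain v :: "'k place" where v: "v \<in> inf_places" using inf_places_nonempty[OF nf] by blast
  have "place_deg v > 0" using inf_place_cases(3)[OF v] by auto
  then show ?thesis
    unfolding place_deg_sum_def using v prod_inf_places(1)[OF nf] by (intro sum_pos2[of _ v]) auto
qed

text \<open>Only the infinite places contribute to the power of \<open>\<epsilon>\<close>.\<close>

lemma place_prod_le:
  fixes f g h :: "'k place \<Rightarrow> real"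
  assumes pos: "\<And>v. v \<in> places \<Longrightarrow> f v > 0"
    and fin: "finite {v \<in> places. f v \<noteq> 1}" "finite {v \<in> places. g v \<noteq> 1}" "finite {v \<in> places. h v \<noteq> 1}"
    and le: "\<And>v. v \<in> places \<Longrightarrow> f v \<le> \<epsilon> ^ place_deg v * (g v * h v)"
  shows "place_prod f \<le> \<epsilon> ^ place_deg_sum TYPE('k) * (place_prod g * place_prod h)"
proof -
  define F where "F = inf_places \<union> ({v \<in> places. f v \<noteq> 1} \<union> {v \<in> places. g v \<noteq> 1} \<union> {v \<in> places. h v \<noteq> 1})"
  have F: "finite F" "F \<subseteq> places" using fin prod_inf_places(1)[OF nf] by (auto simp: F_def places_eq)
  have "place_prod f = prod f F" by (rule place_prod_eq[OF F]) (auto simp: F_def)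
  also have "\<dots> \<le> (\<Prod>v\<in>F. \<epsilon> ^ place_deg v * (g v * h v))"
    using F(2) pos le by (intro prod_mono) (auto intro: less_imp_le)
  also have "\<dots> = (\<Prod>v\<in>F. \<epsilon> ^ place_deg v) * (prod g F * prod h F)"
    by (simp add: prod.distrib)
  also have "prod g F = place_prod g" by (rule place_prod_eq[OF F, symmetric]) (auto simp: F_def)
  also have "prod h F = place_prod h" by (rule place_prod_eq[OF F, symmetric]) (auto simp: F_def)
  also have "(\<Prod>v\<in>F. \<epsilon> ^ place_deg v) = (\<Prod>v\<in>(inf_places :: 'k place set). \<epsilon> ^ place_deg v)"
    using F by (intro prod.mono_neutral_right) (auto simp: F_def places_eq fin_places_def)
  also have "\<dots> = \<epsilon> ^ place_deg_sum TYPE('k)" by (simp add: place_deg_sum_def power_sum)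
  finally show ?thesis .
qed

end


section \<open>Covering a projective line by cells\<close>

text \<open>A point \<open>[p : q]\<close> of the complex projective line has a coordinate \<open>u\<close> of absolute value at
  most 1 in one of the two standard charts. Its cell records the chart and the square of a grid of
  mesh \<open>\<delta>\<close> that contains \<open>u\<close>.\<close>

definition cell :: "real \<Rightarrow> complex \<Rightarrow> complex \<Rightarrow> bool \<times> int \<times> int" where
  "cell \<delta> p q = (let u = if cmod q \<le> cmod p then q / p else p / q
    in (cmod q \<le> cmod p, \<lfloor>Re u / \<delta>\<rfloor>, \<lfloor>Im u / \<delta>\<rfloor>))"

lemma floor_eq_close:
  fixes x y \<delta> :: real
  assumes "\<delta> > 0" "\<lfloor>x / \<delta>\<rfloor> = \<lfloor>y / \<delta>\<rfloor>"
  shows "\<bar>x - y\<bar> \<le> \<delta>"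
proof -
  have "\<bar>x / \<delta> - y / \<delta>\<bar> \<le> 1" using assms(2) by linarith
  then have "\<bar>(x - y) / \<delta>\<bar> \<le> 1" by (simp add: diff_divide_distrib)
  then show ?thesis using assms(1) by (simp add: abs_divide)
qed

lemma cross_le_of_ratio_close:
  assumes "cmod q \<le> cmod p" "cmod q' \<le> cmod p'" "cmod (q' / p' - q / p) \<le> \<epsilon>"
  shows "cmod (p * q' - q * p') \<le> \<epsilon> * (cmod p * cmod p')"
proof (cases "p = 0 \<or> p' = 0")
  case True
  then show ?thesis using assms(1,2) by auto
next
  case False
  then have "p * q' - q * p' = (q' / p' - q / p) * (p * p')" by (simp add: field_simps)
  then have "cmod (p * q' - q * p') = cmod (q' / p' - q / p) * (cmod p * cmod p')"
    by (simp add: norm_mult)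
  then show ?thesis using assms(3) by (simp add: mult_right_mono)
qed

lemma cell_eq_close:
  assumes "\<delta> > 0" "cell \<delta> p q = cell \<delta> p' q'"
  shows "cmod (p * q' - q * p') \<le> 2 * \<delta> * (max (cmod p) (cmod q) * max (cmod p') (cmod q'))"
proof -
  have close: "cmod (u' - u) \<le> 2 * \<delta>"
    if "\<lfloor>Re u / \<delta>\<rfloor> = \<lfloor>Re u' / \<delta>\<rfloor>" "\<lfloor>Im u / \<delta>\<rfloor> = \<lfloor>Im u' / \<delta>\<rfloor>" for u u'
    using floor_eq_close[OF assms(1) that(1)] floor_eq_close[OF assms(1) that(2)] cmod_le[of "u' - u"]
    by simp
  show ?thesis
  proof (cases "cmod q \<le> cmod p")
    case True
    then have "cmod q' \<le> cmod p'" using assms(2) by (simp add: cell_def Let_def split: if_splits)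
    moreover have "cmod (q' / p' - q / p) \<le> 2 * \<delta>"
      using assms(2) True \<open>cmod q' \<le> cmod p'\<close> by (intro close) (auto simp: cell_def Let_def)
    ultimately show ?thesis using cross_le_of_ratio_close[OF True] True by (simp add: max_def)
  next
    case False
    then have le: "cmod p \<le> cmod q" "cmod p' \<le> cmod q'" and not: "\<not> cmod q' \<le> cmod p'"
      using assms(2) by (auto simp: cell_def Let_def split: if_splits)
    have "cmod (p' / q' - p / q) \<le> 2 * \<delta>"
      using assms(2) False not by (intro close) (auto simp: cell_def Let_def)
    from cross_le_of_ratio_close[OF le this] have "cmod (q * p' - p * q') \<le> 2 * \<delta> * (cmod q * cmod q')" .
    then show ?thesis using le by (simp add: max_def norm_minus_commute)
  qed
qed

lemma cross_le: "cmod (p * q' - q * p') \<le> 2 * (max (cmod p) (cmod q) * max (cmod p') (cmod q'))"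
proof -
  have "cmod (p * q' - q * p') \<le> cmod p * cmod q' + cmod q * cmod p'"
    by (metis norm_mult norm_triangle_ineq4)
  also have "cmod p * cmod q' \<le> max (cmod p) (cmod q) * max (cmod p') (cmod q')"
    by (intro mult_mono) (auto simp: le_max_iff_disj)
  also have "cmod q * cmod p' \<le> max (cmod p) (cmod q) * max (cmod p') (cmod q')"
    by (intro mult_mono) (auto simp: le_max_iff_disj)
  finally show ?thesis by simp
qed

text \<open>For \<open>k = 1\<close> only the cells of real points are listed, whose coordinate has imaginary part 0;
  this makes the number of cells of order \<open>\<delta> ^ (- k)\<close> in both cases.\<close>

definition cells :: "real \<Rightarrow> nat \<Rightarrow> (bool \<times> int \<times> int) set" where
  "cells \<delta> k = UNIV \<times> {- \<lceil>1 / \<delta>\<rceil>..\<lceil>1 / \<delta>\<rceil>} \<times> (if k = 1 then {0} else {- \<lceil>1 / \<delta>\<rceil>..\<lceil>1 / \<delta>\<rceil>})"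

lemma cell_in_cells:
  assumes "\<delta> > 0" and k: "k = 1 \<Longrightarrow> p \<in> \<real> \<and> q \<in> \<real>"
  shows "cell \<delta> p q \<in> cells \<delta> k"
proof -
  define u where "u = (if cmod q \<le> cmod p then q / p else p / q)"
  have "cmod u \<le> 1" by (auto simp: u_def norm_divide divide_le_eq_1)
  then have "\<bar>Re u\<bar> \<le> 1" "\<bar>Im u\<bar> \<le> 1" using abs_Re_le_cmod[of u] abs_Im_le_cmod[of u] by auto
  then have bound: "- (1 / \<delta>) \<le> Re u / \<delta>" "Re u / \<delta> \<le> 1 / \<delta>" "- (1 / \<delta>) \<le> Im u / \<delta>" "Im u / \<delta> \<le> 1 / \<delta>"
    using assms(1) by (auto simp: field_simps)
  have range: "\<lfloor>t\<rfloor> \<in> {- \<lceil>1 / \<delta>\<rceil>..\<lceil>1 / \<delta>\<rceil>}" if "- (1 / \<delta>) \<le> t" "t \<le> 1 / \<delta>" for t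
    using that by simp linarith
  have "Im u = 0" if "k = 1"
    using k[OF that] by (simp add: u_def complex_is_Real_iff[symmetric] Reals_divide)
  then show ?thesis
    using range[OF bound(1,2)] range[OF bound(3,4)]
    by (simp add: cell_def cells_def Let_def flip: u_def)
qed

lemma card_cells:
  assumes "0 < \<delta>" "\<delta> \<le> 1" "k = 1 \<or> k = 2"
  shows "finite (cells \<delta> k)" "real (card (cells \<delta> k)) \<le> (10 / \<delta>) ^ k"
proof -
  show "finite (cells \<delta> k)" by (simp add: cells_def)
  define M where "M = 2 * \<lceil>1 / \<delta>\<rceil> + 1"
  have "1 \<le> 1 / \<delta>" using assms by simp
  then have M: "M \<ge> 0" "real_of_int M \<le> 5 / \<delta>" unfolding M_def by (simp, linarith)
  have "card (cells \<delta> k) = 2 * (nat M * (if k = 1 then 1 else nat M))"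
    by (simp add: cells_def card_cartesian_product M_def algebra_simps)
  then have card: "real (card (cells \<delta> k)) = 2 * (real_of_int M * (if k = 1 then 1 else real_of_int M))"
    using M(1) by simp
  from assms(3) show "real (card (cells \<delta> k)) \<le> (10 / \<delta>) ^ k"
  proof
    assume "k = 1"
    then show ?thesis unfolding card using M(2) by simp
  next
    assume "k = 2"
    have "real_of_int M * real_of_int M \<le> 5 / \<delta> * (5 / \<delta>)"
      using M assms(1) by (intro mult_mono) auto
    then have "real (card (cells \<delta> k)) \<le> 50 * (1 / \<delta> * (1 / \<delta>))" using card \<open>k = 2\<close> by simp
    also have "\<dots> \<le> 100 * (1 / \<delta> * (1 / \<delta>))" using assms(1) by (intro mult_right_mono) auto
    finally show ?thesis using \<open>k = 2\<close> by (simp add: power2_eq_square)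
  qed
qed


section \<open>Counting points on a line\<close>

lemma proj_relI:
  "x \<in> coord_space n - {0} \<Longrightarrow> y \<in> coord_space n - {0} \<Longrightarrow> c \<noteq> 0 \<Longrightarrow> y = vec_scale c x \<Longrightarrow>
    (x, y) \<in> proj_rel n"
  by (auto simp: proj_rel_def)

lemma proj_relE:
  assumes "(x, y) \<in> proj_rel n"
  obtains c where "x \<in> coord_space n - {0}" "y \<in> coord_space n - {0}" "c \<noteq> 0" "y = vec_scale c x"
  using assms unfolding proj_rel_def by blast

lemma equiv_proj_rel:
  "equiv (coord_space n - {0}) (proj_rel n :: ((nat \<Rightarrow> 'k::field) \<times> (nat \<Rightarrow> 'k)) set)"
    (is "equiv ?A ?R")
proof (rule equivI)
  show "refl_on ?A ?R"
  proof (rule refl_onI)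
    fix x assume "x \<in> ?A"
    then show "(x, x) \<in> ?R" by (intro proj_relI[of _ _ _ 1]) (simp_all add: vec_scale_def)
  qed
  show "sym ?R"
  proof (rule symI)
    fix x y assume "(x, y) \<in> ?R"
    then obtain c where c: "x \<in> ?A" "y \<in> ?A" "c \<noteq> 0" "y = vec_scale c x" by (rule proj_relE)
    then have eq: "x = vec_scale (inverse c) y" by (simp add: vec_scale_def flip: mult.assoc)
    show "(y, x) \<in> ?R" by (rule proj_relI[OF c(2,1) _ eq]) (use c(3) in simp)
  qed
  show "trans ?R"
  proof (rule transI)
    fix x y z assume "(x, y) \<in> ?R" "(y, z) \<in> ?R"
    then obtain c d where c: "x \<in> ?A" "c \<noteq> 0" "y = vec_scale c x"
      and d: "z \<in> ?A" "d \<noteq> 0" "z = vec_scale d y"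
      by (elim proj_relE)
    then show "(x, z) \<in> ?R"
      by (intro proj_relI[of _ _ _ "d * c"]) (simp_all add: vec_scale_def mult.assoc)
  qed
qed (auto simp: proj_rel_def)

lemma line_basis_exists:
  fixes L :: "(nat \<Rightarrow> 'k::field) set"
  assumes "proj_line n L"
  shows "\<exists>p. case p of (a, b) \<Rightarrow> a \<noteq> b \<and> coords.independent {a, b} \<and> coords.span {a, b} = L"
proof -
  have L: "coords.subspace L" "coords.dim L = 2" using assms by (auto simp: proj_line_def)
  obtain B where B: "B \<subseteq> L" "coords.independent B" "L \<subseteq> coords.span B" "card B = 2"
    using coords.basis_exists[of L] L(2) by metis
  obtain a b where ab: "B = {a, b}" "a \<noteq> b" using B(4) by (auto simp: card_2_iff)
  have "coords.span B = L" using coords.span_minimal[OF B(1) L(1)] B(3) by blast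
  then show ?thesis using ab B(2) by auto
qed

lemma span_pair: "x \<in> coords.span {a, b} \<longleftrightarrow> (\<exists>\<alpha> \<beta>. \<forall>i. x i = \<alpha> * a i + \<beta> * b i)"
proof -
  have "x \<in> coords.span {a, b} \<longleftrightarrow> (\<exists>\<alpha> \<beta>. x - vec_scale \<alpha> a = vec_scale \<beta> b)"
    by (auto simp: coords.span_insert coords.span_singleton image_iff)
  also have "\<dots> \<longleftrightarrow> (\<exists>\<alpha> \<beta>. \<forall>i. x i = \<alpha> * a i + \<beta> * b i)"
    by (simp add: fun_eq_iff vec_scale_def fun_diff_def algebra_simps)
  finally show ?thesis .
qed

lemma pluecker_combination:
  assumes "\<forall>i. x i = \<alpha> * a i + \<beta> * b i" "\<forall>i. y i = \<gamma> * a i + \<delta> * b i"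
  shows "pluecker x y = (\<lambda>ij. (\<alpha> * \<delta> - \<beta> * \<gamma>) * pluecker a b ij)"
  using assms by (auto simp: pluecker_def fun_eq_iff algebra_simps)

lemma pluecker_nonzero:
  fixes a b :: "nat \<Rightarrow> 'k::field"
  assumes "a \<in> coord_space n" "b \<in> coord_space n" "a \<noteq> b" "coords.independent {a, b}"
  obtains ij where "ij \<in> {(i, j). i < j \<and> j \<le> n}" "pluecker a b ij \<noteq> 0"
proof -
  have "\<exists>ij\<in>{(i, j). i < j \<and> j \<le> n}. pluecker a b ij \<noteq> 0"
  proof (rule ccontr)
    assume "\<not> ?thesis"
    then have le: "a i * b j = a j * b i" if "i < j" "j \<le> n" for i j
      using that by (auto simp: pluecker_def)
    have zero: "a i = 0" "b i = 0" if "i > n" for i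
      using assms(1,2) that by (auto simp: coord_space_def)
    have all: "a i * b j = a j * b i" for i j
      using le[of i j] le[of j i] zero[of i] zero[of j] by (cases i j rule: linorder_cases; cases "i \<le> n"; cases "j \<le> n") auto
    have "a \<noteq> 0" using assms(4) coords.dependent_zero[of "{a, b}"] by auto
    then obtain i where i: "a i \<noteq> 0" by (auto simp: fun_eq_iff)
    have "b = vec_scale (b i / a i) a"
      using i all[of i] by (auto simp: fun_eq_iff vec_scale_def field_simps)
    then have "b \<in> coords.span {a}" by (auto simp: coords.span_singleton)
    moreover have "b \<notin> coords.span {a}"
      using assms(3,4) coords.independent_insert[of b "{a}"] by (simp add: insert_commute)
    ultimately show False by blast
  qed
  then show thesis using that by blast
qed

context
  assumes nf: "number_field TYPE('k::field_char_0)"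
begin

lemma local_max_pluecker_finite:
  fixes x y :: "nat \<Rightarrow> 'k"
  assumes v: "v \<in> fin_places" and n: "n \<ge> 1"
  shows "local_max {(i, j). i < j \<and> j \<le> n} (pluecker x y) v \<le> local_max {..n} x v * local_max {..n} y v"
proof -
  have vp: "v \<in> places" using v by (simp add: places_eq)
  have fin: "finite {(i, j). i < j \<and> j \<le> n}"
    by (rule finite_subset[of _ "{..n} \<times> {..n}"]) auto
  have "(0, 1) \<in> {(i, j). i < j \<and> j \<le> n}" using n by simp
  then have ne: "{(i, j). i < j \<and> j \<le> n} \<noteq> {}" by blast
  have prod_le: "place_abs v (x i * y j) \<le> local_max {..n} x v * local_max {..n} y v" if "i \<le> n" "j \<le> n" for i j
    unfolding place_abs_mult[OF nf vp]
    using that place_abs_nonneg[OF nf vp] place_abs_le_local_max[of "{..n}" i v x] place_abs_le_local_max[of "{..n}" j v y]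
    by (intro mult_mono) (auto intro: order_trans)
  have "place_abs v (x i * y j - x j * y i) \<le> local_max {..n} x v * local_max {..n} y v" if "i < j" "j \<le> n" for i j
  proof -
    have "place_abs v (x i * y j + - (x j * y i)) \<le> max (place_abs v (x i * y j)) (place_abs v (- (x j * y i)))"
      by (rule place_abs_add_finite[OF nf v])
    then show ?thesis using prod_le[of i j] prod_le[of j i] that place_abs_minus[OF nf vp] by auto
  qed
  then show ?thesis
    unfolding local_max_def[of "{(i, j). i < j \<and> j \<le> n}"] using fin ne by (auto simp: pluecker_def)
qed

text \<open>If \<open>(i, j)\<close> maximises \<open>\<bar>a\<^sub>i b\<^sub>j - a\<^sub>j b\<^sub>i\<bar>\<close> at \<open>v\<close>, it does so for every other pair of
  points of the line, since all Pluecker coordinates change by the same factor. So the local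
  height of \<open>x \<and> y\<close> is read off from the coordinates \<open>x\<^sub>i, x\<^sub>j, y\<^sub>i, y\<^sub>j\<close>, and the cells of
  \<open>[x\<^sub>i : x\<^sub>j]\<close> and \<open>[y\<^sub>i : y\<^sub>j]\<close> bound it uniformly in \<open>n\<close>.\<close>

lemma line_count_bound:
  fixes L :: "(nat \<Rightarrow> 'k) set"
  assumes n: "n \<ge> 1" and L: "proj_line n L" and B: "B > 0"
  shows "finite (bounded_points n L B) \<and>
    real (line_count n L B) \<le> (2 * 20 ^ place_deg_sum TYPE('k)) / line_height n L * B\<^sup>2 + 1"
proof -
  define Pairs where "Pairs = {(i, j). i < j \<and> j \<le> n}"
  define d where "d = place_deg_sum TYPE('k)"
  have fin_Pairs: "finite Pairs"
    unfolding Pairs_def by (rule finite_subset[of _ "{..n} \<times> {..n}"]) auto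
  obtain a b where ab: "(SOME (a, b). a \<noteq> b \<and> coords.independent {a, b} \<and> coords.span {a, b} = L) = (a, b)"
    by (cases "SOME (a, b). a \<noteq> b \<and> coords.independent {a, b} \<and> coords.span {a, b} = L")
  have basis: "a \<noteq> b" "coords.independent {a, b}" "coords.span {a, b} = L"
    using someI_ex[OF line_basis_exists[OF L]] unfolding ab by auto
  define D where "D = pluecker a b"
  have H: "line_height n L = coord_height Pairs D"
    by (simp add: line_height_def ab D_def Pairs_def)
  have "a \<in> L" "b \<in> L" using basis(3) coords.span_base[of _ "{a, b}"] by auto
  then have "a \<in> coord_space n" "b \<in> coord_space n" using L by (auto simp: proj_line_def)
  then obtain ij0 where ij0: "ij0 \<in> Pairs" "D ij0 \<noteq> 0"
    unfolding D_def Pairs_def by (rule pluecker_nonzero[OF _ _ basis(1,2)])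
  then have ne_Pairs: "Pairs \<noteq> {}" by blast
  have H_pos: "line_height n L > 0"
    unfolding H by (rule coord_height_pos[OF nf fin_Pairs, where x = D, OF ij0])
  define ij where "ij = (\<lambda>v. SOME ij. ij \<in> Pairs \<and> place_abs v (D ij) = local_max Pairs D v)"
  have ij: "ij v \<in> Pairs" "place_abs v (D (ij v)) = local_max Pairs D v" for v
  proof -
    have "local_max Pairs D v \<in> (\<lambda>i. place_abs v (D i)) ` Pairs"
      unfolding local_max_def using fin_Pairs ne_Pairs by (intro Max_in) auto
    then obtain e where "local_max Pairs D v = place_abs v (D e)" "e \<in> Pairs" by (rule imageE)
    then have "\<exists>ij. ij \<in> Pairs \<and> place_abs v (D ij) = local_max Pairs D v"
      by (intro exI[of _ e]) simp
    from someI_ex[OF this] show "ij v \<in> Pairs" "place_abs v (D (ij v)) = local_max Pairs D v"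
      by (auto simp: ij_def)
  qed
  define rep where "rep = (\<lambda>P::(nat \<Rightarrow> 'k) set. SOME x. x \<in> P)"
  have rep: "rep P \<in> L" "rep P \<in> coord_space n - {0}" "P = proj_rel n `` {rep P}"
    if P: "P \<in> line_points n L" for P
  proof -
    obtain x where x: "x \<in> coord_space n - {0}" "P = proj_rel n `` {x}"
      using P by (auto simp: line_points_def proj_space_def quotient_def)
    have "x \<in> P" using equiv_class_self[OF equiv_proj_rel x(1)] x(2) by simp
    then have "rep P \<in> P" unfolding rep_def by (rule someI[of "\<lambda>x. x \<in> P"])
    then show "rep P \<in> L" using P by (auto simp: line_points_def)
    have rel: "(x, rep P) \<in> proj_rel n" using \<open>rep P \<in> P\<close> x(2) by simp
    then show "rep P \<in> coord_space n - {0}" by (simp add: proj_rel_def)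
    show "P = proj_rel n `` {rep P}" using equiv_class_eq[OF equiv_proj_rel rel] x(2) by simp
  qed
  define p where "p = (\<lambda>v x. place_emb v (x (fst (ij v)) :: 'k))"
  define q where "q = (\<lambda>v x. place_emb v (x (snd (ij v)) :: 'k))"
  define m where "m = (\<lambda>v x. max (cmod (p v x)) (cmod (q v x)))"
  have m_le: "m v x ^ place_deg v \<le> local_max {..n} x v" if v: "v \<in> inf_places" for v x
  proof -
    have "fst (ij v) \<le> n" "snd (ij v) \<le> n" using ij(1)[of v] by (auto simp: Pairs_def)
    then show ?thesis
      using place_abs_le_local_max[of "{..n}" "fst (ij v)" v x] place_abs_le_local_max[of "{..n}" "snd (ij v)" v x]
        inf_place_cases(2)[OF v]
      by (auto simp: m_def p_def q_def max_def)
  qed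
  have separation: "line_height n L \<le> \<epsilon> ^ d * B\<^sup>2"
    if PQ: "P \<in> bounded_points n L B" "Q \<in> bounded_points n L B" "P \<noteq> Q" and \<epsilon>: "\<epsilon> > 0"
      and close: "\<And>v. v \<in> inf_places \<Longrightarrow> cmod (p v (rep P) * q v (rep Q) - q v (rep P) * p v (rep Q))
        \<le> \<epsilon> * (m v (rep P) * m v (rep Q))" for P Q \<epsilon>
  proof -
    define x y where "x = rep P" and "y = rep Q"
    have P: "P \<in> line_points n L" "coord_height {..n} x \<le> B"
      and Q: "Q \<in> line_points n L" "coord_height {..n} y \<le> B"
      using PQ by (auto simp: bounded_points_def point_height_def x_def y_def rep_def)
    note x = rep[OF P(1), folded x_def] and y = rep[OF Q(1), folded y_def]
    obtain \<alpha> \<beta> where \<alpha>\<beta>: "\<forall>i. x i = \<alpha> * a i + \<beta> * b i"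
      using x(1) unfolding basis(3)[symmetric] span_pair by blast
    obtain \<gamma> \<delta> where \<gamma>\<delta>: "\<forall>i. y i = \<gamma> * a i + \<delta> * b i"
      using y(1) unfolding basis(3)[symmetric] span_pair by blast
    define \<Delta> where "\<Delta> = \<alpha> * \<delta> - \<beta> * \<gamma>"
    have pl: "pluecker x y = (\<lambda>ij. \<Delta> * D ij)"
      unfolding \<Delta>_def D_def by (rule pluecker_combination[OF \<alpha>\<beta> \<gamma>\<delta>])
    have "\<Delta> \<noteq> 0"
    proof
      assume "\<Delta> = 0"
      then have det: "\<alpha> * \<delta> = \<beta> * \<gamma>" by (simp add: \<Delta>_def)
      have "\<exists>c. \<forall>i. y i = c * x i"
      proof (cases "\<alpha> = 0")
        case False
        then have "\<delta> = \<gamma> / \<alpha> * \<beta>" "\<gamma> = \<gamma> / \<alpha> * \<alpha>" using det by (simp_all add: field_simps)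
        then have "y i = \<gamma> / \<alpha> * x i" for i
          using \<alpha>\<beta> \<gamma>\<delta> by (metis distrib_left mult.assoc)
        then show ?thesis by blast
      next
        case True
        then have "\<beta> \<noteq> 0" using \<alpha>\<beta> x(2) by (auto simp: fun_eq_iff)
        then have "\<gamma> = 0" using det True by simp
        then have "y i = \<delta> / \<beta> * x i" for i
          using \<alpha>\<beta> \<gamma>\<delta> True \<open>\<beta> \<noteq> 0\<close> by simp
        then show ?thesis by blast
      qed
      then obtain c where c: "\<forall>i. y i = c * x i" by blast
      then have "c \<noteq> 0" using y(2) by (auto simp: fun_eq_iff)
      moreover have "y = vec_scale c x" using c by (auto simp: vec_scale_def)
      ultimately have "(x, y) \<in> proj_rel n" using x(2) y(2) by (auto simp: proj_rel_def)
      then have "P = Q" using equiv_class_eq[OF equiv_proj_rel] x(3) y(3) by metis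
      with PQ(3) show False by simp
    qed
    obtain i where i: "i \<in> {..n}" "x i \<noteq> 0"
      using x(2) by (auto simp: coord_space_def fun_eq_iff) (metis leI)
    obtain j where j: "j \<in> {..n}" "y j \<noteq> 0"
      using y(2) by (auto simp: coord_space_def fun_eq_iff) (metis leI)
    have pl_nz: "pluecker x y ij0 \<noteq> 0" using ij0 \<open>\<Delta> \<noteq> 0\<close> by (simp add: pl)
    have "line_height n L = coord_height Pairs (pluecker x y)"
      unfolding H pl
      by (rule coord_height_scale[OF nf fin_Pairs, where x = D, OF ij0 \<open>\<Delta> \<noteq> 0\<close>, symmetric])
    also have "\<dots> \<le> \<epsilon> ^ d * (coord_height {..n} x * coord_height {..n} y)"
      unfolding coord_height_eq d_def
    proof (rule place_prod_le[OF nf])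
      show "finite {v \<in> places. local_max Pairs (pluecker x y) v \<noteq> 1}"
        by (rule finite_local_max_support[OF nf fin_Pairs, where x = "pluecker x y", OF ij0(1) pl_nz])
      show "finite {v \<in> places. local_max {..n} x v \<noteq> 1}"
        by (rule finite_local_max_support[OF nf _, where x = x, OF _ i]) simp
      show "finite {v \<in> places. local_max {..n} y v \<noteq> 1}"
        by (rule finite_local_max_support[OF nf _, where x = y, OF _ j]) simp
      fix v :: "'k place" assume v: "v \<in> places"
      show "0 < local_max Pairs (pluecker x y) v"
        by (rule local_max_pos[OF nf fin_Pairs, where x = "pluecker x y", OF ij0(1) pl_nz v])
      show "local_max Pairs (pluecker x y) v \<le>
          \<epsilon> ^ place_deg v * (local_max {..n} x v * local_max {..n} y v)"
      proof (cases "v \<in> inf_places")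
        case False
        then have "v \<in> fin_places" using v by (simp add: places_eq)
        then show ?thesis
          using local_max_pluecker_finite[OF _ n, of v x y] by (auto simp: fin_places_def Pairs_def)
      next
        case True
        note e = inf_place_cases[OF True]
        interpret e: field_hom "place_emb v" using e(1) by (rule embedding_field_hom)
        have "local_max Pairs (pluecker x y) v = place_abs v \<Delta> * local_max Pairs D v"
          unfolding pl by (rule local_max_scale[OF nf fin_Pairs ne_Pairs v])
        also have "\<dots> = place_abs v (pluecker x y (ij v))"
          by (simp add: pl place_abs_mult[OF nf v] ij(2))
        also have "\<dots> = cmod (p v x * q v y - q v x * p v y) ^ place_deg v"
          by (simp add: e(2) pluecker_def case_prod_unfold e.hom_minus e.hom_mult p_def q_def)
        also have "\<dots> \<le> (\<epsilon> * (m v x * m v y)) ^ place_deg v"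
          using close[OF True] by (intro power_mono) (simp_all add: x_def y_def)
        also have "\<dots> = \<epsilon> ^ place_deg v * (m v x ^ place_deg v * m v y ^ place_deg v)"
          by (simp add: power_mult_distrib)
        also have "\<dots> \<le> \<epsilon> ^ place_deg v * (local_max {..n} x v * local_max {..n} y v)"
        proof (intro mult_left_mono mult_mono m_le[OF True])
          have nonneg: "0 \<le> m v z" for z by (simp add: m_def le_max_iff_disj)
          show "0 \<le> m v y ^ place_deg v" using nonneg by simp
          show "0 \<le> local_max {..n} x v" using nonneg[of x] m_le[OF True, of x] by (meson order_trans zero_le_power)
        qed (use \<epsilon> in simp)
        finally show ?thesis .
      qed
    qed
    also have "\<dots> \<le> \<epsilon> ^ d * (B * B)"
      using P(2) Q(2) \<epsilon> B coord_height_pos[OF nf _, where x = x, OF _ i] coord_height_pos[OF nf _, where x = y, OF _ j]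
      by (intro mult_left_mono mult_mono) (auto intro: less_imp_le)
    finally show ?thesis by (simp add: power2_eq_square)
  qed
  (* With this choice two distinct points in the same cell at every infinite place would violate
     the separation by a factor of two. *)
  define \<epsilon> where "\<epsilon> = root d (line_height n L / (2 * B\<^sup>2))"
  have "d > 0" unfolding d_def by (rule place_deg_sum_pos[OF nf])
  then have \<epsilon>: "\<epsilon> > 0" "\<epsilon> ^ d = line_height n L / (2 * B\<^sup>2)"
    using H_pos B by (simp_all add: \<epsilon>_def)
  have far: "P = Q" if "P \<in> bounded_points n L B" "Q \<in> bounded_points n L B"
    "\<And>v. v \<in> inf_places \<Longrightarrow> cmod (p v (rep P) * q v (rep Q) - q v (rep P) * p v (rep Q))
        \<le> \<epsilon> * (m v (rep P) * m v (rep Q))" for P Q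
  proof (rule ccontr)
    assume "P \<noteq> Q"
    from separation[OF that(1,2) this \<epsilon>(1) that(3)] have "line_height n L \<le> line_height n L / 2"
      using B by (simp add: \<epsilon>(2))
    with H_pos show False by simp
  qed
  show ?thesis
  proof (cases "\<epsilon> \<le> 2")
    case False
    (* Any two points satisfy the closeness condition with the constant 2. *)
    have same: "P = Q" if "P \<in> bounded_points n L B" "Q \<in> bounded_points n L B" for P Q
    proof (rule far[OF that])
      fix v
      have "2 * (m v (rep P) * m v (rep Q)) \<le> \<epsilon> * (m v (rep P) * m v (rep Q))"
        using False by (intro mult_right_mono mult_nonneg_nonneg) (auto simp: m_def le_max_iff_disj)
      then show "cmod (p v (rep P) * q v (rep Q) - q v (rep P) * p v (rep Q)) \<le> \<epsilon> * (m v (rep P) * m v (rep Q))"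
        using cross_le[of "p v (rep P)" "q v (rep Q)" "q v (rep P)" "p v (rep Q)"] unfolding m_def by linarith
    qed
    have "\<exists>P. bounded_points n L B \<subseteq> {P}"
      using same by (cases "bounded_points n L B = {}") blast+
    then obtain P where P: "bounded_points n L B \<subseteq> {P}" ..
    then have "finite (bounded_points n L B)" "card (bounded_points n L B) \<le> 1"
      using finite_subset[OF P] card_mono[OF _ P] by auto
    moreover have "0 \<le> 2 * 20 ^ place_deg_sum TYPE('k) / line_height n L * B\<^sup>2"
      using H_pos by simp
    ultimately show ?thesis by (simp add: line_count_def)
  next
    case True
    define \<delta> where "\<delta> = \<epsilon> / 2"
    have \<delta>: "0 < \<delta>" "\<delta> \<le> 1" "\<epsilon> = 2 * \<delta>" using \<epsilon>(1) True by (auto simp: \<delta>_def)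
    define \<kappa> where "\<kappa> = (\<lambda>P. \<lambda>v\<in>inf_places. cell \<delta> (p v (rep P)) (q v (rep P)))"
    have inj: "inj_on \<kappa> (bounded_points n L B)"
    proof (rule inj_onI)
      fix P Q assume PQ: "P \<in> bounded_points n L B" "Q \<in> bounded_points n L B" "\<kappa> P = \<kappa> Q"
      show "P = Q"
      proof (rule far[OF PQ(1,2)])
        fix v :: "'k place" assume v: "v \<in> inf_places"
        have "cell \<delta> (p v (rep P)) (q v (rep P)) = cell \<delta> (p v (rep Q)) (q v (rep Q))"
          using fun_cong[OF PQ(3), of v] v by (simp add: \<kappa>_def)
        from cell_eq_close[OF \<delta>(1) this]
        show "cmod (p v (rep P) * q v (rep Q) - q v (rep P) * p v (rep Q)) \<le> \<epsilon> * (m v (rep P) * m v (rep Q))"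
          by (simp add: m_def \<delta>(3))
      qed
    qed
    define C where "C = PiE (inf_places :: 'k place set) (\<lambda>v. cells \<delta> (place_deg v))"
    note fin_inf = prod_inf_places(1)[OF nf]
    have deg: "place_deg v = 1 \<or> place_deg v = 2" if "v \<in> inf_places" for v :: "'k place"
      using inf_place_cases(3)[OF that] by auto
    have fin_C: "finite C"
      unfolding C_def using fin_inf card_cells(1)[OF \<delta>(1,2) deg] by (intro finite_PiE) auto
    have sub: "\<kappa> ` bounded_points n L B \<subseteq> C"
    proof safe
      fix P
      have "cell \<delta> (p v (rep P)) (q v (rep P)) \<in> cells \<delta> (place_deg v)" if v: "v \<in> inf_places" for v :: "'k place"
        using inf_place_cases(3)[OF v] by (intro cell_in_cells[OF \<delta>(1)]) (auto simp: p_def q_def)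
      then show "\<kappa> P \<in> C" by (auto simp: \<kappa>_def C_def)
    qed
    have fin: "finite (bounded_points n L B)"
      by (rule inj_on_finite[OF inj sub fin_C])
    have "real (line_count n L B) \<le> real (card C)"
      unfolding line_count_def using card_inj_on_le[OF inj sub fin_C] by simp
    also have "\<dots> = (\<Prod>v\<in>(inf_places :: 'k place set). real (card (cells \<delta> (place_deg v))))"
      by (simp add: C_def card_PiE fin_inf)
    also have "\<dots> \<le> (\<Prod>v\<in>(inf_places :: 'k place set). (10 / \<delta>) ^ place_deg v)"
      using card_cells(2)[OF \<delta>(1,2) deg] by (intro prod_mono) auto
    also have "\<dots> = (10 / \<delta>) ^ d" by (simp add: d_def place_deg_sum_def power_sum)
    also have "10 / \<delta> = 20 / \<epsilon>" by (simp add: \<delta>_def)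
    also have "(20 / \<epsilon>) ^ d = 20 ^ d / \<epsilon> ^ d" by (rule power_divide)
    also have "\<dots> = (2 * 20 ^ d) / line_height n L * B\<^sup>2"
      using H_pos B by (simp add: \<epsilon>(2) field_simps)
    finally show ?thesis using fin by (simp add: d_def)
  qed
qed

end

theorem theorem2p1:
  assumes "number_field TYPE('k::field_char_0)"
  shows "\<exists>c::real. c > 0 \<and>
    (\<forall>n\<ge>1. \<forall>L::(nat \<Rightarrow> 'k) set. proj_line n L \<longrightarrow> (\<forall>B::real. B > 0 \<longrightarrow>
       finite (bounded_points n L B) \<and>
       real (line_count n L B) \<le> c / line_height n L * B\<^sup>2 + 1))"
proof (intro exI[of _ "2 * 20 ^ place_deg_sum TYPE('k)"] conjI[of "_ > _"] allI impI)
  fix n :: nat and L :: "(nat \<Rightarrow> 'k) set" and B :: real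
  assume "n \<ge> 1" "proj_line n L" "B > 0"
  then show "finite (bounded_points n L B) \<and>
      real (line_count n L B) \<le> 2 * 20 ^ place_deg_sum TYPE('k) / line_height n L * B\<^sup>2 + 1"
    by (rule line_count_bound[OF assms])
qed simp

end
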